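(* Let $(M,g,\psi)$ be a seven-dimensional Riemannian manifold which admits a $G_2$-structure, given by a three-form $\psi$. Then $\psi$ and its Hodge dual $*\psi$ are generalized calibrations on $M$ of degree three and four, respectively. In both cases the contact set at every point of $M$ is $G_2/SO(4)$ (a single orbit of the group $G_2\subset SO(T_pM)$ preserving $\psi_p$, with stabilizer $SO(4)$).
   Context: A $G_2$-structure here means that $\psi$ is a three-form such that near each point there is an orthonormal coframe $\{e^1,\dots,e^7\}$ of $g$ with $\psi=e^{123}+e^1\wedge(e^{45}-e^{67})+e^2\wedge(e^{46}+e^{57})+e^3\wedge(e^{47}-e^{56})$, where $e^{ij}=e^i\wedge e^j$ etc.; equivalently $(M,g)$ carries a metric connection, possibly with torsion, with holonomy contained in $G_2$ and $\psi$ parallel. $\psi$, $*\psi$ are not assumed closed. A generalized calibration of degree $m$ is an $m$-form $\phi$ (not necessarily closed) such that $\phi(\xi)|_p\le1$ for every $p\in M$ and every oriented $m$-plane $\xi\subset T_pM$, where $\phi(\xi)$ is $\phi$ evaluated on an oriented orthonormal basis of $\xi$. The contact set at $p$ is the set of oriented $m$-planes $\xi\subset T_pM$ with $\phi(\xi)=1$. *)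

theory Defs
  imports
    "HOL-Analysis.Analysis"
    "HOL-Algebra.Group_Action"
    "HOL-Combinatorics.Permutations"
    "HOL-Library.Function_Algebras"
    "Jordan_Normal_Form.Determinant"
begin

instantiation "fun" :: (type, real_vector) real_vector
begin

definition scaleR_fun_def: "a *\<^sub>R f = (\<lambda>x. a *\<^sub>R f x)"

instance
  by intro_classes (auto simp: scaleR_fun_def fun_eq_iff scaleR_add_right scaleR_add_left)

end


section \<open>Smooth manifolds and tangent vectors\<close>

text \<open>\<open>Ck_on k S f\<close> says that \<open>f\<close> is of class \<open>C\<^sup>k\<close> on \<open>S\<close>. It is meant for open \<open>S\<close> in a
  finite-dimensional space; the continuity of all directional derivatives is then the
  continuity of the derivative.\<close>

primrec Ck_on :: "nat \<Rightarrow> 'e::real_normed_vector set \<Rightarrow> ('e \<Rightarrow> 'f::real_normed_vector) \<Rightarrow> bool" where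
  "Ck_on 0 S f \<longleftrightarrow> continuous_on S f"
| "Ck_on (Suc k) S f \<longleftrightarrow>
     (\<forall>x\<in>S. f differentiable (at x)) \<and> (\<forall>v. Ck_on k S (\<lambda>x. frechet_derivative f (at x) v))"

definition smooth_on :: "'e::real_normed_vector set \<Rightarrow> ('e \<Rightarrow> 'f::real_normed_vector) \<Rightarrow> bool" where
  "smooth_on S f \<longleftrightarrow> (\<forall>k. Ck_on k S f)"

type_synonym ('a, 'n) chart = "'a set \<times> ('a \<Rightarrow> real ^ 'n)"

definition chart_on :: "'a topology \<Rightarrow> ('a, 'n::finite) chart \<Rightarrow> bool" where
  "chart_on X c \<longleftrightarrow> openin X (fst c) \<and> open (snd c ` fst c) \<and>
     homeomorphic_map (subtopology X (fst c)) (top_of_set (snd c ` fst c)) (snd c)"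

definition chart_inv :: "('a, 'n::finite) chart \<Rightarrow> real ^ 'n \<Rightarrow> 'a" where
  "chart_inv c = inv_into (fst c) (snd c)"

definition transition :: "('a, 'n::finite) chart \<Rightarrow> ('a, 'n) chart \<Rightarrow> real ^ 'n \<Rightarrow> real ^ 'n" where
  "transition c c' = snd c' \<circ> chart_inv c"

definition second_countable_space :: "'a topology \<Rightarrow> bool" where
  "second_countable_space X \<longleftrightarrow>
     (\<exists>\<B>. countable \<B> \<and> (\<forall>B\<in>\<B>. openin X B) \<and> (\<forall>U. openin X U \<longrightarrow> (\<exists>\<C>\<subseteq>\<B>. U = \<Union>\<C>)))"

text \<open>The atlas is not required to be maximal.\<close>

definition smooth_manifold :: "'a topology \<Rightarrow> ('a, 'n::finite) chart set \<Rightarrow> bool" where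
  "smooth_manifold X \<A> \<longleftrightarrow>
     Hausdorff_space X \<and> second_countable_space X \<and>
     (\<forall>c\<in>\<A>. chart_on X c) \<and> (\<Union>c\<in>\<A>. fst c) = topspace X \<and>
     (\<forall>c\<in>\<A>. \<forall>c'\<in>\<A>. smooth_on (snd c ` (fst c \<inter> fst c')) (transition c c'))"

text \<open>A tangent vector at \<open>p\<close> is the family of its components in all charts around \<open>p\<close>, which
  transform by the derivatives of the coordinate changes; the entries at all other charts
  are \<open>0\<close>. Vector space operations are those of the function type.\<close>

type_synonym ('a, 'n) tangent = "('a, 'n) chart \<Rightarrow> real ^ 'n"

definition charts_at :: "('a, 'n::finite) chart set \<Rightarrow> 'a \<Rightarrow> ('a, 'n) chart set" where
  "charts_at \<A> p = {c \<in> \<A>. p \<in> fst c}"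

definition tangent_space :: "('a, 'n::finite) chart set \<Rightarrow> 'a \<Rightarrow> ('a, 'n) tangent set" where
  "tangent_space \<A> p = {v. (\<forall>c. c \<notin> charts_at \<A> p \<longrightarrow> v c = 0) \<and>
     (\<forall>c\<in>charts_at \<A> p. \<forall>c'\<in>charts_at \<A> p.
        v c' = frechet_derivative (transition c c') (at (snd c p)) (v c))}"

text \<open>The tangent vector at \<open>p\<close> whose components in the chart \<open>c\<close> are \<open>u\<close>; as \<open>p\<close> varies this is
  the coordinate vector field of \<open>c\<close> with constant coefficients \<open>u\<close>.\<close>

definition coord_vector ::
    "('a, 'n::finite) chart set \<Rightarrow> ('a, 'n) chart \<Rightarrow> real ^ 'n \<Rightarrow> 'a \<Rightarrow> ('a, 'n) tangent" where
  "coord_vector \<A> c u p = (\<lambda>c'. if c' \<in> charts_at \<A> p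
     then frechet_derivative (transition c c') (at (snd c p)) u else 0)"


section \<open>Riemannian metrics and oriented planes\<close>

definition inner_product_on :: "'v::real_vector set \<Rightarrow> ('v \<Rightarrow> 'v \<Rightarrow> real) \<Rightarrow> bool" where
  "inner_product_on V h \<longleftrightarrow>
     (\<forall>x\<in>V. \<forall>y\<in>V. h x y = h y x) \<and>
     (\<forall>x\<in>V. \<forall>y\<in>V. \<forall>z\<in>V. \<forall>a. h (x + a *\<^sub>R y) z = h x z + a * h y z) \<and>
     (\<forall>x\<in>V. x \<noteq> 0 \<longrightarrow> h x x > 0)"

definition riemannian_metric :: "'a topology \<Rightarrow> ('a, 'n::finite) chart set \<Rightarrow>
    ('a \<Rightarrow> ('a, 'n) tangent \<Rightarrow> ('a, 'n) tangent \<Rightarrow> real) \<Rightarrow> bool" where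
  "riemannian_metric X \<A> g \<longleftrightarrow>
     (\<forall>p\<in>topspace X. inner_product_on (tangent_space \<A> p) (g p)) \<and>
     (\<forall>c\<in>\<A>. \<forall>u w. smooth_on (snd c ` fst c)
        (\<lambda>x. g (chart_inv c x) (coord_vector \<A> c u (chart_inv c x))
                               (coord_vector \<A> c w (chart_inv c x))))"

definition orthonormal_frames ::
    "'v::real_vector set \<Rightarrow> ('v \<Rightarrow> 'v \<Rightarrow> real) \<Rightarrow> nat \<Rightarrow> 'v list set" where
  "orthonormal_frames V h m = {vs. length vs = m \<and> set vs \<subseteq> V \<and>
     (\<forall>i<m. \<forall>j<m. h (vs ! i) (vs ! j) = (if i = j then 1 else 0))}"

definition orthonormal_bases :: "'v::real_vector set \<Rightarrow> ('v \<Rightarrow> 'v \<Rightarrow> real) \<Rightarrow> 'v list set" where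
  "orthonormal_bases V h = {E. E \<in> orthonormal_frames V h (length E) \<and> span (set E) = V}"

text \<open>The determinant of the matrix \<open>(h v\<^sub>i w\<^sub>j)\<close>. For orthonormal bases \<open>vs\<close>, \<open>ws\<close> of the same
  subspace this is the determinant of the change of basis.\<close>

definition frame_det :: "('v \<Rightarrow> 'v \<Rightarrow> real) \<Rightarrow> 'v list \<Rightarrow> 'v list \<Rightarrow> real" where
  "frame_det h vs ws =
     Determinant.det (Matrix.mat (length vs) (length ws) (\<lambda>(i, j). h (vs ! i) (ws ! j)))"

definition same_oriented_plane ::
    "'v::real_vector set \<Rightarrow> ('v \<Rightarrow> 'v \<Rightarrow> real) \<Rightarrow> nat \<Rightarrow> ('v list \<times> 'v list) set" where
  "same_oriented_plane V h m = {(vs, ws). vs \<in> orthonormal_frames V h m \<and>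
     ws \<in> orthonormal_frames V h m \<and> span (set vs) = span (set ws) \<and> frame_det h vs ws > 0}"

text \<open>An oriented \<open>m\<close>-plane is represented by the set of its oriented orthonormal bases.\<close>

definition oriented_planes ::
    "'v::real_vector set \<Rightarrow> ('v \<Rightarrow> 'v \<Rightarrow> real) \<Rightarrow> nat \<Rightarrow> 'v list set set" where
  "oriented_planes V h m = orthonormal_frames V h m // same_oriented_plane V h m"


section \<open>Differential forms\<close>

text \<open>Alternating forms on the subspace \<open>V\<close>, as functions of the list of arguments that vanish
  outside their proper domain (the lists of length \<open>m\<close> over \<open>V\<close>).\<close>

definition alternating_forms :: "'v::real_vector set \<Rightarrow> nat \<Rightarrow> ('v list \<Rightarrow> real) set" where
  "alternating_forms V m = {\<phi>.
     (\<forall>vs. \<not> (length vs = m \<and> set vs \<subseteq> V) \<longrightarrow> \<phi> vs = 0) \<and>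
     (\<forall>vs i x y a. length vs = m \<longrightarrow> set vs \<subseteq> V \<longrightarrow> i < m \<longrightarrow> x \<in> V \<longrightarrow> y \<in> V \<longrightarrow>
        \<phi> (vs[i := x + a *\<^sub>R y]) = \<phi> (vs[i := x]) + a * \<phi> (vs[i := y])) \<and>
     (\<forall>vs i j. length vs = m \<longrightarrow> set vs \<subseteq> V \<longrightarrow> i < j \<longrightarrow> j < m \<longrightarrow> vs ! i = vs ! j \<longrightarrow> \<phi> vs = 0)}"

text \<open>Normalized so that a product of 1-forms is the determinant of their values.\<close>

definition wedge ::
    "nat \<Rightarrow> nat \<Rightarrow> ('v list \<Rightarrow> real) \<Rightarrow> ('v list \<Rightarrow> real) \<Rightarrow> 'v list \<Rightarrow> real" where
  "wedge k l \<alpha> \<beta> = (\<lambda>vs. if length vs = k + l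
     then (\<Sum>\<sigma> | \<sigma> permutes {..<k + l}. of_int (sign \<sigma>) *
             \<alpha> (map (\<lambda>i. vs ! \<sigma> i) [0..<k]) * \<beta> (map (\<lambda>i. vs ! \<sigma> i) [k..<k + l]))
          / (fact k * fact l)
     else 0)"

definition smooth_form_on :: "('a, 'n::finite) chart set \<Rightarrow> 'a set \<Rightarrow> nat \<Rightarrow>
    ('a \<Rightarrow> ('a, 'n) tangent list \<Rightarrow> real) \<Rightarrow> bool" where
  "smooth_form_on \<A> W m \<omega> \<longleftrightarrow>
     (\<forall>q\<in>W. \<omega> q \<in> alternating_forms (tangent_space \<A> q) m) \<and>
     (\<forall>c\<in>\<A>. \<forall>us. length us = m \<longrightarrow> smooth_on (snd c ` (fst c \<inter> W))
        (\<lambda>x. \<omega> (chart_inv c x) (map (\<lambda>u. coord_vector \<A> c u (chart_inv c x)) us)))"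

text \<open>The Hodge dual of the \<open>k\<close>-form \<open>\<beta>\<close> with respect to the volume form \<open>vol\<close> of an orientation:
  \<open>(*\<beta>)\<^sub>j\<^sub>1\<^sub>.\<^sub>.\<^sub>.\<^sub>j\<^sub>l = 1/k! \<Sum> \<beta>\<^sub>i\<^sub>1\<^sub>.\<^sub>.\<^sub>.\<^sub>i\<^sub>k vol\<^sub>i\<^sub>1\<^sub>.\<^sub>.\<^sub>.\<^sub>i\<^sub>k\<^sub>j\<^sub>1\<^sub>.\<^sub>.\<^sub>.\<^sub>j\<^sub>l\<close> in an orthonormal basis, whose choice does not matter.
  Thus \<open>*(e\<^sup>1 \<and> \<dots> \<and> e\<^sup>k) = e\<^sup>k\<^sup>+\<^sup>1 \<and> \<dots> \<and> e\<^sup>n\<close> for every oriented orthonormal coframe.\<close>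

definition hodge_dual :: "'v::real_vector set \<Rightarrow> ('v \<Rightarrow> 'v \<Rightarrow> real) \<Rightarrow> ('v list \<Rightarrow> real) \<Rightarrow>
    nat \<Rightarrow> ('v list \<Rightarrow> real) \<Rightarrow> 'v list \<Rightarrow> real" where
  "hodge_dual V h vol k \<beta> =
     (let E = (SOME E. E \<in> orthonormal_bases V h)
      in (\<lambda>ws. (\<Sum>js | length js = k \<and> set js \<subseteq> {..<length E}.
                  \<beta> (map ((!) E) js) * vol (map ((!) E) js @ ws)) / fact k))"


section \<open>Generalized calibrations\<close>

text \<open>The value does not depend on the choice of the oriented orthonormal basis.\<close>

definition form_on_plane :: "('v list \<Rightarrow> real) \<Rightarrow> 'v list set \<Rightarrow> real" where
  "form_on_plane \<phi> \<xi> = \<phi> (SOME vs. vs \<in> \<xi>)"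

definition generalized_calibration :: "'a topology \<Rightarrow> ('a, 'n::finite) chart set \<Rightarrow>
    ('a \<Rightarrow> ('a, 'n) tangent \<Rightarrow> ('a, 'n) tangent \<Rightarrow> real) \<Rightarrow> nat \<Rightarrow>
    ('a \<Rightarrow> ('a, 'n) tangent list \<Rightarrow> real) \<Rightarrow> bool" where
  "generalized_calibration X \<A> g m \<phi> \<longleftrightarrow>
     smooth_form_on \<A> (topspace X) m \<phi> \<and>
     (\<forall>p\<in>topspace X. \<forall>\<xi>\<in>oriented_planes (tangent_space \<A> p) (g p) m. form_on_plane (\<phi> p) \<xi> \<le> 1)"

definition contact_set :: "'v::real_vector set \<Rightarrow> ('v \<Rightarrow> 'v \<Rightarrow> real) \<Rightarrow> nat \<Rightarrow>
    ('v list \<Rightarrow> real) \<Rightarrow> 'v list set set" where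
  "contact_set V h m \<phi> = {\<xi> \<in> oriented_planes V h m. form_on_plane \<phi> \<xi> = 1}"


section \<open>\<open>G\<^sub>2\<close>-structures\<close>

text \<open>A coframe \<open>e\<^sup>1, e\<^sup>2, \<dots>\<close> is orthonormal if it is dual to an orthonormal basis. The index of \<open>e\<close>
  starts at 1, positions in lists start at 0.\<close>

definition orthonormal_coframe :: "'v::real_vector set \<Rightarrow> ('v \<Rightarrow> 'v \<Rightarrow> real) \<Rightarrow>
    (nat \<Rightarrow> 'v list \<Rightarrow> real) \<Rightarrow> bool" where
  "orthonormal_coframe V h e \<longleftrightarrow> (\<exists>E\<in>orthonormal_bases V h. \<forall>i\<in>{1..length E}.
     e i \<in> alternating_forms V 1 \<and>
     (\<forall>j\<in>{1..length E}. e i [E ! (j - 1)] = (if i = j then 1 else 0)))"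

definition g2_form :: "(nat \<Rightarrow> 'v list \<Rightarrow> real) \<Rightarrow> 'v list \<Rightarrow> real" where
  "g2_form e =
     (let e2 = (\<lambda>i j. wedge 1 1 (e i) (e j))
      in wedge 1 2 (e 1) (e2 2 3) +
         wedge 1 2 (e 1) (e2 4 5 - e2 6 7) +
         wedge 1 2 (e 2) (e2 4 6 + e2 5 7) +
         wedge 1 2 (e 3) (e2 4 7 - e2 5 6))"

definition g2_coframe :: "'v::real_vector set \<Rightarrow> ('v \<Rightarrow> 'v \<Rightarrow> real) \<Rightarrow> ('v list \<Rightarrow> real) \<Rightarrow>
    (nat \<Rightarrow> 'v list \<Rightarrow> real) \<Rightarrow> bool" where
  "g2_coframe V h \<psi> e \<longleftrightarrow> orthonormal_coframe V h e \<and> \<psi> = g2_form e"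

definition g2_structure :: "'a topology \<Rightarrow> ('a, 7) chart set \<Rightarrow>
    ('a \<Rightarrow> ('a, 7) tangent \<Rightarrow> ('a, 7) tangent \<Rightarrow> real) \<Rightarrow>
    ('a \<Rightarrow> ('a, 7) tangent list \<Rightarrow> real) \<Rightarrow> bool" where
  "g2_structure X \<A> g \<psi> \<longleftrightarrow>
     smooth_form_on \<A> (topspace X) 3 \<psi> \<and>
     (\<forall>p\<in>topspace X. \<exists>W e. openin X W \<and> p \<in> W \<and>
        (\<forall>i\<in>{1..7}. smooth_form_on \<A> W 1 (e i)) \<and>
        (\<forall>q\<in>W. g2_coframe (tangent_space \<A> q) (g q) (\<psi> q) (\<lambda>i. e i q)))"

text \<open>The volume form \<open>e\<^sup>1 \<and> \<dots> \<and> e\<^sup>7\<close> of the orientation induced by \<open>\<psi>\<close>. It does not depend on the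
  coframe, since orthogonal maps that preserve \<open>\<psi>\<close> have determinant 1.\<close>

definition g2_volume :: "'v::real_vector set \<Rightarrow> ('v \<Rightarrow> 'v \<Rightarrow> real) \<Rightarrow> ('v list \<Rightarrow> real) \<Rightarrow>
    'v list \<Rightarrow> real" where
  "g2_volume V h \<psi> =
     (let e = (SOME e. g2_coframe V h \<psi> e)
      in (\<lambda>vs. if length vs = 7
               then Determinant.det (Matrix.mat 7 7 (\<lambda>(i, j). e (Suc i) [vs ! j]))
               else 0))"

definition g2_dual :: "('a, 7) chart set \<Rightarrow>
    ('a \<Rightarrow> ('a, 7) tangent \<Rightarrow> ('a, 7) tangent \<Rightarrow> real) \<Rightarrow>
    ('a \<Rightarrow> ('a, 7) tangent list \<Rightarrow> real) \<Rightarrow> 'a \<Rightarrow> ('a, 7) tangent list \<Rightarrow> real" where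
  "g2_dual \<A> g \<psi> p =
     hodge_dual (tangent_space \<A> p) (g p) (g2_volume (tangent_space \<A> p) (g p) (\<psi> p)) 3 (\<psi> p)"


section \<open>The groups \<open>G\<^sub>2\<close> and \<open>SO(4)\<close>\<close>

text \<open>Endomorphisms of \<open>V\<close> are represented by extensional functions.\<close>

definition special_orthogonal :: "'v::real_vector set \<Rightarrow> ('v \<Rightarrow> 'v \<Rightarrow> real) \<Rightarrow> ('v \<Rightarrow> 'v) set" where
  "special_orthogonal V h = {A \<in> V \<rightarrow>\<^sub>E V.
     (\<forall>x\<in>V. \<forall>y\<in>V. \<forall>a. A (x + a *\<^sub>R y) = A x + a *\<^sub>R A y) \<and>
     (\<forall>x\<in>V. \<forall>y\<in>V. h (A x) (A y) = h x y) \<and>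
     (\<forall>E\<in>orthonormal_bases V h. frame_det h E (map A E) = 1)}"

definition g2_group :: "'v::real_vector set \<Rightarrow> ('v \<Rightarrow> 'v \<Rightarrow> real) \<Rightarrow> ('v list \<Rightarrow> real) \<Rightarrow>
    ('v \<Rightarrow> 'v) monoid" where
  "g2_group V h \<psi> =
     \<lparr>carrier = {A \<in> special_orthogonal V h. \<forall>vs. set vs \<subseteq> V \<longrightarrow> \<psi> (map A vs) = \<psi> vs},
      monoid.mult = (\<lambda>A B. compose V A B), one = (\<lambda>x\<in>V. x)\<rparr>"

definition SO4 :: "(real ^ 4 ^ 4) monoid" where
  "SO4 = \<lparr>carrier = {Q. rotation_matrix Q}, monoid.mult = (**), one = Finite_Cartesian_Product.mat 1\<rparr>"

definition plane_action :: "('v \<Rightarrow> 'v) \<Rightarrow> 'v list set \<Rightarrow> 'v list set" where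
  "plane_action A \<xi> = map A ` \<xi>"

text \<open>Isomorphism of topological groups. Endomorphisms of a tangent space carry the topology of
  the function type, i.e. that of pointwise convergence; on linear maps of a
  finite-dimensional space this is the usual topology.\<close>

definition topological_group_iso ::
    "'s::topological_space monoid \<Rightarrow> 't::topological_space monoid \<Rightarrow> bool" where
  "topological_group_iso G H \<longleftrightarrow> (\<exists>\<Phi>\<in>iso G H.
     homeomorphic_map (top_of_set (carrier G)) (top_of_set (carrier H)) \<Phi>)"

text \<open>\<open>C\<close> is a single (nonempty) orbit of \<open>G\<close> acting on \<open>S\<close>, with stabilizers isomorphic to \<open>H\<close>.\<close>

definition homogeneous_orbit :: "'s::topological_space monoid \<Rightarrow> 'x set \<Rightarrow> ('s \<Rightarrow> 'x \<Rightarrow> 'x) \<Rightarrow>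
    't::topological_space monoid \<Rightarrow> 'x set \<Rightarrow> bool" where
  "homogeneous_orbit G S act H C \<longleftrightarrow> C \<in> orbits G S act \<and>
     (\<forall>\<xi>\<in>C. topological_group_iso (G\<lparr>carrier := stabilizer G act \<xi>\<rparr>) H)"

end

theory Submission
  imports Defs
begin

text \<open>In an adapted orthonormal frame \<open>\<psi>\<close> is the form \<open>\<langle>x \<times> y, z\<rangle>\<close> of a cross product on \<open>\<real>\<^sup>7\<close>
  with \<open>\<bar>x \<times> y\<bar>\<^sup>2 = \<bar>x\<bar>\<^sup>2\<bar>y\<bar>\<^sup>2 - \<langle>x, y\<rangle>\<^sup>2\<close>, and on orthonormal vectors \<open>*\<psi>\<close> is \<open>\<langle>x \<times> (y \<times> z), w\<rangle>\<close> with
  \<open>\<bar>x \<times> (y \<times> z)\<bar>\<^sup>2 = 1 - \<psi>(x, y, z)\<^sup>2\<close>. So both are at most 1 by Cauchy-Schwarz, with equality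
  iff \<open>z = x \<times> y\<close>, respectively \<open>\<psi>(x, y, z) = 0\<close> and \<open>w = x \<times> (y \<times> z)\<close>. Every orthonormal triple
  \<open>x, y, w\<close> with \<open>w\<close> orthogonal to \<open>x \<times> y\<close> generates an adapted frame. Hence the frames with
  value 1 are the parts \<open>e\<^sub>1, e\<^sub>2, e\<^sub>3\<close>, respectively \<open>e\<^sub>4, \<dots>, e\<^sub>7\<close>, of adapted frames, and \<open>G\<^sub>2\<close> is simply
  transitive on adapted frames. Both stabilizers consist of the elements that preserve the
  span of \<open>e\<^sub>4, \<dots>, e\<^sub>7\<close>; restriction to it is the isomorphism with \<open>SO(4)\<close>. It has an inverse because
  the columns \<open>q\<^sub>1, \<dots>, q\<^sub>4\<close> of a rotation satisfy \<open>*\<psi> = det = 1\<close>, so they complete to an adapted frame.\<close>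


section \<open>The cross product on \<open>\<real>\<^sup>7\<close>\<close>

text \<open>The definitions of \<open>*\<psi>\<close> and of the value of a form on a plane rest on
  unspecified choices: an orthonormal basis, an adapted coframe, a representative of the plane. The
  first two are neutralized by a polynomial \<open>star0\<close> on \<open>\<real>\<^sup>7\<close>
  that can be written with the cross product and the inner product alone, so that it takes the same
  value in the coordinates of every adapted frame; the Hodge sum equals it for any orthonormal basis
  by Parseval. The same freedom gives the smoothness of \<open>*\<psi>\<close>, since the pointwise
  choice may be replaced by a smooth local coframe. The cross product is not associative. The proof
  relies on the identity for \<open>a \<times> (a \<times> b)\<close> and its polarization, by which
  left multiplications by orthogonal vectors anticommute on vectors orthogonal to both. Orientations
  take care of themselves: \<open>\<psi>\<close> and \<open>*\<psi>\<close> restrict to the volume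
  forms of the spans of \<open>e\<^sub>1, e\<^sub>2, e\<^sub>3\<close> and of
  \<open>e\<^sub>4, \<dots>, e\<^sub>7\<close>, so an element of \<open>G\<^sub>2\<close> that
  preserves one of these spans cannot reverse it.\<close>

no_notation Matrix.vec_index (infixl "$" 100)
no_notation Matrix.scalar_prod (infix "\<bullet>" 70)

text \<open>The numerals of the index type \<open>7\<close> are taken modulo 7: the last coordinate is \<open>x $ 7 = x $ 0\<close>.\<close>

lemma exhaust_7: "x = 1 \<or> x = 2 \<or> x = 3 \<or> x = 4 \<or> x = 5 \<or> x = 6 \<or> x = 7" for x :: 7
proof (induct x)
  case (of_int z)
  then have "z = 0 \<or> z = 1 \<or> z = 2 \<or> z = 3 \<or> z = 4 \<or> z = 5 \<or> z = 6" by simp arith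
  then show ?case by auto
qed

lemma forall_7: "(\<forall>i::7. P i) \<longleftrightarrow> P 1 \<and> P 2 \<and> P 3 \<and> P 4 \<and> P 5 \<and> P 6 \<and> P 7"
  by (metis exhaust_7)

lemma UNIV_7: "UNIV = {1, 2, 3, 4, 5, 6, 7::7}"
  using exhaust_7 by auto

lemma sum_7: "sum f (UNIV::7 set) = f 1 + f 2 + f 3 + f 4 + f 5 + f 6 + f 7"
  unfolding UNIV_7 by (simp add: ac_simps)

lemma inner_7: "a \<bullet> b = a$1*b$1 + a$2*b$2 + a$3*b$3 + a$4*b$4 + a$5*b$5 + a$6*b$6 + a$7*b$7"
  for a b :: "real^7"
  by (simp add: inner_vec_def sum_7)

text \<open>The value of \<open>e\<^sup>i \<and> e\<^sup>j \<and> e\<^sup>k\<close> on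
  \<open>a, b, c\<close>, expanded along \<open>a\<close>. As an explicit polynomial it lets the
  simplifier verify the basic identities in coordinates.\<close>

definition minor3 :: "7 \<Rightarrow> 7 \<Rightarrow> 7 \<Rightarrow> real^7 \<Rightarrow> real^7 \<Rightarrow> real^7 \<Rightarrow> real" where
  "minor3 i j k a b c = a$i * (b$j * c$k - b$k * c$j) - a$j * (b$i * c$k - b$k * c$i)
     + a$k * (b$i * c$j - b$j * c$i)"

definition minor4 :: "7 \<Rightarrow> 7 \<Rightarrow> 7 \<Rightarrow> 7 \<Rightarrow> real^7 \<Rightarrow> real^7 \<Rightarrow> real^7 \<Rightarrow> real^7 \<Rightarrow> real" where
  "minor4 i j k l a b c d = a$i * minor3 j k l b c d - a$j * minor3 i k l b c d
     + a$k * minor3 i j l b c d - a$l * minor3 i j k b c d"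

definition psi0 :: "real^7 \<Rightarrow> real^7 \<Rightarrow> real^7 \<Rightarrow> real" where
  "psi0 a b c = minor3 1 2 3 a b c + minor3 1 4 5 a b c - minor3 1 6 7 a b c + minor3 2 4 6 a b c
     + minor3 2 5 7 a b c + minor3 3 4 7 a b c - minor3 3 5 6 a b c"

text \<open>Each term carries the indices complementary to those of the corresponding term of
  \<open>psi0\<close>. All seven shuffles are even, so the signs are those of \<open>psi0\<close>.
  That this is the Hodge dual is the content of \<open>hodge_psi0\<close>.\<close>

definition star0 :: "real^7 \<Rightarrow> real^7 \<Rightarrow> real^7 \<Rightarrow> real^7 \<Rightarrow> real" where
  "star0 a b c d = minor4 4 5 6 7 a b c d + minor4 2 3 6 7 a b c d - minor4 2 3 4 5 a b c d
     + minor4 1 3 5 7 a b c d + minor4 1 3 4 6 a b c d + minor4 1 2 5 6 a b c d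
     - minor4 1 2 4 7 a b c d"

text \<open>The vector that represents the linear form \<open>psi0 a b\<close>: the vector product
  of imaginary octonions, with signs fixed by \<open>\<psi>\<close>.\<close>

definition cross7 :: "real^7 \<Rightarrow> real^7 \<Rightarrow> real^7" where
  "cross7 a b = (\<chi> m. psi0 a b (axis m 1))"

lemma cross7_components:
  "cross7 a b $ 1 = a$2*b$3 - a$3*b$2 + a$4*b$5 - a$5*b$4 - a$6*b$7 + a$7*b$6"
  "cross7 a b $ 2 = a$3*b$1 - a$1*b$3 + a$4*b$6 - a$6*b$4 + a$5*b$7 - a$7*b$5"
  "cross7 a b $ 3 = a$1*b$2 - a$2*b$1 + a$4*b$7 - a$7*b$4 - a$5*b$6 + a$6*b$5"
  "cross7 a b $ 4 = a$5*b$1 - a$1*b$5 + a$6*b$2 - a$2*b$6 + a$7*b$3 - a$3*b$7"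
  "cross7 a b $ 5 = a$1*b$4 - a$4*b$1 + a$7*b$2 - a$2*b$7 - a$6*b$3 + a$3*b$6"
  "cross7 a b $ 6 = a$1*b$7 - a$7*b$1 + a$2*b$4 - a$4*b$2 - a$3*b$5 + a$5*b$3"
  "cross7 a b $ 7 = a$6*b$1 - a$1*b$6 + a$2*b$5 - a$5*b$2 + a$3*b$4 - a$4*b$3"
  by (simp_all add: cross7_def psi0_def minor3_def axis_def)

lemma psi0_eq_inner: "psi0 a b c = cross7 a b \<bullet> c"
  by (simp add: inner_7 cross7_components psi0_def minor3_def algebra_simps)

lemma cross7_add: "cross7 (a + a') b = cross7 a b + cross7 a' b"
    "cross7 a (b + b') = cross7 a b + cross7 a b'"
  by (simp_all add: Finite_Cartesian_Product.vec_eq_iff forall_7 cross7_components algebra_simps)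

lemma cross7_minus [simp]: "cross7 (- a) b = - cross7 a b" "cross7 a (- b) = - cross7 a b"
  by (simp_all add: Finite_Cartesian_Product.vec_eq_iff forall_7 cross7_components algebra_simps)

lemma cross7_scaleR [simp]: "cross7 (r *\<^sub>R a) b = r *\<^sub>R cross7 a b"
    "cross7 a (r *\<^sub>R b) = r *\<^sub>R cross7 a b"
  by (simp_all add: Finite_Cartesian_Product.vec_eq_iff forall_7 cross7_components algebra_simps)

lemma cross7_commute: "cross7 a b = - cross7 b a"
  by (simp add: Finite_Cartesian_Product.vec_eq_iff forall_7 cross7_components)

lemma cross7_self [simp]: "cross7 a a = 0"
  by (simp add: Finite_Cartesian_Product.vec_eq_iff forall_7 cross7_components)

text \<open>The cyclic symmetry of \<open>psi0\<close>, read as a rule for moving a factor across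
  the inner product.\<close>

lemma cross7_inner_shift: "cross7 a b \<bullet> c = a \<bullet> cross7 b c"
  by (simp add: inner_7 cross7_components algebra_simps)

text \<open>The imaginary part of the alternative law \<open>a(ab) = (aa)b\<close> of the octonions.
  It collapses double products with a repeated factor and stands in for associativity.\<close>

lemma cross7_cross7_same: "cross7 a (cross7 a b) = (a \<bullet> b) *\<^sub>R a - (a \<bullet> a) *\<^sub>R b"
  by (simp add: Finite_Cartesian_Product.vec_eq_iff forall_7 cross7_components inner_7) (simp add: algebra_simps)

text \<open>The right-hand side depends only on the cross product and the inner product. Therefore \<open>*\<psi>\<close>
  does not depend on the adapted frame, although the orientation enters into its definition.\<close>

lemma star0_eq_inner: "star0 a b c d =
    (cross7 a (cross7 b c) + (a \<bullet> b) *\<^sub>R c - (a \<bullet> c) *\<^sub>R b) \<bullet> d"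
  unfolding star0_def minor4_def minor3_def
  by (simp add: inner_7 cross7_components) (simp add: algebra_simps)


lemma cross7_inner_self [simp]: "cross7 a b \<bullet> a = 0" "cross7 a b \<bullet> b = 0"
    "a \<bullet> cross7 a b = 0" "b \<bullet> cross7 a b = 0"
  by (simp_all add: inner_7 cross7_components algebra_simps)

lemma cross7_cross7_polarized:
  "cross7 a (cross7 b c) = (a \<bullet> c) *\<^sub>R b + (b \<bullet> c) *\<^sub>R a - (2 * (a \<bullet> b)) *\<^sub>R c - cross7 b (cross7 a c)"
proof -
  have "cross7 (a + b) (cross7 (a + b) c) = ((a + b) \<bullet> c) *\<^sub>R (a + b) - ((a + b) \<bullet> (a + b)) *\<^sub>R c"
    by (rule cross7_cross7_same)
  then show ?thesis
    by (simp add: cross7_add cross7_cross7_same inner_add inner_commute[of b a] algebra_simps)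
qed

text \<open>The inner product terms of the polarized identity drop out, and only a sign remains.
  This is the rule that moves factors around in the multiplication table of an adapted
  frame.\<close>

lemma cross7_cross7_orthogonal:
  assumes "a \<bullet> b = 0" "a \<bullet> c = 0" "b \<bullet> c = 0"
  shows "cross7 a (cross7 b c) = - cross7 b (cross7 a c)"
  using cross7_cross7_polarized[of a b c] assms by simp

text \<open>Moving the first factor across the inner product leaves a double product with the
  repeated factor \<open>b\<close>.\<close>

lemma cross7_norm: "cross7 a b \<bullet> cross7 a b = (a \<bullet> a) * (b \<bullet> b) - (a \<bullet> b)\<^sup>2"
proof -
  have "cross7 a b \<bullet> cross7 a b = a \<bullet> cross7 b (- cross7 b a)"
    unfolding cross7_commute[of b a] minus_minus by (rule cross7_inner_shift)
  then show ?thesis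
    by (simp add: cross7_cross7_same inner_diff power2_eq_square inner_commute)
qed

lemma cross7_inner_swap: "cross7 a b \<bullet> c = - (cross7 a c \<bullet> b)"
  by (simp add: inner_7 cross7_components algebra_simps)

text \<open>Stated with the cross product instead of \<open>psi0\<close>: in this form the
  invariance of \<open>star0\<close> and the images of all basis vectors can be read off directly.
  \<open>g2_mapI\<close> makes the connection with \<open>psi0\<close>.\<close>

definition g2_map :: "(real^7 \<Rightarrow> real^7) \<Rightarrow> bool" where
  "g2_map f \<longleftrightarrow> linear f \<and> (\<forall>a b. f a \<bullet> f b = a \<bullet> b) \<and>
     (\<forall>a b. cross7 (f a) (f b) = f (cross7 a b))"

lemma g2_map_psi0: "g2_map f \<Longrightarrow> psi0 (f a) (f b) (f c) = psi0 a b c"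
  by (simp add: g2_map_def psi0_eq_inner)

lemma g2_map_star0: "g2_map f \<Longrightarrow> star0 (f a) (f b) (f c) (f d) = star0 a b c d"
  by (simp add: g2_map_def star0_eq_inner inner_diff inner_add)

text \<open>The images of the basis vectors follow the multiplication table \<open>e\<^sub>3 = e\<^sub>1 \<times> e\<^sub>2\<close>, \<open>e\<^sub>5 = e\<^sub>1 \<times> e\<^sub>4\<close>,
  \<open>e\<^sub>6 = e\<^sub>2 \<times> e\<^sub>4\<close>, \<open>e\<^sub>7 = e\<^sub>3 \<times> e\<^sub>4\<close>.\<close>

definition frame_map :: "real^7 \<Rightarrow> real^7 \<Rightarrow> real^7 \<Rightarrow> real^7 \<Rightarrow> real^7" where
  "frame_map x y w a = a$1 *\<^sub>R x + a$2 *\<^sub>R y + a$3 *\<^sub>R cross7 x y + a$4 *\<^sub>R w + a$5 *\<^sub>R cross7 x w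
     + a$6 *\<^sub>R cross7 y w + a$7 *\<^sub>R cross7 (cross7 x y) w"

lemma linear_frame_map: "linear (frame_map x y w)"
  by (rule linearI) (simp_all add: frame_map_def algebra_simps)

lemma frame_map_axis:
  "frame_map x y w (axis 1 1) = x" "frame_map x y w (axis 2 1) = y"
  "frame_map x y w (axis 3 1) = cross7 x y" "frame_map x y w (axis 4 1) = w"
  "frame_map x y w (axis 5 1) = cross7 x w" "frame_map x y w (axis 6 1) = cross7 y w"
  "frame_map x y w (axis 7 1) = cross7 (cross7 x y) w"
  by (simp_all add: frame_map_def axis_def)

text \<open>The last orthogonality condition puts \<open>w\<close> outside the three-space of
  \<open>x\<close>, \<open>y\<close>, \<open>x \<times> y\<close>, on which the product is that of
  the imaginary quaternions. Then the seven vectors are orthonormal and multiply like the standard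
  basis, and bilinearity does the rest.\<close>

theorem g2_map_frame_map:
  assumes unit: "x \<bullet> x = 1" "y \<bullet> y = 1" "w \<bullet> w = 1"
    and orth: "x \<bullet> y = 0" "x \<bullet> w = 0" "y \<bullet> w = 0" "cross7 x y \<bullet> w = 0"
  shows "g2_map (frame_map x y w)"
proof -
  define c p q r where "c = cross7 x y" and "p = cross7 x w" and "q = cross7 y w" and "r = cross7 c w"
  note defs = c_def p_def q_def r_def
  note orth' = orth orth[unfolded inner_commute[of _ y]] orth[unfolded inner_commute[of _ w]]
  have c0: "c \<bullet> x = 0" "x \<bullet> c = 0" "c \<bullet> y = 0" "y \<bullet> c = 0" "c \<bullet> w = 0" "w \<bullet> c = 0"
    using orth' by (simp_all add: c_def)
  have c1: "c \<bullet> c = 1" using unit orth by (simp add: c_def cross7_norm)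
  \<comment> \<open>The fact \<open>tij\<close> is the product of the \<open>i\<close>-th and the
    \<open>j\<close>-th vector in the order \<open>x, y, c, w, p, q, r\<close>.\<close>
  have t12: "cross7 x y = c" and t14: "cross7 x w = p" and t24: "cross7 y w = q" and t34: "cross7 c w = r"
    by (simp_all add: defs)
  have t13: "cross7 x c = - y" using unit orth by (simp add: c_def cross7_cross7_same)
  have t23: "cross7 y c = x"
    using unit orth' by (simp add: c_def cross7_commute[of x y] cross7_cross7_same)
  have t15: "cross7 x p = - w" and t26: "cross7 y q = - w"
    using unit orth by (simp_all add: p_def q_def cross7_cross7_same)
  have t37: "cross7 c r = - w" using c0 c1 by (simp add: r_def cross7_cross7_same)
  have t45: "cross7 w p = x"
    using unit orth' by (simp add: p_def cross7_commute[of x w] cross7_cross7_same)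
  have t46: "cross7 w q = y"
    using unit orth' by (simp add: q_def cross7_commute[of y w] cross7_cross7_same)
  have t47: "cross7 w r = c"
    using unit c0 by (simp add: r_def cross7_commute[of c w] cross7_cross7_same)
  \<comment> \<open>The first product of three generators. Two sign changes turn
    \<open>x \<times> (y \<times> w)\<close> into \<open>w \<times> (x \<times> y)\<close>, which is
    \<open>- r\<close>.\<close>
  have t16: "cross7 x q = - r"
    using cross7_cross7_orthogonal[of w x y] orth'
    by (simp add: q_def r_def c_def cross7_commute[of y w] cross7_commute[of "cross7 x y" w])
  have t25: "cross7 y p = r"
    using cross7_cross7_orthogonal[of y x w] orth' t16 by (simp add: p_def q_def)
  have t17: "cross7 x r = q"
  proof -
    have "x \<bullet> q = 0" using orth by (simp add: q_def flip: cross7_inner_shift)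
    then show ?thesis using cross7_cross7_same[of x q] unit t16 by simp
  qed
  have t27: "cross7 y r = - p"
  proof -
    have "y \<bullet> p = 0" using orth by (simp add: p_def cross7_commute[of y x] flip: cross7_inner_shift)
    then show ?thesis using cross7_cross7_same[of y p] unit t25 by simp
  qed
  have t35: "cross7 c p = - q"
    using cross7_cross7_orthogonal[of c x w] c0 orth t17 by (simp add: defs)
  have t36: "cross7 c q = p"
    using cross7_cross7_orthogonal[of c y w] c0 orth t27 by (simp add: defs)
  \<comment> \<open>An inner product such as \<open>p \<bullet> y\<close> is a value of
    \<open>psi0\<close>; swapping its last two arguments turns it into one that the known products
    decide.\<close>
  have p0: "p \<bullet> y = 0" "p \<bullet> w = 0" "p \<bullet> c = 0" "p \<bullet> x = 0"
    and q0: "q \<bullet> x = 0" "q \<bullet> w = 0" "q \<bullet> c = 0" "q \<bullet> y = 0"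
    and r0: "r \<bullet> x = 0" "r \<bullet> y = 0" "r \<bullet> w = 0" "r \<bullet> c = 0"
    using orth' c0 cross7_inner_swap[of x w y] cross7_inner_swap[of x w c] cross7_inner_swap[of y w x]
      cross7_inner_swap[of y w c] cross7_inner_swap[of c w x] cross7_inner_swap[of c w y]
    by (simp_all add: t12 t14 t24 t34 t13 t23 cross7_commute[of y x] cross7_commute[of c x] cross7_commute[of c y])
      (simp_all add: defs)
  have t56: "cross7 p q = - c"
    using cross7_cross7_orthogonal[of p y w] p0 orth t45
    by (simp add: t24 t12 cross7_commute[of y x] cross7_commute[of p w])
  have t57: "cross7 p r = y"
    using cross7_cross7_orthogonal[of p c w] p0 c0 t45
    by (simp add: t34 t13 cross7_commute[of c x] cross7_commute[of p w])
  have t67: "cross7 q r = - x"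
    using cross7_cross7_orthogonal[of q c w] q0 c0 t46
    by (simp add: t34 t23 cross7_commute[of c y] cross7_commute[of q w])
  note table = t12 t13 t14 t15 t16 t17 t23 t24 t25 t26 t27 t34 t35 t36 t37 t45 t46 t47 t56 t57 t67
  have table': "cross7 y x = - c" "cross7 c x = y" "cross7 w x = - p" "cross7 p x = w" "cross7 q x = r"
    "cross7 r x = - q" "cross7 c y = - x" "cross7 w y = - q" "cross7 p y = - r" "cross7 q y = w"
    "cross7 r y = p" "cross7 w c = - r" "cross7 p c = q" "cross7 q c = - p" "cross7 r c = w"
    "cross7 p w = - x" "cross7 q w = - y" "cross7 r w = - c" "cross7 q p = c" "cross7 r p = - y"
    "cross7 r q = x"
    by (subst cross7_commute, simp add: table)+
  have pqr: "p \<bullet> p = 1" "q \<bullet> q = 1" "r \<bullet> r = 1" "p \<bullet> q = 0" "p \<bullet> r = 0" "q \<bullet> r = 0"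
  proof -
    show "p \<bullet> p = 1" "q \<bullet> q = 1" "r \<bullet> r = 1"
      unfolding defs cross7_norm using unit orth by (simp_all add: cross7_norm)
    \<comment> \<open>The common factor \<open>w\<close> is shifted to the other side, where
      \<open>w \<times> q = y\<close> and \<open>w \<times> r = c\<close> remove it.\<close>
    have "p \<bullet> q = x \<bullet> y" "p \<bullet> r = x \<bullet> c" "q \<bullet> r = y \<bullet> c"
      using cross7_inner_shift[of x w q] cross7_inner_shift[of x w r] cross7_inner_shift[of y w r]
      by (simp_all only: t14 t24 t46 t47)
    then show "p \<bullet> q = 0" "p \<bullet> r = 0" "q \<bullet> r = 0" using orth c0 by auto
  qed
  have ortho: "frame_map x y w a \<bullet> frame_map x y w b = a \<bullet> b" for a b
    unfolding frame_map_def table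
    using unit orth' c0 c1 p0 q0 r0 pqr pqr(4-6)[unfolded inner_commute[of p] inner_commute[of q r]]
      p0[unfolded inner_commute[of p]] q0[unfolded inner_commute[of q]] r0[unfolded inner_commute[of r]]
    by (simp add: inner_add inner_7[of a b])
  have "cross7 (frame_map x y w a) (frame_map x y w b) = frame_map x y w (cross7 a b)" for a b
    unfolding frame_map_def table
    by (simp add: cross7_add table table' cross7_components) (simp add: algebra_simps)
  with ortho show ?thesis by (simp add: g2_map_def linear_frame_map)
qed

section \<open>Equality in the calibration inequalities\<close>

text \<open>Both parts come from expanding the square of \<open>u - v\<close>. The vector
  \<open>u\<close> may be short: for \<open>*\<psi>\<close> its squared norm is
  \<open>1 - \<psi>\<^sup>2\<close>, and equality then also forces
  \<open>\<psi> = 0\<close>.\<close>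

lemma unit_inner_le:
  fixes u v :: "'a::real_inner"
  assumes "u \<bullet> u \<le> 1" "v \<bullet> v = 1"
  shows "u \<bullet> v \<le> 1" and "u \<bullet> v = 1 \<Longrightarrow> u = v"
proof -
  have *: "(u - v) \<bullet> (u - v) = u \<bullet> u + 1 - 2 * (u \<bullet> v)"
    using assms by (simp add: inner_diff inner_commute)
  then show "u \<bullet> v \<le> 1" using assms inner_ge_zero[of "u - v"] by linarith
  assume "u \<bullet> v = 1"
  then have "(u - v) \<bullet> (u - v) \<le> 0" using * assms by linarith
  then show "u = v" by (metis inner_ge_zero inner_eq_zero_iff order_antisym eq_iff_diff_eq_0)
qed

definition orthonormal_triple :: "real^7 \<Rightarrow> real^7 \<Rightarrow> real^7 \<Rightarrow> bool" where
  "orthonormal_triple a b c \<longleftrightarrow> a \<bullet> a = 1 \<and> b \<bullet> b = 1 \<and> c \<bullet> c = 1 \<and>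
     a \<bullet> b = 0 \<and> a \<bullet> c = 0 \<and> b \<bullet> c = 0"

lemma psi0_le_1:
  assumes "orthonormal_triple a b c"
  shows "psi0 a b c \<le> 1" and "psi0 a b c = 1 \<Longrightarrow> c = cross7 a b"
  using unit_inner_le[of "cross7 a b" c] assms
  by (auto simp: orthonormal_triple_def psi0_eq_inner cross7_norm)

text \<open>The triple fixes the images of \<open>e\<^sub>1, e\<^sub>2, e\<^sub>3\<close>; for the
  remaining generator \<open>e\<^sub>4\<close> any unit vector orthogonal to the three will do, and
  3 < 7 provides one.\<close>

lemma psi0_contact:
  assumes "orthonormal_triple a b c" "psi0 a b c = 1"
  obtains f where "g2_map f" "f (axis 1 1) = a" "f (axis 2 1) = b" "f (axis 3 1) = c"
proof -
  have c: "c = cross7 a b" by (rule psi0_le_1(2)[OF assms])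
  have "dim {a, b, c} \<le> card {a, b, c}" by (rule dim_le_card) (auto simp: span_base)
  also have "\<dots> \<le> 3" by (simp add: card_insert_if)
  finally have "dim {a, b, c} < DIM(real^7)" by simp
  then obtain v where v: "v \<noteq> 0" "\<And>y. y \<in> span {a, b, c} \<Longrightarrow> v \<bullet> y = 0"
    by (metis orthogonal_to_subspace_exists Linear_Algebra.orthogonal_def)
  define w where "w = v /\<^sub>R norm v"
  have w: "w \<bullet> w = 1" "a \<bullet> w = 0" "b \<bullet> w = 0" "c \<bullet> w = 0"
    using v(1) v(2)[OF span_base, of a] v(2)[OF span_base, of b] v(2)[OF span_base, of c]
    by (simp_all add: w_def inner_commute dot_square_norm power2_eq_square)
  have "g2_map (frame_map a b w)"
    using assms(1) w c by (intro g2_map_frame_map) (auto simp: orthonormal_triple_def)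
  then show thesis
    by (rule that) (simp_all add: frame_map_axis c)
qed

lemma star0_le_1:
  assumes "orthonormal_triple a b c" "d \<bullet> d = 1"
  shows "star0 a b c d \<le> 1"
    and "star0 a b c d = 1 \<Longrightarrow> d = cross7 a (cross7 b c) \<and> psi0 a b c = 0"
proof -
  define u where "u = cross7 a (cross7 b c)"
  have star: "star0 a b c d = u \<bullet> d"
    using assms by (simp add: star0_eq_inner u_def orthonormal_triple_def)
  have u: "u \<bullet> u = 1 - (psi0 a b c)\<^sup>2"
    unfolding u_def cross7_norm psi0_eq_inner cross7_inner_shift[of a b c]
    using assms by (simp add: orthonormal_triple_def)
  then have "u \<bullet> u \<le> 1" by simp
  note * = unit_inner_le[OF this assms(2)]
  show "star0 a b c d \<le> 1" using * star by simp
  assume "star0 a b c d = 1"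
  then have "d = u" using * star by simp
  then show "d = cross7 a (cross7 b c) \<and> psi0 a b c = 0" using u assms(2) by (simp add: u_def)
qed

text \<open>Reading \<open>a, b, c\<close> as \<open>e\<^sub>4, e\<^sub>5, e\<^sub>6\<close>, the
  table demands \<open>e\<^sub>1 = e\<^sub>4 \<times> e\<^sub>5\<close> and
  \<open>e\<^sub>2 = e\<^sub>4 \<times> e\<^sub>6\<close>. The condition
  \<open>\<psi>(a, b, c) = 0\<close> says exactly that \<open>a\<close> is orthogonal to
  \<open>e\<^sub>1 \<times> e\<^sub>2\<close>. The formula involves no choice, which later gives
  continuity.\<close>

lemma star0_contact:
  assumes abc: "orthonormal_triple a b c" and d: "d \<bullet> d = 1" "star0 a b c d = 1"
  defines "f \<equiv> frame_map (cross7 a b) (cross7 a c) a"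
  shows "g2_map f" "f (axis 4 1) = a" "f (axis 5 1) = b" "f (axis 6 1) = c" "f (axis 7 1) = d"
    "f (axis 1 1) = cross7 a b" "f (axis 2 1) = cross7 a c" "f (axis 3 1) = cross7 a d"
proof -
  have d': "d = cross7 a (cross7 b c)" and psi: "psi0 a b c = 0"
    using star0_le_1(2)[OF abc d] by auto
  have abc': "a \<bullet> a = 1" "b \<bullet> b = 1" "c \<bullet> c = 1" "a \<bullet> b = 0" "a \<bullet> c = 0" "b \<bullet> c = 0"
    using abc by (auto simp: orthonormal_triple_def)
  have b: "cross7 (cross7 a b) a = b" and c: "cross7 (cross7 a c) a = c"
    using abc' by (simp_all add: cross7_commute[of _ a] cross7_cross7_same)
  have bc: "a \<bullet> cross7 b c = 0" using psi by (simp add: psi0_eq_inner cross7_inner_shift)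
  have ad: "cross7 a d = - cross7 b c" using abc' bc by (simp add: d' cross7_cross7_same)
  have orth: "cross7 a b \<bullet> cross7 a c = 0" "cross7 (cross7 a b) (cross7 a c) \<bullet> a = 0"
    using abc' psi b c by (simp_all add: cross7_inner_shift psi0_eq_inner)
      (simp add: cross7_commute[of c a] cross7_cross7_same inner_diff flip: cross7_inner_shift)
  have g2: "g2_map f"
    unfolding f_def using abc' orth by (intro g2_map_frame_map) (simp_all add: cross7_norm)
  have f: "f (axis 4 1) = a" "f (axis 5 1) = b" "f (axis 6 1) = c"
    "f (axis 1 1) = cross7 a b" "f (axis 2 1) = cross7 a c"
    by (simp_all add: f_def frame_map_axis b c)
  \<comment> \<open>The first two products combine to \<open>e\<^sub>7 = - e\<^sub>4 \<times>
    e\<^sub>3 = e\<^sub>4 \<times> (e\<^sub>5 \<times> e\<^sub>6)\<close>, the pattern of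
    \<open>d = a \<times> (b \<times> c)\<close>.\<close>
  have ax: "cross7 (axis 5 1) (axis 6 1) = - axis 3 1" "cross7 (axis 4 1) (- axis 3 1) = axis 7 1"
    "cross7 (axis 4 1) (axis 7 1) = axis 3 1"
    by (simp_all add: Finite_Cartesian_Product.vec_eq_iff forall_7 cross7_components axis_def)
  have cr: "f (cross7 u v) = cross7 (f u) (f v)" for u v using g2 by (simp add: g2_map_def)
  have "f (axis 7 1) = d"
    unfolding ax(2)[symmetric] ax(1)[symmetric] cr f d' by simp
  moreover from this have "f (axis 3 1) = cross7 a d"
    unfolding ax(3)[symmetric] cr f by simp
  ultimately show "g2_map f" "f (axis 4 1) = a" "f (axis 5 1) = b" "f (axis 6 1) = c" "f (axis 7 1) = d"
    "f (axis 1 1) = cross7 a b" "f (axis 2 1) = cross7 a c" "f (axis 3 1) = cross7 a d"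
    using g2 f by auto
qed

section \<open>Extension of rotations of \<open>\<real>\<^sup>4\<close> to elements of \<open>G\<^sub>2\<close>\<close>

lemma det_4:
  fixes A :: "real^4^4"
  shows "Determinants.det A =
    A$1$1 * (A$2$2 * (A$3$3 * A$4$4 - A$3$4 * A$4$3) - A$2$3 * (A$3$2 * A$4$4 - A$3$4 * A$4$2)
      + A$2$4 * (A$3$2 * A$4$3 - A$3$3 * A$4$2)) -
    A$2$1 * (A$1$2 * (A$3$3 * A$4$4 - A$3$4 * A$4$3) - A$1$3 * (A$3$2 * A$4$4 - A$3$4 * A$4$2)
      + A$1$4 * (A$3$2 * A$4$3 - A$3$3 * A$4$2)) +
    A$3$1 * (A$1$2 * (A$2$3 * A$4$4 - A$2$4 * A$4$3) - A$1$3 * (A$2$2 * A$4$4 - A$2$4 * A$4$2)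
      + A$1$4 * (A$2$2 * A$4$3 - A$2$3 * A$4$2)) -
    A$4$1 * (A$1$2 * (A$2$3 * A$3$4 - A$2$4 * A$3$3) - A$1$3 * (A$2$2 * A$3$4 - A$2$4 * A$3$2)
      + A$1$4 * (A$2$2 * A$3$3 - A$2$3 * A$3$2))"
proof -
  have f1234: "finite {2::4, 3, 4}" "1 \<notin> {2::4, 3, 4}" and f234: "finite {3::4, 4}" "2 \<notin> {3::4, 4}"
    and f34: "finite {4::4}" "3 \<notin> {4::4}" by auto
  show ?thesis
    unfolding Determinants.det_def UNIV_4
    unfolding sum_over_permutations_insert[OF f1234]
    unfolding sum_over_permutations_insert[OF f234]
    unfolding sum_over_permutations_insert[OF f34]
    unfolding permutes_sing
    by (simp add: sign_swap_id sign_id permutation_swap_id permutation_compose sign_compose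
        Transposition.transpose_def) (simp add: algebra_simps)
qed

definition emb4 :: "4 \<Rightarrow> 7" where
  "emb4 i = (if i = 1 then 4 else if i = 2 then 5 else if i = 3 then 6 else 7)"

lemma emb4_simps [simp]: "emb4 1 = 4" "emb4 2 = 5" "emb4 3 = 6" "emb4 4 = 7"
  by (simp_all add: emb4_def)

definition col4 :: "real^4^4 \<Rightarrow> 4 \<Rightarrow> real^7" where
  "col4 Q j = (\<Sum>i\<in>UNIV. Q$i$j *\<^sub>R axis (emb4 i) 1)"

lemma col4_components [simp]:
  "col4 Q j $ 1 = 0" "col4 Q j $ 2 = 0" "col4 Q j $ 3 = 0" "col4 Q j $ 4 = Q$1$j"
  "col4 Q j $ 5 = Q$2$j" "col4 Q j $ 6 = Q$3$j" "col4 Q j $ 7 = Q$4$j"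
  by (simp_all add: col4_def sum_4 axis_def)

lemma inner_col4: "col4 Q j \<bullet> col4 Q k = (Finite_Cartesian_Product.transpose Q ** Q) $ j $ k"
  by (simp add: inner_7 matrix_matrix_mult_def sum_4 Finite_Cartesian_Product.transpose_def)

text \<open>Every term of \<open>star0\<close> other than \<open>minor4 4 5 6 7\<close> contains one
  of the indices 1, 2, 3, where the columns vanish.\<close>

lemma star0_col4: "star0 (col4 Q 1) (col4 Q 2) (col4 Q 3) (col4 Q 4) = Determinants.det Q"
  by (simp add: star0_def minor4_def minor3_def det_4) (simp add: algebra_simps)

text \<open>The images of \<open>e\<^sub>1 = e\<^sub>4 \<times> e\<^sub>5\<close> and \<open>e\<^sub>2 = e\<^sub>4 \<times> e\<^sub>6\<close> are forced by the columns.\<close>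

definition g2_extension :: "real^4^4 \<Rightarrow> real^7 \<Rightarrow> real^7" where
  "g2_extension Q = frame_map (cross7 (col4 Q 1) (col4 Q 2)) (cross7 (col4 Q 1) (col4 Q 3)) (col4 Q 1)"

text \<open>For linear \<open>f\<close> this is the invariance of the span of
  \<open>e\<^sub>4, \<dots>, e\<^sub>7\<close>, put as vanishing of coordinates.\<close>

definition preserves4 :: "(real^7 \<Rightarrow> real^7) \<Rightarrow> bool" where
  "preserves4 f \<longleftrightarrow> (\<forall>j. f (axis (emb4 j) 1) $ 1 = 0 \<and> f (axis (emb4 j) 1) $ 2 = 0 \<and>
     f (axis (emb4 j) 1) $ 3 = 0)"

definition block4 :: "(real^7 \<Rightarrow> real^7) \<Rightarrow> real^4^4" where
  "block4 f = (\<chi> i j. f (axis (emb4 j) 1) $ emb4 i)"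

lemma col4_block4: "preserves4 f \<Longrightarrow> col4 (block4 f) j = f (axis (emb4 j) 1)"
  by (simp add: Finite_Cartesian_Product.vec_eq_iff forall_7 block4_def preserves4_def)

lemma inner_axis_emb4: "axis (emb4 i) (1::real) \<bullet> axis (emb4 j) 1 = (if i = j then 1 else 0)"
  using exhaust_4[of i] exhaust_4[of j] by (auto simp: inner_axis_axis)

text \<open>The determinant is the value of \<open>star0\<close> on the images of
  \<open>e\<^sub>4, \<dots>, e\<^sub>7\<close>, so the invariance of \<open>star0\<close> rules out
  reflections.\<close>

lemma rotation_block4:
  assumes "g2_map f" "preserves4 f"
  shows "rotation_matrix (block4 f)"
proof -
  have "(Finite_Cartesian_Product.transpose (block4 f) ** block4 f) $ j $ k =
      axis (emb4 j) (1::real) \<bullet> axis (emb4 k) 1" for j k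
    using assms by (simp add: col4_block4 g2_map_def flip: inner_col4)
  then have "orthogonal_matrix (block4 f)"
    by (simp add: orthogonal_matrix Finite_Cartesian_Product.vec_eq_iff inner_axis_emb4 Finite_Cartesian_Product.mat_def)
  moreover have "Determinants.det (block4 f) = star0 (axis 4 1) (axis 5 1) (axis 6 1) (axis 7 1)"
    using g2_map_star0[OF assms(1)] assms(2) by (simp add: col4_block4 flip: star0_col4)
  moreover have "star0 (axis 4 1) (axis 5 1) (axis 6 1) (axis 7 1) = 1"
    by (simp add: star0_def minor4_def minor3_def axis_def)
  ultimately show ?thesis by (simp add: rotation_matrix_def)
qed

text \<open>Since \<open>g\<close> keeps the vectors \<open>e\<^sub>4, \<dots>, e\<^sub>7\<close> in
  their span, the columns of its block are complete expansions of their images, to which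
  \<open>f\<close> applies linearly.\<close>

lemma block4_compose:
  assumes "linear f" "preserves4 g"
  shows "block4 (f \<circ> g) = block4 f ** block4 g"
proof -
  have "f (g (axis (emb4 j) 1)) = (\<Sum>k\<in>UNIV. block4 g $ k $ j *\<^sub>R f (axis (emb4 k) 1))" for j
    unfolding col4_block4[OF assms(2), symmetric] col4_def
    using assms(1) by (simp add: linear_sum linear_scale)
  then show ?thesis
    by (simp add: Finite_Cartesian_Product.vec_eq_iff block4_def matrix_matrix_mult_def mult.commute)
qed

lemma cross7_axis:
  "cross7 (axis 4 1) (axis 5 1) = axis 1 1" "cross7 (axis 4 1) (axis 6 1) = axis 2 1"
  "cross7 (axis 1 1) (axis 2 1) = axis 3 1" "cross7 (axis 1 1) (axis 4 1) = axis 5 1"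
  "cross7 (axis 2 1) (axis 4 1) = axis 6 1" "cross7 (axis 3 1) (axis 4 1) = axis 7 1"
  by (simp_all add: Finite_Cartesian_Product.vec_eq_iff forall_7 cross7_components axis_def)

lemma linear_eq_axis:
  fixes f g :: "real^7 \<Rightarrow> real^7"
  assumes "linear f" "linear g" "\<And>i. f (axis i 1) = g (axis i 1)"
  shows "f = g"
  using assms by (intro linear_eq_stdbasis) (auto simp: Basis_vec_def)

text \<open>The vectors \<open>e\<^sub>1, e\<^sub>2, e\<^sub>4\<close> generate the others under the
  cross product.\<close>

lemma g2_map_eq_frame_map:
  assumes "g2_map f"
  shows "f = frame_map (f (axis 1 1)) (f (axis 2 1)) (f (axis 4 1))"
proof (rule linear_eq_axis)
  fix i
  note cr = conjunct2[OF conjunct2[OF assms[unfolded g2_map_def]], rule_format]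
  show "f (axis i 1) = frame_map (f (axis 1 1)) (f (axis 2 1)) (f (axis 4 1)) (axis i 1)"
    using exhaust_7[of i] by (auto simp: frame_map_axis cr cross7_axis)
qed (use assms linear_frame_map in \<open>auto simp: g2_map_def\<close>)

text \<open>Injectivity of the restriction: the block contains the images of
  \<open>e\<^sub>4, e\<^sub>5, e\<^sub>6\<close>, whose products give those of
  \<open>e\<^sub>1\<close> and \<open>e\<^sub>2\<close>.\<close>

lemma g2_extension_block4:
  assumes "g2_map f" "preserves4 f"
  shows "g2_extension (block4 f) = f"
proof -
  note cr = conjunct2[OF conjunct2[OF assms(1)[unfolded g2_map_def]], rule_format]
  show ?thesis
    using g2_map_eq_frame_map[OF assms(1)] assms(2)
    by (simp add: g2_extension_def col4_block4 cr cross7_axis)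
qed

lemma g2_extension:
  assumes "rotation_matrix Q"
  shows "g2_map (g2_extension Q)" and "preserves4 (g2_extension Q)" and "block4 (g2_extension Q) = Q"
proof -
  have Q: "col4 Q j \<bullet> col4 Q k = (if j = k then 1 else 0)" for j k
    using assms by (simp add: inner_col4 rotation_matrix_def orthogonal_matrix Finite_Cartesian_Product.mat_def)
  have tr: "orthonormal_triple (col4 Q 1) (col4 Q 2) (col4 Q 3)" and u: "col4 Q 4 \<bullet> col4 Q 4 = 1"
    by (simp_all add: orthonormal_triple_def Q)
  have st: "star0 (col4 Q 1) (col4 Q 2) (col4 Q 3) (col4 Q 4) = 1"
    using assms by (simp add: star0_col4 rotation_matrix_def)
  note ct = star0_contact[OF tr u st, folded g2_extension_def]
  show "g2_map (g2_extension Q)" by (fact ct(1))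
  have ax: "g2_extension Q (axis (emb4 j) 1) = col4 Q j" for j
    using exhaust_4[of j] ct by auto
  then show "preserves4 (g2_extension Q)" by (simp add: preserves4_def)
  show "block4 (g2_extension Q) = Q"
    by (simp add: block4_def ax Finite_Cartesian_Product.vec_eq_iff forall_4)
qed

lemma continuous_on_cross7 [continuous_intros]:
  assumes "continuous_on S f" "continuous_on S g"
  shows "continuous_on S (\<lambda>x. cross7 (f x) (g x))"
proof -
  have "continuous_on S (\<lambda>x. cross7 (f x) (g x) $ i)" for i
    using exhaust_7[of i]
    by (elim disjE; simp only: cross7_components; intro continuous_intros assms)
  then have "continuous_on S (\<lambda>x. \<chi> i. cross7 (f x) (g x) $ i)"
    by (rule continuous_on_vec_lambda)
  then show ?thesis by simp
qed

text \<open>The extension is built from cross products of columns. This yields the continuity of the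
  inverse isomorphism without a compactness argument.\<close>

lemma continuous_on_g2_extension: "continuous_on S (\<lambda>Q. g2_extension Q a)"
  unfolding g2_extension_def frame_map_def col4_def by (intro continuous_intros)

section \<open>The Hodge dual in coordinates\<close>

lemma det_mat_0 [simp]: "Determinant.det (Matrix.mat 0 0 f) = (1::real)"
  by (simp add: Determinant.det_def)

lemma det_mat_Suc:
  "Determinant.det (Matrix.mat (Suc n) (Suc n) (\<lambda>(i, j). F i j :: real)) =
    (\<Sum>k<Suc n. F k 0 * ((-1) ^ k *
       Determinant.det (Matrix.mat n n (\<lambda>(i, j). F (insert_index k i) (Suc j)))))"
proof -
  have "mat_delete (Matrix.mat (Suc n) (Suc n) (\<lambda>(i, j). F i j)) k 0 =
      Matrix.mat n n (\<lambda>(i, j). F (insert_index k i) (Suc j))" for k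
    by (rule eq_matI) (auto simp: mat_delete_def insert_index_def)
  then show ?thesis
    by (subst laplace_expansion_column[of _ "Suc n" 0]) (auto simp: cofactor_def intro!: sum.cong)
qed

lemma det_mat_3:
  "Determinant.det (Matrix.mat 3 3 (\<lambda>(i, j). F i j :: real)) =
    F 0 0 * (F 1 1 * F 2 2 - F 2 1 * F 1 2) - F 1 0 * (F 0 1 * F 2 2 - F 2 1 * F 0 2)
    + F 2 0 * (F 0 1 * F 1 2 - F 1 1 * F 0 2)"
  by (simp add: det_mat_Suc insert_index_def eval_nat_numeral algebra_simps)

lemma det_mat_4:
  "Determinant.det (Matrix.mat 4 4 (\<lambda>(i, j). F i j :: real)) =
    F 0 0 * (F 1 1 * (F 2 2 * F 3 3 - F 3 2 * F 2 3) - F 2 1 * (F 1 2 * F 3 3 - F 3 2 * F 1 3)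
      + F 3 1 * (F 1 2 * F 2 3 - F 2 2 * F 1 3))
    - F 1 0 * (F 0 1 * (F 2 2 * F 3 3 - F 3 2 * F 2 3) - F 2 1 * (F 0 2 * F 3 3 - F 3 2 * F 0 3)
      + F 3 1 * (F 0 2 * F 2 3 - F 2 2 * F 0 3))
    + F 2 0 * (F 0 1 * (F 1 2 * F 3 3 - F 3 2 * F 1 3) - F 1 1 * (F 0 2 * F 3 3 - F 3 2 * F 0 3)
      + F 3 1 * (F 0 2 * F 1 3 - F 1 2 * F 0 3))
    - F 3 0 * (F 0 1 * (F 1 2 * F 2 3 - F 2 2 * F 1 3) - F 1 1 * (F 0 2 * F 2 3 - F 2 2 * F 0 3)
      + F 2 1 * (F 0 2 * F 1 3 - F 1 2 * F 0 3))"
  by (simp add: det_mat_Suc insert_index_def eval_nat_numeral algebra_simps)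

text \<open>A single term of the Laplace expansion survives. Three such steps bring a 7 by 7
  determinant down to 4 by 4 and avoid its full expansion.\<close>

lemma det_mat_unit_column:
  assumes "r \<le> n" "\<And>k. k \<le> n \<Longrightarrow> F k 0 = (if k = r then 1 else 0)"
  shows "Determinant.det (Matrix.mat (Suc n) (Suc n) (\<lambda>(i, j). F i j :: real)) =
    (-1) ^ r * Determinant.det (Matrix.mat n n (\<lambda>(i, j). F (insert_index r i) (Suc j)))"
proof -
  have "Determinant.det (Matrix.mat (Suc n) (Suc n) (\<lambda>(i, j). F i j)) =
      (\<Sum>k<Suc n. (if k = r then (-1) ^ k *
       Determinant.det (Matrix.mat n n (\<lambda>(i, j). F (insert_index k i) (Suc j))) else 0))"
    unfolding det_mat_Suc by (rule sum.cong) (auto simp: assms(2))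
  then show ?thesis using assms(1) by simp
qed

text \<open>Rows count from 0 and coordinates from 1; in row 6 the index \<open>of_nat 7\<close> is
  0 in the type \<open>7\<close>, which is the last coordinate.\<close>

definition vol0 :: "(real^7) list \<Rightarrow> real" where
  "vol0 us = Determinant.det (Matrix.mat 7 7 (\<lambda>(i, j). us ! j $ of_nat (Suc i)))"

text \<open>In the Laplace expansion along column \<open>k\<close> the cofactors do not involve that
  column.\<close>

lemma linear_vol0:
  assumes "length us = 7" "k < 7"
  shows "linear (\<lambda>x. vol0 (us[k := x]))"
proof -
  define M where "M x = Matrix.mat 7 7 (\<lambda>(i, j). us[k := x] ! j $ of_nat (Suc i))" for x
  have *: "mat_delete (M x) i k = mat_delete (M 0) i k" for x i
    using assms by (intro eq_matI) (auto simp: M_def mat_delete_def nth_list_update)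
  define c where "c i = cofactor (M 0) i k" for i
  have "cofactor (M x) i k = c i" for x i
    unfolding c_def cofactor_def using *[of x i] by simp
  moreover have "vol0 (us[k := x]) = (\<Sum>i<7. M x $$ (i, k) * cofactor (M x) i k)" for x
    unfolding vol0_def M_def[symmetric]
    by (rule laplace_expansion_column) (use assms in \<open>auto simp: M_def\<close>)
  moreover have "M x $$ (i, k) = x $ of_nat (Suc i)" if "i < 7" for x i
    using that assms by (simp add: M_def)
  ultimately have "vol0 (us[k := x]) = (\<Sum>i<7. x $ of_nat (Suc i) * c i)" for x
    by simp
  then show ?thesis
    by (intro linearI) (simp_all add: sum.distrib algebra_simps sum_distrib_left)
qed

lemma vol0_repeated:
  assumes "i < 7" "j < 7" "i \<noteq> j" "us ! i = us ! j"
  shows "vol0 us = 0"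
  unfolding vol0_def
  by (rule det_identical_columns[OF _ assms(3,1,2)]) (use assms in \<open>auto intro!: eq_vecI\<close>)

lemma vol0_swap:
  assumes "length us = 7" "i < 7" "j < 7" "i \<noteq> j"
  shows "vol0 (us[i := y, j := x]) = - vol0 (us[i := x, j := y])"
proof -
  define f where "f u v = vol0 (us[i := u, j := v])" for u v
  have f0: "f u u = 0" for u
    unfolding f_def using assms by (intro vol0_repeated[of i j]) auto
  have lin1: "f (u + u') v = f u v + f u' v" for u u' v
    using linear_add[OF linear_vol0[of "us[j := v]" i]] assms
    by (simp add: f_def list_update_swap[of i j])
  have lin2: "f u (v + v') = f u v + f u v'" for u v v'
    using linear_add[OF linear_vol0[of "us[i := u]" j]] assms by (simp add: f_def)
  have "f (x + y) (x + y) = f x x + f y x + (f x y + f y y)"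
    by (simp only: lin1 lin2)
  then have "f y x = - f x y" using f0[of x] f0[of y] f0[of "x + y"] by linarith
  then show ?thesis unfolding f_def .
qed

text \<open>Both sides are the inner product of the vectors that represent \<open>f\<close> and
  \<open>g\<close>. This is the independence of a contraction from the orthonormal basis.\<close>

lemma parseval_linear:
  fixes f g :: "real^7 \<Rightarrow> real"
  assumes "linear f" "linear g" and d: "\<And>u v. (\<Sum>i\<in>I. (u \<bullet> d i) * (v \<bullet> d i)) = u \<bullet> v"
  shows "(\<Sum>i\<in>I. f (d i) * g (d i)) = (\<Sum>a\<in>UNIV. f (axis a 1) * g (axis a 1))"
proof -
  have rep: "F x = (\<chi> a. F (axis a 1)) \<bullet> x" if "linear F" for F :: "real^7 \<Rightarrow> real" and x
  proof -
    have "F x = F (\<Sum>a\<in>UNIV. x$a *\<^sub>R axis a 1)"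
      by (simp add: basis_expansion flip: scalar_mult_eq_scaleR)
    also have "\<dots> = (\<chi> a. F (axis a 1)) \<bullet> x"
      using that by (simp add: linear_sum linear_scale inner_vec_def mult.commute)
    finally show ?thesis .
  qed
  have "(\<Sum>i\<in>I. f (d i) * g (d i)) = (\<chi> a. f (axis a 1)) \<bullet> (\<chi> a. g (axis a 1))"
  proof -
    have "f (d i) * g (d i) = ((\<chi> a. f (axis a 1)) \<bullet> d i) * ((\<chi> a. g (axis a 1)) \<bullet> d i)" for i
      using rep[OF assms(1), of "d i"] rep[OF assms(2), of "d i"] by simp
    then show ?thesis by (simp only: d)
  qed
  then show ?thesis by (simp add: inner_vec_def)
qed

lemma linear_psi0: "linear (\<lambda>x. psi0 x y z)" "linear (\<lambda>y. psi0 x y z)" "linear (\<lambda>z. psi0 x y z)"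
  by (rule linearI; simp add: psi0_def minor3_def algebra_simps)+

text \<open>Each of the six monomials of the minor selects one ordering of \<open>i, j, k\<close>,
  with the sign of the permutation.\<close>

lemma sum_minor3:
  "(\<Sum>a\<in>UNIV. \<Sum>b\<in>UNIV. \<Sum>c\<in>UNIV. minor3 i j k (axis a 1) (axis b 1) (axis c 1) * T a b c) =
    T i j k - T i k j - T j i k + T j k i + T k i j - (T k j i :: real)"
proof -
  have ax: "axis a (1::real) $ i = (if i = a then 1 else 0)" for a i :: 7 by (simp add: axis_def)
  have *: "(\<Sum>a\<in>UNIV. \<Sum>b\<in>UNIV. \<Sum>c\<in>UNIV. axis a 1 $ i * (axis b 1 $ j * axis c 1 $ k) * T a b c)
      = T i j k" for i j k
    by (simp add: ax if_distrib[of "\<lambda>x. x * _"] if_distrib[of "\<lambda>x. _ * x"] sum.delta' cong: if_cong)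
  show ?thesis
    unfolding minor3_def
    by (simp only: right_diff_distrib distrib_right left_diff_distrib sum.distrib sum_subtractf *)
qed

text \<open>The numbers \<open>r, s, t\<close> are the positions of the rows to be deleted among
  those still present; nesting \<open>insert_index\<close> recovers the original row
  numbers.\<close>

lemma vol0_axis:
  assumes "length ws = 4" "r < 7" "s < 6" "t < 5"
    "i = of_nat (Suc r)" "j = of_nat (Suc (insert_index r s))"
    "k = of_nat (Suc (insert_index r (insert_index s t)))"
  shows "vol0 (axis i 1 # axis j 1 # axis k 1 # ws) = (-1) ^ (r + s + t) *
    Determinant.det (Matrix.mat 4 4 (\<lambda>(a, b). ws ! b $ of_nat (Suc (insert_index r (insert_index s (insert_index t a))))))"
proof -
  have inj: "of_nat a = (of_nat b :: 7) \<longleftrightarrow> a = b" if "a < 7" "b < 7" for a b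
  proof -
    from that have "a = 0 \<or> a = 1 \<or> a = 2 \<or> a = 3 \<or> a = 4 \<or> a = 5 \<or> a = 6"
      "b = 0 \<or> b = 1 \<or> b = 2 \<or> b = 3 \<or> b = 4 \<or> b = 5 \<or> b = 6" by linarith+
    then show ?thesis by (elim disjE; simp)
  qed
  have ins: "insert_index r a < Suc n" if "a < n" for a r n using that by (simp add: insert_index_def)
  have ins_inj: "insert_index r a = insert_index r b \<longleftrightarrow> a = b" for a b r
    by (auto simp: insert_index_def)
  define F where "F a b = (axis i 1 # axis j 1 # axis k 1 # ws) ! b $ of_nat (Suc a)" for a b
  have "vol0 (axis i 1 # axis j 1 # axis k 1 # ws) = Determinant.det (Matrix.mat (Suc 6) (Suc 6) (\<lambda>(i, j). F i j))"
    by (simp add: vol0_def F_def)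
  also have "\<dots> = (-1) ^ r * Determinant.det (Matrix.mat (Suc 5) (Suc 5) (\<lambda>(i, j). F (insert_index r i) (Suc j)))"
    using assms by (subst det_mat_unit_column[of r]) (auto simp: F_def axis_def inj)
  also have "Determinant.det (Matrix.mat (Suc 5) (Suc 5) (\<lambda>(i, j). F (insert_index r i) (Suc j))) =
    (-1) ^ s * Determinant.det (Matrix.mat (Suc 4) (Suc 4) (\<lambda>(i, j). F (insert_index r (insert_index s i)) (Suc (Suc j))))"
    using assms ins[of _ 6] by (subst det_mat_unit_column[of s]) (auto simp: F_def axis_def inj ins_inj)
  also have "Determinant.det (Matrix.mat (Suc 4) (Suc 4) (\<lambda>(i, j). F (insert_index r (insert_index s i)) (Suc (Suc j)))) =
    (-1) ^ t * Determinant.det (Matrix.mat 4 4 (\<lambda>(i, j). F (insert_index r (insert_index s (insert_index t i))) (Suc (Suc (Suc j)))))"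
    using assms ins[of _ 6] ins[of _ 5] by (subst det_mat_unit_column[of t]) (auto simp: F_def axis_def inj ins_inj)
  finally show ?thesis by (simp add: power_add F_def)
qed

lemma sum_psi0_vol0_axis:
  "(\<Sum>a\<in>UNIV. \<Sum>b\<in>UNIV. \<Sum>c\<in>UNIV. psi0 (axis a 1) (axis b 1) (axis c 1) *
      vol0 [axis a 1, axis b 1, axis c 1, w1, w2, w3, w4]) = 6 * star0 w1 w2 w3 w4"
proof -
  define T where "T a b c = vol0 [axis a 1, axis b 1, axis c 1, w1, w2, w3, w4]" for a b c
  have s01: "T b a c = - T a b c" for a b c
    using vol0_swap[of "[axis b 1, axis a 1, axis c 1, w1, w2, w3, w4]" 0 1 "axis b 1" "axis a 1"]
    by (simp add: T_def)
  have s12: "T a c b = - T a b c" for a b c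
    using vol0_swap[of "[axis a 1, axis b 1, axis c 1, w1, w2, w3, w4]" 1 2 "axis c 1" "axis b 1"]
    by (simp add: T_def numeral_2_eq_2)
  \<comment> \<open>All six orderings contribute equally because \<open>vol0\<close> alternates;
    this is the \<open>3!\<close> in the denominator of the Hodge dual.\<close>
  have six: "T i j k - T i k j - T j i k + T j k i + T k i j - T k j i = 6 * T i j k" for i j k
    using s12[of i k j] s01[of j i k] s12[of j i k] s01[of k i j] s12[of k j i] s01[of k j i] by simp
  have T: "T 1 2 3 = minor4 4 5 6 7 w1 w2 w3 w4"
    "T 1 4 5 = minor4 2 3 6 7 w1 w2 w3 w4"
    "T 1 6 7 = minor4 2 3 4 5 w1 w2 w3 w4"
    "T 2 4 6 = minor4 1 3 5 7 w1 w2 w3 w4"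
    "T 2 5 7 = minor4 1 3 4 6 w1 w2 w3 w4"
    "T 3 4 7 = minor4 1 2 5 6 w1 w2 w3 w4"
    "T 3 5 6 = minor4 1 2 4 7 w1 w2 w3 w4"
    \<comment> \<open>For \<open>i < j < k\<close> the parameters are \<open>i - 1\<close>,
      \<open>j - 2\<close>, \<open>k - 3\<close>: counting from 0 costs one, and so does each row
      already deleted. Their sums are even, so no sign appears.\<close>
    unfolding T_def
    by (subst vol0_axis[of _ 0 0 0] vol0_axis[of _ 0 2 2] vol0_axis[of _ 0 4 4] vol0_axis[of _ 1 2 3]
      vol0_axis[of _ 1 3 4] vol0_axis[of _ 2 2 4] vol0_axis[of _ 2 3 3],
      simp, simp, simp, simp, simp, simp add: insert_index_def, simp add: insert_index_def,
      unfold det_mat_4, simp add: insert_index_def minor4_def minor3_def algebra_simps)+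
  show ?thesis
    unfolding psi0_def T_def[symmetric] star0_def
    by (simp only: distrib_right left_diff_distrib sum.distrib sum_subtractf sum_minor3 six)
      (simp add: T)
qed

text \<open>Parseval replaces the family \<open>d\<close> by the standard basis one slot at a time;
  the exchanges of sums bring the next slot to the innermost place.\<close>

theorem hodge_psi0:
  assumes d: "\<And>u v. (\<Sum>i\<in>I. (u \<bullet> d i) * (v \<bullet> d i)) = u \<bullet> v"
  shows "(\<Sum>i\<in>I. \<Sum>j\<in>I. \<Sum>k\<in>I. psi0 (d i) (d j) (d k) * vol0 [d i, d j, d k, w1, w2, w3, w4]) =
    6 * star0 w1 w2 w3 w4"
proof -
  let ?T = "\<lambda>x y z. vol0 [x, y, z, w1, w2, w3, w4]"
  have lin: "linear (\<lambda>x. ?T x y z)" "linear (\<lambda>y. ?T x y z)" "linear (\<lambda>z. ?T x y z)" for x y z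
    using linear_vol0[of "[x, y, z, w1, w2, w3, w4]" 0] linear_vol0[of "[x, y, z, w1, w2, w3, w4]" 1]
      linear_vol0[of "[x, y, z, w1, w2, w3, w4]" 2] by (simp_all add: numeral_2_eq_2)
  note p = parseval_linear[OF _ _ d]
  have "(\<Sum>i\<in>I. \<Sum>j\<in>I. \<Sum>k\<in>I. psi0 (d i) (d j) (d k) * ?T (d i) (d j) (d k)) =
      (\<Sum>i\<in>I. \<Sum>j\<in>I. \<Sum>c\<in>UNIV. psi0 (d i) (d j) (axis c 1) * ?T (d i) (d j) (axis c 1))"
    by (intro sum.cong refl p lin linear_psi0)
  also have "\<dots> = (\<Sum>i\<in>I. \<Sum>c\<in>UNIV. \<Sum>j\<in>I. psi0 (d i) (d j) (axis c 1) * ?T (d i) (d j) (axis c 1))"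
    by (intro sum.cong refl sum.swap)
  also have "\<dots> = (\<Sum>i\<in>I. \<Sum>c\<in>UNIV. \<Sum>b\<in>UNIV. psi0 (d i) (axis b 1) (axis c 1) * ?T (d i) (axis b 1) (axis c 1))"
    by (intro sum.cong refl p lin linear_psi0)
  also have "\<dots> = (\<Sum>c\<in>UNIV. \<Sum>i\<in>I. \<Sum>b\<in>UNIV. psi0 (d i) (axis b 1) (axis c 1) * ?T (d i) (axis b 1) (axis c 1))"
    by (rule sum.swap)
  also have "\<dots> = (\<Sum>c\<in>UNIV. \<Sum>b\<in>UNIV. \<Sum>i\<in>I. psi0 (d i) (axis b 1) (axis c 1) * ?T (d i) (axis b 1) (axis c 1))"
    by (intro sum.cong refl sum.swap)
  also have "\<dots> = (\<Sum>c\<in>UNIV. \<Sum>b\<in>UNIV. \<Sum>a\<in>UNIV. psi0 (axis a 1) (axis b 1) (axis c 1) * ?T (axis a 1) (axis b 1) (axis c 1))"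
    by (intro sum.cong refl p lin linear_psi0)
  also have "\<dots> = (\<Sum>b\<in>UNIV. \<Sum>c\<in>UNIV. \<Sum>a\<in>UNIV. psi0 (axis a 1) (axis b 1) (axis c 1) * ?T (axis a 1) (axis b 1) (axis c 1))"
    by (rule sum.swap)
  also have "\<dots> = (\<Sum>b\<in>UNIV. \<Sum>a\<in>UNIV. \<Sum>c\<in>UNIV. psi0 (axis a 1) (axis b 1) (axis c 1) * ?T (axis a 1) (axis b 1) (axis c 1))"
    by (intro sum.cong refl sum.swap)
  also have "\<dots> = (\<Sum>a\<in>UNIV. \<Sum>b\<in>UNIV. \<Sum>c\<in>UNIV. psi0 (axis a 1) (axis b 1) (axis c 1) * ?T (axis a 1) (axis b 1) (axis c 1))"
    by (rule sum.swap)
  finally show ?thesis by (simp add: sum_psi0_vol0_axis)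
qed

section \<open>Oriented planes\<close>

text \<open>Tangent spaces are sets in a function type and their inner product varies with the
  point, so elementary inner product theory is developed relative to a subspace instead of through
  the class \<open>real_inner\<close>.\<close>

locale ip_space =
  fixes V :: "'v::real_vector set" and h :: "'v \<Rightarrow> 'v \<Rightarrow> real"
  assumes subspace: "subspace V" and ip: "inner_product_on V h"
begin

lemma h_sym: "x \<in> V \<Longrightarrow> y \<in> V \<Longrightarrow> h x y = h y x"
  using ip by (auto simp: inner_product_on_def)

lemma h_linear: "x \<in> V \<Longrightarrow> y \<in> V \<Longrightarrow> z \<in> V \<Longrightarrow> h (x + a *\<^sub>R y) z = h x z + a * h y z"
  using ip by (auto simp: inner_product_on_def)

lemma h_pos: "x \<in> V \<Longrightarrow> x \<noteq> 0 \<Longrightarrow> h x x > 0"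
  using ip by (auto simp: inner_product_on_def)

lemma zero_in [simp]: "0 \<in> V" by (rule subspace_0[OF subspace])

lemma add_in: "x \<in> V \<Longrightarrow> y \<in> V \<Longrightarrow> x + y \<in> V" by (rule subspace_add[OF subspace])

lemma scale_in: "x \<in> V \<Longrightarrow> a *\<^sub>R x \<in> V" by (rule subspace_scale[OF subspace])

lemma sum_in: "(\<And>i. i \<in> I \<Longrightarrow> f i \<in> V) \<Longrightarrow> (\<Sum>i\<in>I. c i *\<^sub>R f i) \<in> V"
  by (intro subspace_sum subspace scale_in) auto

lemma h_add: "x \<in> V \<Longrightarrow> y \<in> V \<Longrightarrow> z \<in> V \<Longrightarrow> h (x + y) z = h x z + h y z"
  using h_linear[of x y z 1] by simp

lemma h_zero: "z \<in> V \<Longrightarrow> h 0 z = 0"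
  using h_add[of 0 0 z] by simp

lemma h_scale: "y \<in> V \<Longrightarrow> z \<in> V \<Longrightarrow> h (a *\<^sub>R y) z = a * h y z"
  using h_linear[of 0 y z a] h_zero by simp

lemma h_sum:
  assumes "\<And>i. i \<in> I \<Longrightarrow> f i \<in> V" "z \<in> V"
  shows "h (\<Sum>i\<in>I. c i *\<^sub>R f i) z = (\<Sum>i\<in>I. c i * h (f i) z)"
  using assms(1)
proof (induction I rule: infinite_finite_induct)
  case (insert i I)
  then show ?case using assms(2) by (simp add: h_add h_scale sum_in scale_in)
qed (simp_all add: h_zero assms)

section \<open>Orthonormal frames: Fourier expansion and change of basis\<close>

lemma framesD:
  assumes "vs \<in> orthonormal_frames V h m"
  shows "length vs = m" "set vs \<subseteq> V" "\<And>i. i < m \<Longrightarrow> vs ! i \<in> V"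
    "\<And>i j. i < m \<Longrightarrow> j < m \<Longrightarrow> h (vs ! i) (vs ! j) = (if i = j then 1 else 0)"
  using assms by (auto simp: orthonormal_frames_def)

lemma span_in: "set vs \<subseteq> V \<Longrightarrow> span (set vs) \<subseteq> V"
  by (rule span_minimal[OF _ subspace])

lemma span_sum_nth: "length vs = m \<Longrightarrow> (\<Sum>i<m. c i *\<^sub>R vs ! i) \<in> span (set vs)"
  by (intro span_sum span_scale span_base) simp

text \<open>The vectors equal to their Fourier expansion form a subspace that contains the
  frame.\<close>

lemma span_frame:
  assumes vs: "vs \<in> orthonormal_frames V h m"
  shows "x \<in> span (set vs) \<longleftrightarrow> x \<in> V \<and> x = (\<Sum>i<m. h x (vs ! i) *\<^sub>R vs ! i)"
proof
  note fr = framesD[OF vs]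
  assume "x \<in> span (set vs)"
  then show "x \<in> V \<and> x = (\<Sum>i<m. h x (vs ! i) *\<^sub>R vs ! i)"
  proof (induction rule: span_induct)
    case base
    show ?case
    proof (rule subspaceI; unfold mem_Collect_eq)
      show "0 \<in> V \<and> 0 = (\<Sum>i<m. h 0 (vs ! i) *\<^sub>R vs ! i)" using fr by (simp add: h_zero)
    next
      fix x y assume "x \<in> V \<and> x = (\<Sum>i<m. h x (vs ! i) *\<^sub>R vs ! i)"
        "y \<in> V \<and> y = (\<Sum>i<m. h y (vs ! i) *\<^sub>R vs ! i)"
      then have xy: "x \<in> V" "y \<in> V" and x: "x = (\<Sum>i<m. h x (vs ! i) *\<^sub>R vs ! i)"
        and y: "y = (\<Sum>i<m. h y (vs ! i) *\<^sub>R vs ! i)" by auto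
      have "(\<Sum>i<m. h (x + y) (vs ! i) *\<^sub>R vs ! i) =
          (\<Sum>i<m. h x (vs ! i) *\<^sub>R vs ! i) + (\<Sum>i<m. h y (vs ! i) *\<^sub>R vs ! i)"
        using fr xy by (simp add: h_add scaleR_add_left sum.distrib)
      then show "x + y \<in> V \<and> x + y = (\<Sum>i<m. h (x + y) (vs ! i) *\<^sub>R vs ! i)"
        using x[symmetric] y[symmetric] xy by (simp add: add_in)
    next
      fix c x assume "x \<in> V \<and> x = (\<Sum>i<m. h x (vs ! i) *\<^sub>R vs ! i)"
      then have xy: "x \<in> V" and x: "x = (\<Sum>i<m. h x (vs ! i) *\<^sub>R vs ! i)" by auto
      have "(\<Sum>i<m. h (c *\<^sub>R x) (vs ! i) *\<^sub>R vs ! i) = c *\<^sub>R (\<Sum>i<m. h x (vs ! i) *\<^sub>R vs ! i)"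
        using fr xy by (simp add: h_scale scaleR_sum_right)
      then show "c *\<^sub>R x \<in> V \<and> c *\<^sub>R x = (\<Sum>i<m. h (c *\<^sub>R x) (vs ! i) *\<^sub>R vs ! i)"
        using x[symmetric] xy by (simp add: scale_in)
    qed
  next
    case (step x)
    then obtain j where j: "j < m" "x = vs ! j" using fr(1) by (auto simp: in_set_conv_nth)
    then have "(\<Sum>i<m. h x (vs ! i) *\<^sub>R vs ! i) = (\<Sum>i<m. if i = j then vs ! i else 0)"
      using fr by (intro sum.cong) auto
    then show ?case using j fr by simp
  qed
next
  assume "x \<in> V \<and> x = (\<Sum>i<m. h x (vs ! i) *\<^sub>R vs ! i)"
  then have x: "x = (\<Sum>i<m. h x (vs ! i) *\<^sub>R vs ! i)" by blast
  show "x \<in> span (set vs)"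
    by (subst x, rule span_sum_nth) (use framesD[OF vs] in auto)
qed

lemma frame_parseval:
  assumes vs: "vs \<in> orthonormal_frames V h m" and "x \<in> span (set vs)" "y \<in> V"
  shows "h x y = (\<Sum>i<m. h x (vs ! i) * h (vs ! i) y)"
proof -
  have "h x y = h (\<Sum>i<m. h x (vs ! i) *\<^sub>R vs ! i) y" using span_frame[OF vs, of x] assms by simp
  also have "\<dots> = (\<Sum>i<m. h x (vs ! i) * h (vs ! i) y)"
    using framesD[OF vs] assms by (intro h_sum) auto
  finally show ?thesis .
qed

lemma frame_independent:
  assumes vs: "vs \<in> orthonormal_frames V h m"
  shows "independent (set vs)" "distinct vs"
proof -
  note fr = framesD[OF vs]
  show dist: "distinct vs" using fr by (auto simp: distinct_conv_nth) (metis zero_neq_one)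
  show "independent (set vs)"
  proof (rule independent_if_scalars_zero)
    fix f x assume 0: "(\<Sum>x\<in>set vs. f x *\<^sub>R x) = 0" and x: "x \<in> set vs"
    have xV: "x \<in> V" using x fr by auto
    have "h (\<Sum>y\<in>set vs. f y *\<^sub>R y) x = (\<Sum>y\<in>set vs. f y * h y x)"
      using fr xV by (intro h_sum) auto
    also have "\<dots> = (\<Sum>y\<in>set vs. if y = x then f y else 0)"
      using fr x by (intro sum.cong refl) (auto simp: in_set_conv_nth split: if_splits)
    finally show "f x = 0" using x xV 0 by (simp add: h_zero)
  qed simp
qed

lemma orthonormal_basis_length:
  assumes "D \<in> orthonormal_bases V h" "D' \<in> orthonormal_bases V h"
  shows "length D = length D'"
proof -
  have "length D \<le> length D'" if "D \<in> orthonormal_bases V h" "D' \<in> orthonormal_bases V h" for D D'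
  proof -
    have D: "D \<in> orthonormal_frames V h (length D)" "D' \<in> orthonormal_frames V h (length D')"
      "span (set D') = V" using that by (auto simp: orthonormal_bases_def)
    have "card (set D) \<le> card (set D')"
      using frame_independent[OF D(1)] framesD[OF D(1)] D(3)
      by (intro conjunct2[OF independent_span_bound]) auto
    then show ?thesis
      using frame_independent(2)[OF D(1)] frame_independent(2)[OF D(2)] by (simp add: distinct_card)
  qed
  with assms show ?thesis by (meson order_antisym)
qed

text \<open>Parseval along \<open>vs\<close> turns the matrix of \<open>us\<close> against
  \<open>ws\<close> into a product of matrices.\<close>

lemma frame_det_mult:
  assumes "length us = m" "set us \<subseteq> V" "vs \<in> orthonormal_frames V h m"
    "length ws = m" "set ws \<subseteq> span (set vs)"
  shows "frame_det h us ws = frame_det h us vs * frame_det h vs ws"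
proof -
  note fr = framesD[OF assms(3)]
  have wsV: "set ws \<subseteq> V" using assms(5) span_in[OF fr(2)] by blast
  let ?A = "Matrix.mat m m (\<lambda>(i, j). h (us ! i) (vs ! j))"
  let ?B = "Matrix.mat m m (\<lambda>(i, j). h (vs ! i) (ws ! j))"
  have "Matrix.mat m m (\<lambda>(i, j). h (us ! i) (ws ! j)) = ?A * ?B"
  proof (rule eq_matI)
    fix i j assume "i < dim_row (?A * ?B)" "j < dim_col (?A * ?B)"
    then have ij: "i < m" "j < m" by auto
    then have u: "us ! i \<in> V" and w: "ws ! j \<in> span (set vs)" "ws ! j \<in> V"
      using assms wsV by (auto simp: subset_iff)
    have "h (us ! i) (ws ! j) = h (ws ! j) (us ! i)" using u w by (intro h_sym) auto
    also have "\<dots> = (\<Sum>k<m. h (ws ! j) (vs ! k) * h (vs ! k) (us ! i))"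
      by (rule frame_parseval[OF assms(3) w(1) u])
    also have "\<dots> = (\<Sum>k<m. h (us ! i) (vs ! k) * h (vs ! k) (ws ! j))"
      using fr u w by (intro sum.cong refl) (simp add: h_sym[of "ws ! j"] h_sym[of "us ! i"])
    finally show "Matrix.mat m m (\<lambda>(i, j). h (us ! i) (ws ! j)) $$ (i, j) = (?A * ?B) $$ (i, j)"
      using ij by (simp add: scalar_prod_def lessThan_atLeast0)
  qed auto
  then show ?thesis
    using assms fr by (simp add: frame_det_def) (rule det_mult[of _ m]; simp)
qed

lemma frame_det_sym:
  assumes "set vs \<subseteq> V" "set ws \<subseteq> V" "length vs = length ws"
  shows "frame_det h ws vs = frame_det h vs ws"
proof -
  have "Matrix.mat (length ws) (length vs) (\<lambda>(i, j). h (ws ! i) (vs ! j)) =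
      transpose_mat (Matrix.mat (length vs) (length ws) (\<lambda>(i, j). h (vs ! i) (ws ! j)))"
    using assms by (intro eq_matI) (auto intro!: h_sym)
  then show ?thesis
    unfolding frame_det_def using assms(3) by (simp add: Determinant.det_transpose[of _ "length ws"])
qed

lemma frame_det_self:
  assumes "vs \<in> orthonormal_frames V h m"
  shows "frame_det h vs vs = 1"
proof -
  have "Matrix.mat m m (\<lambda>(i, j). h (vs ! i) (vs ! j)) = 1\<^sub>m m"
    using framesD[OF assms] by (intro eq_matI) auto
  then show ?thesis using framesD[OF assms] by (simp add: frame_det_def)
qed

text \<open>The inverse change of basis has the transposed matrix, hence the same
  determinant.\<close>

lemma frame_det_square:
  assumes "vs \<in> orthonormal_frames V h m" "ws \<in> orthonormal_frames V h m" "set ws \<subseteq> span (set vs)"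
  shows "frame_det h vs ws * frame_det h vs ws = 1"
  using frame_det_mult[of ws m vs ws] frame_det_self[OF assms(2)] assms framesD[OF assms(1)]
    framesD[OF assms(2)] frame_det_sym[of vs ws] by simp

lemma frame_det_eq_1:
  assumes "vs \<in> orthonormal_frames V h m" "ws \<in> orthonormal_frames V h m" "set ws \<subseteq> span (set vs)"
    "frame_det h vs ws > 0"
  shows "frame_det h vs ws = 1"
  using frame_det_square[OF assms(1-3)] assms(4) by (auto simp: square_eq_1_iff)

lemma frame_span_eq:
  assumes vs: "vs \<in> orthonormal_frames V h m" and ws: "ws \<in> orthonormal_frames V h m"
    and sub: "set ws \<subseteq> span (set vs)"
  shows "span (set ws) = span (set vs)"
proof
  show "span (set ws) \<subseteq> span (set vs)" using sub by (simp add: span_minimal)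
  have "card (set ws) = m" "card (set vs) = m"
    using frame_independent(2)[OF vs] frame_independent(2)[OF ws] framesD(1)[OF vs] framesD(1)[OF ws]
    by (simp_all add: distinct_card)
  then have card: "card (set ws) = card (set vs)" by simp
  have "v \<in> span (set ws)" if "v \<in> set vs" for v
  proof (rule ccontr)
    assume v: "v \<notin> span (set ws)"
    then have "independent (insert v (set ws))"
      using frame_independent(1)[OF ws] by (rule independent_insertI)
    moreover have "insert v (set ws) \<subseteq> span (set vs)" using sub that by (simp add: span_base)
    ultimately have "card (insert v (set ws)) \<le> card (set vs)"
      using independent_span_bound[of "set vs"] by blast
    moreover have "v \<notin> set ws" using v span_base by blast
    ultimately show False using card by simp
  qed
  then show "span (set vs) \<subseteq> span (set ws)" by (intro span_minimal) auto
qed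

lemma equiv_same_oriented_plane: "equiv (orthonormal_frames V h m) (same_oriented_plane V h m)"
proof (rule equivI)
  show "same_oriented_plane V h m \<subseteq> orthonormal_frames V h m \<times> orthonormal_frames V h m"
    by (auto simp: same_oriented_plane_def)
  show "refl_on (orthonormal_frames V h m) (same_oriented_plane V h m)"
    by (auto simp: refl_on_def same_oriented_plane_def frame_det_self)
  show "sym (same_oriented_plane V h m)"
    by (auto simp: sym_def same_oriented_plane_def frame_det_sym framesD)
  show "trans (same_oriented_plane V h m)"
  proof (rule transI)
    fix us vs ws assume "(us, vs) \<in> same_oriented_plane V h m" "(vs, ws) \<in> same_oriented_plane V h m"
    then show "(us, ws) \<in> same_oriented_plane V h m"
      using frame_det_mult[of us m vs ws] framesD(1,2)[of us m] framesD(1,2)[of vs m] framesD(1,2)[of ws m]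
        span_superset[of "set ws"]
      by (auto simp: same_oriented_plane_def)
  qed
qed

section \<open>Oriented planes as classes of frames, and the action of isometries on them\<close>

definition plane :: "nat \<Rightarrow> 'v list \<Rightarrow> 'v list set" where
  "plane m vs = same_oriented_plane V h m `` {vs}"

lemma in_plane: "ws \<in> plane m vs \<longleftrightarrow> vs \<in> orthonormal_frames V h m \<and>
    ws \<in> orthonormal_frames V h m \<and> span (set vs) = span (set ws) \<and> frame_det h vs ws > 0"
  by (simp add: plane_def same_oriented_plane_def)

lemma plane_self: "vs \<in> orthonormal_frames V h m \<Longrightarrow> vs \<in> plane m vs"
  by (simp add: in_plane frame_det_self)

lemma plane_eq_iff:
  "vs \<in> orthonormal_frames V h m \<Longrightarrow> ws \<in> orthonormal_frames V h m \<Longrightarrow>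
    plane m vs = plane m ws \<longleftrightarrow> span (set vs) = span (set ws) \<and> frame_det h vs ws > 0"
  unfolding plane_def using eq_equiv_class_iff[OF equiv_same_oriented_plane, of vs m ws]
  by (auto simp: same_oriented_plane_def)

lemma oriented_planes_eq: "oriented_planes V h m = plane m ` orthonormal_frames V h m"
  by (auto simp: oriented_planes_def quotient_def plane_def)

text \<open>Controls the representative on which \<open>form_on_plane\<close> evaluates: nothing is
  known of it except that it is a frame of the same oriented plane.\<close>

lemma oriented_plane_some:
  assumes "\<xi> \<in> oriented_planes V h m"
  shows "(SOME vs. vs \<in> \<xi>) \<in> orthonormal_frames V h m" "\<xi> = plane m (SOME vs. vs \<in> \<xi>)"
    "(SOME vs. vs \<in> \<xi>) \<in> \<xi>"
proof -
  obtain ws where ws: "ws \<in> orthonormal_frames V h m" "\<xi> = plane m ws"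
    using assms by (auto simp: oriented_planes_eq)
  then show *: "(SOME vs. vs \<in> \<xi>) \<in> \<xi>" using plane_self by (metis someI)
  then show "(SOME vs. vs \<in> \<xi>) \<in> orthonormal_frames V h m" "\<xi> = plane m (SOME vs. vs \<in> \<xi>)"
    using ws plane_eq_iff[OF ws(1)] by (auto simp: in_plane)
qed

text \<open>Surjectivity is built in so that the inverse is again an isometry; with it
  \<open>plane_action\<close> is seen to map a class onto a whole class.\<close>

definition isometry :: "('v \<Rightarrow> 'v) \<Rightarrow> bool" where
  "isometry A \<longleftrightarrow> A ` V = V \<and>
     (\<forall>x\<in>V. \<forall>y\<in>V. \<forall>a. A (x + a *\<^sub>R y) = A x + a *\<^sub>R A y) \<and>
     (\<forall>x\<in>V. \<forall>y\<in>V. h (A x) (A y) = h x y)"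

lemma isometryD:
  assumes "isometry A"
  shows "x \<in> V \<Longrightarrow> A x \<in> V" "x \<in> V \<Longrightarrow> y \<in> V \<Longrightarrow> A (x + y) = A x + A y"
    "A 0 = 0" "x \<in> V \<Longrightarrow> A (a *\<^sub>R x) = a *\<^sub>R A x"
    "x \<in> V \<Longrightarrow> y \<in> V \<Longrightarrow> h (A x) (A y) = h x y"
proof -
  have lin: "\<And>x y a. x \<in> V \<Longrightarrow> y \<in> V \<Longrightarrow> A (x + a *\<^sub>R y) = A x + a *\<^sub>R A y"
    using assms by (auto simp: isometry_def)
  show add: "x \<in> V \<Longrightarrow> y \<in> V \<Longrightarrow> A (x + y) = A x + A y" for x y using lin[of x y 1] by simp
  show 0: "A 0 = 0" using add[of 0 0] by simp
  show "x \<in> V \<Longrightarrow> A (a *\<^sub>R x) = a *\<^sub>R A x" using lin[of 0 x a] 0 by simp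
qed (use assms in \<open>auto simp: isometry_def\<close>)

lemma isometry_sum:
  assumes "isometry A" "\<And>i. i \<in> I \<Longrightarrow> f i \<in> V"
  shows "A (\<Sum>i\<in>I. c i *\<^sub>R f i) = (\<Sum>i\<in>I. c i *\<^sub>R A (f i))"
  using assms(2)
proof (induction I rule: infinite_finite_induct)
  case (insert i I)
  then show ?case by (simp add: isometryD[OF assms(1)] sum_in scale_in)
qed (simp_all add: isometryD[OF assms(1)])

lemma isometry_frames:
  assumes "isometry A" "vs \<in> orthonormal_frames V h m"
  shows "map A vs \<in> orthonormal_frames V h m"
  using framesD[OF assms(2)] isometryD[OF assms(1)] by (auto simp: orthonormal_frames_def)

lemma isometry_span:
  assumes A: "isometry A" and vs: "vs \<in> orthonormal_frames V h m"
  shows "span (set (map A vs)) = A ` span (set vs)"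
proof -
  note fr = framesD[OF vs]
  have le: "A x \<in> span (set (map A vs))" if "x \<in> span (set vs)" for x
  proof -
    have x: "x = (\<Sum>i<m. h x (vs ! i) *\<^sub>R vs ! i)" using span_frame[OF vs] that by blast
    have "A x = (\<Sum>i<m. h x (vs ! i) *\<^sub>R A (vs ! i))"
      by (subst x, rule isometry_sum[OF A]) (simp add: fr)
    then show ?thesis using fr span_sum_nth[of "map A vs" m "\<lambda>i. h x (vs ! i)"] by simp
  qed
  moreover have "y \<in> A ` span (set vs)" if "y \<in> span (set (map A vs))" for y
  proof -
    have "y = (\<Sum>i<m. h y (map A vs ! i) *\<^sub>R map A vs ! i)"
      using span_frame[OF isometry_frames[OF A vs]] that by blast
    also have "\<dots> = A (\<Sum>i<m. h y (map A vs ! i) *\<^sub>R vs ! i)"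
      using fr by (subst isometry_sum[OF A]) auto
    finally show ?thesis by (rule image_eqI) (rule span_sum_nth[OF fr(1)])
  qed
  ultimately show ?thesis by blast
qed

lemma isometry_frame_det:
  assumes "isometry A" "set vs \<subseteq> V" "set ws \<subseteq> V"
  shows "frame_det h (map A vs) (map A ws) = frame_det h vs ws"
proof -
  have "Matrix.mat (length vs) (length ws) (\<lambda>(i, j). h (map A vs ! i) (map A ws ! j)) =
      Matrix.mat (length vs) (length ws) (\<lambda>(i, j). h (vs ! i) (ws ! j))"
    using assms isometryD[OF assms(1)] by (intro eq_matI) (auto simp: subset_iff)
  then show ?thesis by (simp add: frame_det_def)
qed

lemma isometry_inj:
  assumes "isometry A"
  shows "inj_on A V"
proof (rule inj_onI)
  fix x y assume xy: "x \<in> V" "y \<in> V" "A x = A y"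
  have mem: "x + (-1) *\<^sub>R y \<in> V" using xy add_in scale_in by blast
  have "A (x + (-1) *\<^sub>R y) = 0"
    using xy isometryD(2)[OF assms, of x "(-1) *\<^sub>R y"] isometryD(4)[OF assms, of y "-1"] scale_in[of y "-1"]
    by simp
  then have "h (x + (-1) *\<^sub>R y) (x + (-1) *\<^sub>R y) = 0"
    using isometryD(5)[OF assms mem mem] by (simp add: h_zero)
  then show "x = y" using h_pos[OF mem] by auto
qed

lemma isometry_inverse:
  assumes A: "isometry A"
  shows "isometry (inv_into V A)"
proof -
  define B where "B = inv_into V A"
  have im: "A ` V = V" using A by (simp add: isometry_def)
  have B: "B x \<in> V" "A (B x) = x" if "x \<in> V" for x
    using that im by (auto simp: B_def f_inv_into_f inv_into_into)
  have BA: "B (A x) = x" if "x \<in> V" for x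
    using that by (simp add: B_def isometry_inj[OF A])
  have "B (x + a *\<^sub>R y) = B x + a *\<^sub>R B y" if "x \<in> V" "y \<in> V" for x y a
    using BA[of "B x + a *\<^sub>R B y"] that B add_in scale_in isometryD[OF A] by simp
  moreover have "h (B x) (B y) = h x y" if "x \<in> V" "y \<in> V" for x y
    using that B isometryD(5)[OF A, of "B x" "B y"] by simp
  moreover have "B ` V = V"
  proof
    show "V \<subseteq> B ` V" using BA isometryD(1)[OF A] by (metis imageI subsetI)
  qed (use B in auto)
  ultimately show ?thesis unfolding isometry_def B_def by blast
qed

text \<open>The inclusion \<open>sub\<close> holds for every isometry; applied to the inverse it
  gives the opposite inclusion.\<close>

lemma plane_action_plane:
  assumes A: "isometry A" and vs: "vs \<in> orthonormal_frames V h m"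
  shows "plane_action A (plane m vs) = plane m (map A vs)"
proof -
  have sub: "map A ws \<in> plane m (map A vs)"
    if "isometry A" "ws \<in> plane m vs" for A ws vs
    using that isometry_frames[OF that(1)] isometry_span[OF that(1)] isometry_frame_det[OF that(1)] framesD(2)
    by (auto simp: in_plane simp del: set_map)
  have inv: "map A (map (inv_into V A) us) = us" "map (inv_into V A) (map A us) = us" if "set us \<subseteq> V" for us
    using that A by (auto intro!: map_idI simp: isometry_def f_inv_into_f inv_into_f_f isometry_inj[OF A] subset_iff)
  have "us \<in> map A ` plane m vs" if "us \<in> plane m (map A vs)" for us
  proof -
    have "map (inv_into V A) us \<in> plane m (map (inv_into V A) (map A vs))"
      by (rule sub[OF isometry_inverse[OF A] that])
    moreover have "set us \<subseteq> V" "set vs \<subseteq> V" using that framesD(2) vs by (auto simp: in_plane)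
    ultimately show ?thesis using inv[of us] inv[of vs] by (metis imageI)
  qed
  with sub[OF A] show ?thesis by (auto simp: plane_action_def)
qed

end

section \<open>Adapted frames\<close>

lemma inner_preserving_surj:
  fixes f :: "'a::euclidean_space \<Rightarrow> 'a"
  assumes "linear f" "\<And>a b. f a \<bullet> f b = a \<bullet> b"
  shows "surj f"
proof -
  have "a = 0" if "f a = 0" for a using assms(2)[of a a] that by simp
  then have "inj f" using assms(1) by (simp add: linear_injective_0)
  then show ?thesis using assms(1) by (simp add: linear_injective_imp_surjective)
qed

text \<open>The defect of multiplicativity is orthogonal to the image of \<open>f\<close>, and that
  image is the whole space.\<close>

lemma g2_mapI:
  assumes "linear f" "\<And>a b. f a \<bullet> f b = a \<bullet> b" "\<And>a b c. psi0 (f a) (f b) (f c) = psi0 a b c"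
  shows "g2_map f"
proof -
  have "surj f" by (rule inner_preserving_surj[OF assms(1,2)])
  have "cross7 (f a) (f b) = f (cross7 a b)" for a b
  proof -
    define d where "d = cross7 (f a) (f b) - f (cross7 a b)"
    have "d \<bullet> f c = 0" for c
      using assms(2)[of "cross7 a b" c] assms(3)[of a b c] by (simp add: d_def inner_diff psi0_eq_inner)
    then have "d \<bullet> d = 0" using \<open>surj f\<close> by (metis surjD)
    then show ?thesis by (simp add: d_def)
  qed
  with assms show ?thesis by (simp add: g2_map_def)
qed

text \<open>Each of \<open>e\<^sub>1, e\<^sub>2, e\<^sub>3\<close> is a product of two of
  \<open>e\<^sub>4, \<dots>, e\<^sub>7\<close>, and a product of two vectors in the span of the
  latter has no component there.\<close>

lemma preserves4_complement:
  assumes f: "g2_map f" "preserves4 f" and "i \<in> {1, 2, 3}" "l \<in> {4, 5, 6, 7}"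
  shows "f (axis i 1) $ l = 0"
proof -
  note cr = conjunct2[OF conjunct2[OF f(1)[unfolded g2_map_def]], rule_format]
  have "cross7 (axis 4 1) (axis 7 1) = axis 3 1"
    by (simp add: Finite_Cartesian_Product.vec_eq_iff forall_7 cross7_components axis_def)
  then have e: "f (axis 1 1) = cross7 (f (axis 4 1)) (f (axis 5 1))"
    "f (axis 2 1) = cross7 (f (axis 4 1)) (f (axis 6 1))"
    "f (axis 3 1) = cross7 (f (axis 4 1)) (f (axis 7 1))"
    unfolding cr by (simp_all add: cross7_axis)
  show ?thesis
    using assms(3,4) f(2) by (auto simp: e cross7_components preserves4_def forall_4)
qed

text \<open>An adapted frame of one tangent space, in coordinates. The frame \<open>E\<close> is a
  parameter since several adapted frames of the same \<open>\<psi>\<close> are compared;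
  \<open>g2_coframe_frame\<close> obtains one from a coframe.\<close>

locale g2_frame = ip_space V h for V :: "'v::real_vector set" and h +
  fixes \<psi> :: "'v list \<Rightarrow> real" and E :: "7 \<Rightarrow> 'v"
  assumes E_in: "E i \<in> V"
    and E_orth: "h (E i) (E j) = (if i = j then 1 else 0)"
    and E_span: "V \<subseteq> span (range E)"
    and psi: "set vs \<subseteq> V \<Longrightarrow> \<psi> vs = (if length vs = 3
       then psi0 (\<chi> i. h (vs ! 0) (E i)) (\<chi> i. h (vs ! 1) (E i)) (\<chi> i. h (vs ! 2) (E i)) else 0)"
begin

definition C :: "'v \<Rightarrow> real^7" where "C v = (\<chi> i. h v (E i))"

definition J :: "real^7 \<Rightarrow> 'v" where "J a = (\<Sum>i\<in>UNIV. a$i *\<^sub>R E i)"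

lemma frame_E: "distinct is \<Longrightarrow> map E is \<in> orthonormal_frames V h (length is)"
  by (auto simp: orthonormal_frames_def E_in E_orth nth_eq_iff_index_eq)

definition EL :: "'v list" where "EL = map E [1, 2, 3, 4, 5, 6, 7]"

lemma EL_length: "length EL = 7"
  by (simp add: EL_def)

lemma EL_frame: "EL \<in> orthonormal_frames V h 7"
  using frame_E[of "[1, 2, 3, 4, 5, 6, 7]"] by (simp add: EL_def eval_nat_numeral)

lemma EL_span: "span (set EL) = V"
proof
  have "range E = set EL" by (simp add: EL_def UNIV_7)
  then show "V \<subseteq> span (set EL)" using E_span by simp
  show "span (set EL) \<subseteq> V" using span_in[of EL] E_in by (simp add: EL_def)
qed

lemma EL_basis: "EL \<in> orthonormal_bases V h"
  using EL_frame EL_span by (simp add: orthonormal_bases_def EL_length)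

lemma EL_nth: "i < 7 \<Longrightarrow> EL ! i = E (of_nat (Suc i))"
proof -
  assume "i < 7"
  then have "i = 0 \<or> i = 1 \<or> i = 2 \<or> i = 3 \<or> i = 4 \<or> i = 5 \<or> i = 6" by linarith
  then show ?thesis by (elim disjE; simp add: EL_def)
qed

lemma J_in: "J a \<in> V"
  by (simp add: J_def sum_in E_in)

lemma C_J: "C (J a) = a"
  by (simp add: C_def J_def h_sum E_in E_orth Finite_Cartesian_Product.vec_eq_iff if_distrib cong: if_cong)

lemma J_C: "v \<in> V \<Longrightarrow> J (C v) = v"
proof -
  assume "v \<in> V"
  then have "v = (\<Sum>i<7. h v (EL ! i) *\<^sub>R EL ! i)" using span_frame[OF EL_frame] EL_span by blast
  also have "\<dots> = J (C v)" by (simp add: J_def C_def sum_7 EL_def eval_nat_numeral)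
  finally show ?thesis ..
qed

lemma C_linear: "x \<in> V \<Longrightarrow> y \<in> V \<Longrightarrow> C (x + a *\<^sub>R y) = C x + a *\<^sub>R C y"
  by (simp add: C_def Finite_Cartesian_Product.vec_eq_iff h_linear E_in)

lemma J_linear: "J (a + r *\<^sub>R b) = J a + r *\<^sub>R J b"
  by (simp add: J_def algebra_simps sum.distrib scaleR_sum_right)

lemma C_E: "C (E i) = axis i 1"
  by (simp add: C_def E_orth axis_def Finite_Cartesian_Product.vec_eq_iff)

lemma J_axis: "J (axis i 1) = E i"
  using J_C[OF E_in, of i] by (simp add: C_E)

lemma h_C: "x \<in> V \<Longrightarrow> y \<in> V \<Longrightarrow> h x y = C x \<bullet> C y"
proof -
  assume xy: "x \<in> V" "y \<in> V"
  have "h x y = h (J (C x)) y" using xy by (simp add: J_C)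
  also have "\<dots> = C x \<bullet> C y"
    unfolding J_def using xy by (simp add: h_sum E_in inner_vec_def C_def h_sym[of "E _" y])
  finally show ?thesis .
qed

lemma psi_C: "x \<in> V \<Longrightarrow> y \<in> V \<Longrightarrow> z \<in> V \<Longrightarrow> \<psi> [x, y, z] = psi0 (C x) (C y) (C z)"
  by (simp add: psi C_def numeral_2_eq_2)

lemma h_J: "h (J a) (J b) = a \<bullet> b"
  by (simp add: h_C J_in C_J)

lemma psi_J: "\<psi> [J a, J b, J c] = psi0 a b c"
  by (simp add: psi_C J_in C_J)

lemma psi_length: "set vs \<subseteq> V \<Longrightarrow> length vs \<noteq> 3 \<Longrightarrow> \<psi> vs = 0"
  by (simp add: psi)

section \<open>Elements of the group in coordinates\<close>

definition coord :: "('v \<Rightarrow> 'v) \<Rightarrow> real^7 \<Rightarrow> real^7" where "coord A = C \<circ> A \<circ> J"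

text \<open>Separates the algebraic conditions on a group element from the determinant, which
  \<open>preserving_det\<close> supplies.\<close>

definition preserving :: "('v \<Rightarrow> 'v) \<Rightarrow> bool" where
  "preserving A \<longleftrightarrow> (\<forall>x\<in>V. A x \<in> V) \<and>
     (\<forall>x\<in>V. \<forall>y\<in>V. \<forall>a. A (x + a *\<^sub>R y) = A x + a *\<^sub>R A y) \<and>
     (\<forall>x\<in>V. \<forall>y\<in>V. h (A x) (A y) = h x y) \<and>
     (\<forall>x\<in>V. \<forall>y\<in>V. \<forall>z\<in>V. \<psi> [A x, A y, A z] = \<psi> [x, y, z])"

lemma preserving_coord:
  assumes "preserving A"
  shows "g2_map (coord A)" and "x \<in> V \<Longrightarrow> A x = J (coord A (C x))" and "x \<in> V \<Longrightarrow> C (A x) = coord A (C x)"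
proof -
  note A = assms[unfolded preserving_def]
  show "x \<in> V \<Longrightarrow> C (A x) = coord A (C x)" for x by (simp add: coord_def J_C)
  show "x \<in> V \<Longrightarrow> A x = J (coord A (C x))" for x using A by (simp add: coord_def J_C)
  have lin: "coord A (a + r *\<^sub>R b) = coord A a + r *\<^sub>R coord A b" for a b r
    using A by (simp add: coord_def J_linear J_in C_linear)
  have add: "coord A (a + b) = coord A a + coord A b" for a b using lin[of a 1 b] by simp
  have "coord A 0 = 0" using add[of 0 0] by simp
  then have "linear (coord A)" using add lin[of 0] by (intro linearI) auto
  moreover have "coord A a \<bullet> coord A b = a \<bullet> b" for a b
    using A by (simp add: coord_def J_in h_J flip: h_C)
  moreover have "psi0 (coord A a) (coord A b) (coord A c) = psi0 a b c" for a b c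
    using A by (simp add: coord_def J_in psi_J flip: psi_C)
  ultimately show "g2_map (coord A)" by (rule g2_mapI)
qed

lemma preserving_isometry:
  assumes "preserving A"
  shows "isometry A"
proof -
  note A = assms[unfolded preserving_def]
  have "y \<in> A ` V" if "y \<in> V" for y
  proof -
    have "linear (coord A)" "\<And>a b. coord A a \<bullet> coord A b = a \<bullet> b"
      using preserving_coord(1)[OF assms] by (auto simp: g2_map_def)
    then have "surj (coord A)" by (rule inner_preserving_surj)
    then obtain a where "coord A a = C y" by (metis surjD)
    then have "A (J a) = y" using preserving_coord(2)[OF assms, of "J a"] that by (simp add: J_in C_J J_C)
    then show ?thesis using J_in by blast
  qed
  with A show ?thesis by (auto simp: isometry_def)
qed

lemma preserving_psi:
  assumes "preserving A" "set vs \<subseteq> V"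
  shows "\<psi> (map A vs) = \<psi> vs"
proof (cases "length vs = 3")
  case True
  then obtain x y z where "vs = [x, y, z]" by (auto simp: eval_nat_numeral length_Suc_conv)
  then show ?thesis using assms by (simp add: preserving_def)
next
  case False
  moreover have "set (map A vs) \<subseteq> V" using assms by (auto simp: preserving_def)
  ultimately show ?thesis using psi_length assms(2) by (metis length_map)
qed

lemma vol_eq_vol0:
  assumes "length vs = 7" "set vs \<subseteq> V"
  shows "frame_det h EL vs = vol0 (map C vs)"
proof -
  have "Matrix.mat 7 7 (\<lambda>(i, j). h (EL ! i) (vs ! j)) =
      Matrix.mat 7 7 (\<lambda>(i, j). map C vs ! j $ of_nat (Suc i))"
    using assms by (intro eq_matI) (auto simp: EL_nth C_def simp del: of_nat_Suc intro!: h_sym E_in)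
  moreover have "length EL = 7" by (simp add: EL_def)
  ultimately show ?thesis using assms by (simp add: frame_det_def vol0_def)
qed

lemma basis_length: "D \<in> orthonormal_bases V h \<Longrightarrow> length D = 7"
  using orthonormal_basis_length[OF _ EL_basis] by (simp add: EL_def)

lemma basis_frame: "D \<in> orthonormal_bases V h \<Longrightarrow> D \<in> orthonormal_frames V h 7"
  using basis_length[of D] by (simp add: orthonormal_bases_def)

text \<open>The coordinate vectors of \<open>D\<close> form a Parseval family whatever the
  orientation of \<open>D\<close>; the volume form is fixed by \<open>EL\<close> alone.\<close>

lemma hodge_psi:
  assumes D: "D \<in> orthonormal_bases V h" and w: "w1 \<in> V" "w2 \<in> V" "w3 \<in> V" "w4 \<in> V"
  shows "(\<Sum>i<7. \<Sum>j<7. \<Sum>k<7. \<psi> [D!i, D!j, D!k] * frame_det h EL [D!i, D!j, D!k, w1, w2, w3, w4]) =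
    6 * star0 (C w1) (C w2) (C w3) (C w4)"
proof -
  note fr = framesD[OF basis_frame[OF D]]
  have "(\<Sum>i<7. (u \<bullet> C (D!i)) * (v \<bullet> C (D!i))) = u \<bullet> v" for u v
  proof -
    have "u \<bullet> v = h (J u) (J v)" by (simp add: h_C J_in C_J)
    also have "\<dots> = (\<Sum>i<7. h (J u) (D!i) * h (D!i) (J v))"
      using D by (intro frame_parseval[OF basis_frame[OF D]]) (auto simp: J_in orthonormal_bases_def)
    also have "\<dots> = (\<Sum>i<7. (u \<bullet> C (D!i)) * (v \<bullet> C (D!i)))"
      using fr by (intro sum.cong refl) (simp add: h_C J_in C_J inner_commute[of v])
    finally show ?thesis ..
  qed
  from hodge_psi0[OF this] show ?thesis
    using fr w by (simp add: psi_C vol_eq_vol0)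
qed

text \<open>Applying \<open>A\<close> multiplies the volume form in the Hodge formula for \<open>*\<psi>\<close> by the determinant, while
  \<open>*\<psi> \<noteq> 0\<close> is invariant.\<close>

theorem preserving_det:
  assumes A: "preserving A" and D: "D \<in> orthonormal_bases V h"
  shows "frame_det h D (map A D) = 1"
proof -
  note iso = preserving_isometry[OF A]
  have frD: "D \<in> orthonormal_frames V h 7" and spD: "span (set D) = V"
    using basis_frame[OF D] D by (auto simp: orthonormal_bases_def)
  note fr = framesD[OF frD]
  have frAD: "map A D \<in> orthonormal_frames V h 7" by (rule isometry_frames[OF iso frD])
  have spAD: "span (set (map A D)) = V"
    using isometry_span[OF iso frD] spD iso by (simp add: isometry_def)
  have AD: "map A D \<in> orthonormal_bases V h"
    using frAD spAD fr(1) by (simp add: orthonormal_bases_def)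
  note frEL = framesD[OF EL_frame]
  have vol: "frame_det h EL (map A vs) = frame_det h D (map A D) * frame_det h EL vs"
    if vs: "set vs \<subseteq> V" "length vs = 7" for vs
  proof -
    have "set (map A vs) \<subseteq> V" "set (map A D) \<subseteq> V" using vs fr(2) isometryD(1)[OF iso] by auto
    then have "frame_det h EL (map A vs) = frame_det h EL (map A D) * frame_det h (map A D) (map A vs)"
      "frame_det h EL (map A D) = frame_det h EL D * frame_det h D (map A D)"
      "frame_det h EL vs = frame_det h EL D * frame_det h D vs"
      using vs frEL frAD frD spAD spD fr
      by (intro frame_det_mult[of _ 7]; simp)+
    then show ?thesis using isometry_frame_det[OF iso fr(2) vs(1)] by simp
  qed
  have Aw: "A (E i) \<in> V" for i using isometryD(1)[OF iso E_in] .
  have st: "star0 (C (A (E 4))) (C (A (E 5))) (C (A (E 6))) (C (A (E 7))) = 1"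
    using g2_map_star0[OF preserving_coord(1)[OF A]]
    by (simp add: preserving_coord(3)[OF A] E_in C_E) (simp add: star0_def minor4_def minor3_def axis_def)
  have "6 = (\<Sum>i<7. \<Sum>j<7. \<Sum>k<7. \<psi> [map A D!i, map A D!j, map A D!k] *
      frame_det h EL [map A D!i, map A D!j, map A D!k, A (E 4), A (E 5), A (E 6), A (E 7)])"
    using hodge_psi[OF AD Aw Aw Aw Aw, of 4 5 6 7] st by simp
  also have "\<dots> = (\<Sum>i<7. \<Sum>j<7. \<Sum>k<7. frame_det h D (map A D) * (\<psi> [D!i, D!j, D!k] *
      frame_det h EL [D!i, D!j, D!k, E 4, E 5, E 6, E 7]))"
  proof (intro sum.cong refl)
    fix i j k :: nat assume "i \<in> {..<7}" "j \<in> {..<7}" "k \<in> {..<7}"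
    then have i: "i < length D" "j < length D" "k < length D" "D!i \<in> V" "D!j \<in> V" "D!k \<in> V" using fr by auto
    show "\<psi> [map A D!i, map A D!j, map A D!k] *
      frame_det h EL [map A D!i, map A D!j, map A D!k, A (E 4), A (E 5), A (E 6), A (E 7)] =
      frame_det h D (map A D) * (\<psi> [D!i, D!j, D!k] * frame_det h EL [D!i, D!j, D!k, E 4, E 5, E 6, E 7])"
      using vol[of "[D!i, D!j, D!k, E 4, E 5, E 6, E 7]"] preserving_psi[OF A, of "[D!i, D!j, D!k]"] i
      by (simp add: E_in)
  qed
  also have "\<dots> = frame_det h D (map A D) * (6 * star0 (C (E 4)) (C (E 5)) (C (E 6)) (C (E 7)))"
    by (simp only: hodge_psi[OF D E_in E_in E_in E_in, symmetric] sum_distrib_left)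
  also have "star0 (C (E 4)) (C (E 5)) (C (E 6)) (C (E 7)) = 1"
    by (simp add: C_E star0_def minor4_def minor3_def axis_def)
  finally show ?thesis by simp
qed

lemma g2_groupI:
  assumes "preserving A" "A \<in> extensional V"
  shows "A \<in> carrier (g2_group V h \<psi>)"
  using assms preserving_det[OF assms(1)] preserving_psi[OF assms(1)]
  by (auto simp: g2_group_def special_orthogonal_def PiE_def preserving_def)

lemma g2_groupD:
  assumes "A \<in> carrier (g2_group V h \<psi>)"
  shows "preserving A" "A \<in> extensional V"
proof -
  have psi: "\<psi> (map A vs) = \<psi> vs" if "set vs \<subseteq> V" for vs
    using assms that by (auto simp: g2_group_def)
  have "\<psi> [A x, A y, A z] = \<psi> [x, y, z]" if "x \<in> V" "y \<in> V" "z \<in> V" for x y z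
    using psi[of "[x, y, z]"] that by simp
  then show "preserving A" "A \<in> extensional V"
    using assms by (auto simp: g2_group_def special_orthogonal_def PiE_def preserving_def)
qed

text \<open>The inverse of \<open>coord\<close>, restricted to \<open>V\<close> because group
  elements are extensional.\<close>

definition act :: "(real^7 \<Rightarrow> real^7) \<Rightarrow> 'v \<Rightarrow> 'v" where
  "act f = restrict (J \<circ> f \<circ> C) V"

lemma act:
  assumes "g2_map f"
  shows "act f \<in> carrier (g2_group V h \<psi>)" "coord (act f) = f"
proof -
  have f: "linear f" "\<And>a b. f a \<bullet> f b = a \<bullet> b" using assms by (auto simp: g2_map_def)
  have "preserving (act f)"
    using f add_in scale_in
    by (auto simp: preserving_def act_def J_in C_linear linear_add linear_scale J_linear h_C C_J psi_C
      g2_map_psi0[OF assms])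
  then show "act f \<in> carrier (g2_group V h \<psi>)" by (rule g2_groupI) (simp add: act_def)
  show "coord (act f) = f" by (rule ext) (simp add: coord_def act_def J_in C_J)
qed

lemma act_coord: "A \<in> carrier (g2_group V h \<psi>) \<Longrightarrow> act (coord A) = A"
  using preserving_coord(2)[of A] g2_groupD[of A]
  by (intro extensionalityI[of _ V]) (auto simp: act_def)

lemma g2_frame_image:
  assumes A: "A \<in> carrier (g2_group V h \<psi>)"
  shows "g2_frame V h \<psi> (\<lambda>i. A (E i))"
proof
  note p = g2_groupD(1)[OF A]
  note iso = preserving_isometry[OF p]
  show AV: "A (E i) \<in> V" for i by (rule isometryD(1)[OF iso E_in])
  show "h (A (E i)) (A (E j)) = (if i = j then 1 else 0)" for i j
    by (simp add: isometryD(5)[OF iso] E_in E_orth)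
  have "range (\<lambda>i. A (E i)) = set (map A EL)" by (auto simp: EL_def UNIV_7)
  moreover have "span (set (map A EL)) = V"
    using isometry_span[OF iso EL_frame] iso by (simp add: EL_span isometry_def)
  ultimately show "V \<subseteq> span (range (\<lambda>i. A (E i)))" by simp
  \<comment> \<open>The coordinates of \<open>v\<close> in the image frame are those of its preimage
    under \<open>A\<close> in the frame \<open>E\<close>.\<close>
  have c: "(\<chi> i. h v (A (E i))) = C (inv_into V A v)" and "inv_into V A v \<in> V" "A (inv_into V A v) = v" if "v \<in> V" for v
  proof -
    show *: "inv_into V A v \<in> V" "A (inv_into V A v) = v"
      using that iso by (auto simp: isometry_def inv_into_into f_inv_into_f)
    show "(\<chi> i. h v (A (E i))) = C (inv_into V A v)"
      using isometryD(5)[OF iso *(1) E_in] *(2) by (simp add: C_def)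
  qed
  note c = this
  fix vs assume vs: "set vs \<subseteq> V"
  show "\<psi> vs = (if length vs = 3
       then psi0 (\<chi> i. h (vs ! 0) (A (E i))) (\<chi> i. h (vs ! 1) (A (E i))) (\<chi> i. h (vs ! 2) (A (E i))) else 0)"
  proof (cases "length vs = 3")
    case True
    then obtain x y z where vs': "vs = [x, y, z]" by (auto simp: eval_nat_numeral length_Suc_conv)
    with vs have "x \<in> V" "y \<in> V" "z \<in> V" by auto
    then have "\<psi> [x, y, z] = \<psi> [inv_into V A x, inv_into V A y, inv_into V A z]"
      using preserving_psi[OF p, of "[inv_into V A x, inv_into V A y, inv_into V A z]"] c by simp
    with \<open>x \<in> V\<close> \<open>y \<in> V\<close> \<open>z \<in> V\<close> have "\<psi> vs = psi0 (C (inv_into V A x)) (C (inv_into V A y)) (C (inv_into V A z))"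
      using c(2) by (simp add: vs' psi_C)
    then show ?thesis using c \<open>x \<in> V\<close> \<open>y \<in> V\<close> \<open>z \<in> V\<close> vs' by simp
  qed (use vs psi_length in auto)
qed

lemma g2_frame_of_map:
  assumes "g2_map f"
  shows "g2_frame V h \<psi> (\<lambda>i. J (f (axis i 1)))"
  using g2_frame_image[OF act(1)[OF assms]] by (simp add: act_def E_in C_E)

text \<open>The element sends a vector to the one with the same coordinates in the other frame; both
  frames express \<open>\<psi>\<close> by the same \<open>psi0\<close>.\<close>

lemma transitive_on_frames:
  assumes "g2_frame V h \<psi> F"
  shows "\<exists>A\<in>carrier (g2_group V h \<psi>). \<forall>i. A (E i) = F i"
proof -
  interpret F: g2_frame V h \<psi> F by fact
  define A where "A = restrict (F.J \<circ> C) V"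
  have "preserving A"
    using add_in scale_in
    by (auto simp: preserving_def A_def F.J_in C_linear F.J_linear F.h_J F.psi_J)
      (auto simp: h_C psi_C)
  then have "A \<in> carrier (g2_group V h \<psi>)" by (rule g2_groupI) (simp add: A_def)
  moreover have "A (E i) = F i" for i by (simp add: A_def E_in C_E F.J_axis)
  ultimately show ?thesis by blast
qed


section \<open>Contact planes and their stabilizers\<close>

lemma in_span_iff:
  assumes "distinct is"
  shows "v \<in> span (E ` set is) \<longleftrightarrow> v \<in> V \<and> (\<forall>i. i \<notin> set is \<longrightarrow> C v $ i = 0)"
proof
  note fr = frame_E[OF assms]
  assume "v \<in> span (E ` set is)"
  then have v: "v \<in> V" "v = (\<Sum>k<length is. h v (map E is ! k) *\<^sub>R map E is ! k)"
    using span_frame[OF fr] by simp_all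
  have "C v $ i = 0" if "i \<notin> set is" for i
  proof -
    have "h v (E i) = h (\<Sum>k<length is. h v (map E is ! k) *\<^sub>R map E is ! k) (E i)" using v(2) by simp
    also have "\<dots> = (\<Sum>k<length is. h v (map E is ! k) * h (map E is ! k) (E i))"
      by (rule h_sum) (simp_all add: E_in)
    also have "\<dots> = 0" using that by (intro sum.neutral) (auto simp: E_orth)
    finally show ?thesis by (simp add: C_def)
  qed
  with v(1) show "v \<in> V \<and> (\<forall>i. i \<notin> set is \<longrightarrow> C v $ i = 0)" by blast
next
  assume v: "v \<in> V \<and> (\<forall>i. i \<notin> set is \<longrightarrow> C v $ i = 0)"
  then have "v = J (C v)" by (simp add: J_C)
  also have "\<dots> = (\<Sum>i\<in>set is. C v $ i *\<^sub>R E i)"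
    unfolding J_def using v by (intro sum.mono_neutral_right) auto
  finally show "v \<in> span (E ` set is)" by (metis (no_types, lifting) imageI span_base span_scale span_sum)
qed

text \<open>Only the term \<open>e\<^sup>1\<^sup>2\<^sup>3\<close> survives on this span, so
  \<open>\<psi>\<close> restricts to the volume form and takes the value 1 on every positively
  oriented orthonormal basis.\<close>

lemma psi_on_plane:
  assumes "ws \<in> orthonormal_frames V h 3" "set ws \<subseteq> span (E ` {1, 2, 3})"
  shows "\<psi> ws = frame_det h (map E [1, 2, 3]) ws"
proof -
  obtain x y z where ws: "ws = [x, y, z]" using framesD(1)[OF assms(1)] by (auto simp: eval_nat_numeral length_Suc_conv)
  have V: "x \<in> V" "y \<in> V" "z \<in> V" using framesD(2)[OF assms(1)] by (auto simp: ws)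
  have "C v $ i = 0" if "v \<in> set ws" "i \<in> {4, 5, 6, 7}" for v i
    using in_span_iff[of "[1, 2, 3]" v] assms(2) that by auto
  then have z: "C v $ 4 = 0" "C v $ 5 = 0" "C v $ 6 = 0" "C v $ 7 = 0" if "v \<in> set ws" for v
    using that by auto
  have hC: "h (E i) v = C v $ i" if "v \<in> V" for i v using that by (simp add: C_def h_sym E_in)
  have "frame_det h (map E [1, 2, 3]) ws = Determinant.det (Matrix.mat 3 3 (\<lambda>(i, j). h ([E 1, E 2, E 3] ! i) ([x, y, z] ! j)))"
    by (simp add: frame_det_def ws eval_nat_numeral)
  also have "\<dots> = minor3 1 2 3 (C x) (C y) (C z)"
    by (subst det_mat_3) (simp add: hC V minor3_def numeral_2_eq_2 algebra_simps)
  also have "\<dots> = \<psi> ws"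
    using z by (simp add: psi_C ws V psi0_def) (simp add: minor3_def)
  finally show ?thesis ..
qed

lemma star_on_plane:
  assumes "[x, y, z, w] \<in> orthonormal_frames V h 4" "set [x, y, z, w] \<subseteq> span (E ` {4, 5, 6, 7})"
  shows "star0 (C x) (C y) (C z) (C w) = frame_det h (map E [4, 5, 6, 7]) [x, y, z, w]"
proof -
  have V: "x \<in> V" "y \<in> V" "z \<in> V" "w \<in> V" using framesD(2)[OF assms(1)] by auto
  have "C v $ i = 0" if "v \<in> set [x, y, z, w]" "i \<in> {1, 2, 3}" for v i
    using in_span_iff[of "[4, 5, 6, 7]" v] assms(2) that by auto
  then have z: "C v $ 1 = 0" "C v $ 2 = 0" "C v $ 3 = 0" if "v \<in> set [x, y, z, w]" for v
    using that by auto
  have hC: "h (E i) v = C v $ i" if "v \<in> V" for i v using that by (simp add: C_def h_sym E_in)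
  have "frame_det h (map E [4, 5, 6, 7]) [x, y, z, w] =
      Determinant.det (Matrix.mat 4 4 (\<lambda>(i, j). h ([E 4, E 5, E 6, E 7] ! i) ([x, y, z, w] ! j)))"
    by (simp add: frame_det_def eval_nat_numeral)
  also have "\<dots> = minor4 4 5 6 7 (C x) (C y) (C z) (C w)"
    by (subst det_mat_4) (simp add: hC V minor3_def minor4_def numeral_2_eq_2 numeral_3_eq_3 algebra_simps)
  also have "\<dots> = star0 (C x) (C y) (C z) (C w)"
    using z by (simp add: star0_def) (simp add: minor3_def minor4_def)
  finally show ?thesis ..
qed

lemma orthonormal_triple_C:
  assumes "vs \<in> orthonormal_frames V h m" "i < m" "j < m" "k < m" "i \<noteq> j" "i \<noteq> k" "j \<noteq> k"
  shows "orthonormal_triple (C (vs ! i)) (C (vs ! j)) (C (vs ! k))"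
  using framesD[OF assms(1)] assms(2-) by (simp add: orthonormal_triple_def flip: h_C)

lemma psi_le_1:
  assumes "vs \<in> orthonormal_frames V h 3"
  shows "\<psi> vs \<le> 1"
proof -
  obtain x y z where vs: "vs = [x, y, z]" using framesD(1)[OF assms] by (auto simp: eval_nat_numeral length_Suc_conv)
  then show ?thesis
    using framesD(2)[OF assms] psi0_le_1(1)[OF orthonormal_triple_C[OF assms, of 0 1 2]]
    by (simp add: psi_C numeral_2_eq_2)
qed

lemma psi_contact:
  assumes "vs \<in> orthonormal_frames V h 3" "\<psi> vs = 1"
  shows "\<exists>F. g2_frame V h \<psi> F \<and> vs = map F [1, 2, 3]"
proof -
  obtain x y z where vs: "vs = [x, y, z]" using framesD(1)[OF assms(1)] by (auto simp: eval_nat_numeral length_Suc_conv)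
  have V: "x \<in> V" "y \<in> V" "z \<in> V" using framesD(2)[OF assms(1)] by (auto simp: vs)
  have "orthonormal_triple (C x) (C y) (C z)"
    using orthonormal_triple_C[OF assms(1), of 0 1 2] by (simp add: vs numeral_2_eq_2)
  moreover have "psi0 (C x) (C y) (C z) = 1" using assms(2) V by (simp add: vs psi_C)
  ultimately obtain f where "g2_map f" "f (axis 1 1) = C x" "f (axis 2 1) = C y" "f (axis 3 1) = C z"
    by (rule psi0_contact)
  then show ?thesis using g2_frame_of_map[of f] V by (intro exI[of _ "\<lambda>i. J (f (axis i 1))"]) (simp add: vs J_C)
qed

lemma star_le_1:
  assumes "[x, y, z, w] \<in> orthonormal_frames V h 4"
  shows "star0 (C x) (C y) (C z) (C w) \<le> 1"
    and "star0 (C x) (C y) (C z) (C w) = 1 \<Longrightarrow> \<exists>F. g2_frame V h \<psi> F \<and> [x, y, z, w] = map F [4, 5, 6, 7]"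
proof -
  note fr = framesD[OF assms]
  have V: "x \<in> V" "y \<in> V" "z \<in> V" "w \<in> V" using fr(2) by auto
  have tr: "orthonormal_triple (C x) (C y) (C z)"
    using orthonormal_triple_C[OF assms, of 0 1 2] by (simp add: numeral_2_eq_2)
  have u: "C w \<bullet> C w = 1" using fr(4)[of 3 3] V by (simp add: h_C numeral_3_eq_3)
  show "star0 (C x) (C y) (C z) (C w) \<le> 1" by (rule star0_le_1(1)[OF tr u])
  assume "star0 (C x) (C y) (C z) (C w) = 1"
  note ct = star0_contact[OF tr u this]
  show "\<exists>F. g2_frame V h \<psi> F \<and> [x, y, z, w] = map F [4, 5, 6, 7]"
    by (rule exI, rule conjI, rule g2_frame_of_map[OF ct(1)]) (simp add: ct V J_C)
qed

lemma preserves4_iff: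
  assumes "A \<in> carrier (g2_group V h \<psi>)"
  shows "preserves4 (coord A) \<longleftrightarrow> (\<forall>j. A (E (emb4 j)) \<in> span (E ` {4, 5, 6, 7}))"
proof -
  have "A (E i) \<in> V" for i using g2_groupD(1)[OF assms] E_in by (simp add: preserving_def)
  moreover have "(\<forall>i. i \<notin> set [4, 5, 6, 7] \<longrightarrow> P i) \<longleftrightarrow> P 1 \<and> P 2 \<and> P 3" for P :: "7 \<Rightarrow> bool"
    by (auto simp: forall_7)
  ultimately show ?thesis
    using in_span_iff[of "[4, 5, 6, 7]"] by (simp add: preserves4_def coord_def J_axis)
qed

text \<open>An element that preserves the span also preserves its orientation: the determinant of
  the restriction is the value of \<open>star0\<close> on the images of
  \<open>e\<^sub>4, \<dots>, e\<^sub>7\<close>, which is 1.\<close>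

lemma stabilizer_star_plane:
  assumes A: "A \<in> carrier (g2_group V h \<psi>)"
  shows "plane_action A (plane 4 (map E [4, 5, 6, 7])) = plane 4 (map E [4, 5, 6, 7]) \<longleftrightarrow> preserves4 (coord A)"
proof -
  let ?es = "map E [4, 5, 6, 7]"
  note p = g2_groupD(1)[OF A]
  note iso = preserving_isometry[OF p]
  have fr: "?es \<in> orthonormal_frames V h 4" using frame_E[of "[4, 5, 6, 7]"] by (simp add: eval_nat_numeral)
  have frA: "map A ?es \<in> orthonormal_frames V h 4" by (rule isometry_frames[OF iso fr])
  have all: "(\<forall>j. A (E (emb4 j)) \<in> S) \<longleftrightarrow> set (map A ?es) \<subseteq> S" for S by (auto simp: forall_4)
  show ?thesis
  proof
    assume "plane_action A (plane 4 ?es) = plane 4 ?es"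
    then have "span (set (map A ?es)) = span (set ?es)"
      using plane_eq_iff[OF frA fr] plane_action_plane[OF iso fr] by simp
    then show "preserves4 (coord A)"
      unfolding preserves4_iff[OF A] all using span_superset[of "set (map A ?es)"] by simp
  next
    assume pr: "preserves4 (coord A)"
    then have sub: "set (map A ?es) \<subseteq> span (set ?es)" by (simp add: preserves4_iff[OF A] forall_4)
    have "frame_det h ?es (map A ?es) = star0 (C (A (E 4))) (C (A (E 5))) (C (A (E 6))) (C (A (E 7)))"
      using star_on_plane[of "A (E 4)" "A (E 5)" "A (E 6)" "A (E 7)"] frA sub by simp
    also have "\<dots> = 1"
      using g2_map_star0[OF preserving_coord(1)[OF p]]
      by (simp add: preserving_coord(3)[OF p] E_in C_E) (simp add: star0_def minor4_def minor3_def axis_def)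
    finally show "plane_action A (plane 4 ?es) = plane 4 ?es"
      unfolding plane_action_plane[OF iso fr] using plane_eq_iff[OF fr frA] frame_span_eq[OF fr frA sub] by simp
  qed
qed

text \<open>From left to right the complement is reached by orthogonality, from right to left the
  span of \<open>e\<^sub>1, e\<^sub>2, e\<^sub>3\<close> by \<open>preserves4_complement\<close>.
  Here \<open>\<psi>\<close> itself computes the determinant of the restriction.\<close>

lemma stabilizer_psi_plane:
  assumes A: "A \<in> carrier (g2_group V h \<psi>)"
  shows "plane_action A (plane 3 (map E [1, 2, 3])) = plane 3 (map E [1, 2, 3]) \<longleftrightarrow> preserves4 (coord A)"
proof -
  let ?es = "map E [1, 2, 3]"
  note p = g2_groupD(1)[OF A]
  note iso = preserving_isometry[OF p]
  have fr: "?es \<in> orthonormal_frames V h 3" using frame_E[of "[1, 2, 3]"] by (simp add: eval_nat_numeral)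
  have frA: "map A ?es \<in> orthonormal_frames V h 3" by (rule isometry_frames[OF iso fr])
  have AV: "A (E i) \<in> V" for i by (rule isometryD(1)[OF iso E_in])
  show ?thesis
  proof
    assume "plane_action A (plane 3 ?es) = plane 3 ?es"
    then have "span (set (map A ?es)) = span (set ?es)"
      using plane_eq_iff[OF frA fr] plane_action_plane[OF iso fr] by simp
    then have sp: "A ` span (E ` {1, 2, 3}) = span (E ` {1, 2, 3})"
      using isometry_span[OF iso fr] by simp
    have "h (A (E (emb4 j))) (E i) = 0" if i: "i \<in> {1, 2, 3}" for i j
    proof -
      have "E i \<in> span (E ` {1, 2, 3})" using i by (auto intro: span_base)
      then obtain x where x: "x \<in> span (E ` {1, 2, 3})" "E i = A x" using sp by blast
      then have xV: "x \<in> V" and "C x $ emb4 j = 0"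
        using in_span_iff[of "[1, 2, 3]" x] exhaust_4[of j] by auto
      then show ?thesis using isometryD(5)[OF iso E_in xV] x(2) by (simp add: C_def h_sym[OF E_in])
    qed
    then show "preserves4 (coord A)" by (simp add: preserves4_def coord_def J_axis C_def)
  next
    assume pr: "preserves4 (coord A)"
    have "A (E i) \<in> span (E ` set [1, 2, 3])" if i: "i \<in> {1, 2, 3}" for i
    proof -
      have "C (A (E i)) $ l = 0" if "l \<notin> set [1, 2, 3]" for l
        using preserves4_complement[OF preserving_coord(1)[OF p] pr i, of l] that exhaust_7[of l]
        by (auto simp: coord_def J_axis)
      then show ?thesis using in_span_iff[of "[1, 2, 3]" "A (E i)"] AV by simp
    qed
    then have sub: "set (map A ?es) \<subseteq> span (set ?es)" by simp
    have "frame_det h ?es (map A ?es) = \<psi> (map A ?es)"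
      using psi_on_plane[OF frA] sub by simp
    also have "\<dots> = \<psi> ?es" using framesD(2)[OF fr] by (rule preserving_psi[OF p])
    also have "\<dots> = 1" by (simp add: psi_C E_in C_E) (simp add: psi0_def minor3_def axis_def)
    finally show "plane_action A (plane 3 ?es) = plane 3 ?es"
      unfolding plane_action_plane[OF iso fr] using plane_eq_iff[OF fr frA] frame_span_eq[OF fr frA sub] by simp
  qed
qed

end

section \<open>Orbits and stabilizers\<close>

text \<open>The classes of the vector type do not relate topology and vector operations; the
  continuity that is used enters as hypotheses, which are verified for tangent spaces below.\<close>

lemma topological_group_iso_SO4:
  fixes V :: "'v::{real_vector,topological_space} set"
  assumes frame: "g2_frame V h \<psi> E"
    and h_cont: "\<And>w. w \<in> V \<Longrightarrow> continuous_on V (\<lambda>v. h v w)"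
    and comb_cont: "\<And>F::7 \<Rightarrow> 'v. (\<And>i. F i \<in> V) \<Longrightarrow>
      continuous_on UNIV (\<lambda>a::real^7. \<Sum>i\<in>UNIV. a$i *\<^sub>R F i)"
    and S: "S = {A \<in> carrier (g2_group V h \<psi>). preserves4 (g2_frame.coord h E A)}"
  shows "topological_group_iso ((g2_group V h \<psi>)\<lparr>carrier := S\<rparr>) SO4"
proof -
  interpret g2_frame V h \<psi> E by fact
  define \<Phi> where "\<Phi> A = block4 (coord A)" for A
  define \<Psi> where "\<Psi> Q = act (g2_extension Q)" for Q
  have S': "A \<in> S \<Longrightarrow> A \<in> carrier (g2_group V h \<psi>) \<and> preserves4 (coord A) \<and> g2_map (coord A)" for A
    using preserving_coord(1) g2_groupD by (auto simp: S)
  have SO4: "carrier SO4 = {Q. rotation_matrix Q}" by (simp add: SO4_def)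
  have \<Phi>_in: "\<Phi> A \<in> carrier SO4" and \<Psi>\<Phi>: "\<Psi> (\<Phi> A) = A" if "A \<in> S" for A
    using S'[OF that] by (simp_all add: SO4 \<Phi>_def \<Psi>_def rotation_block4 g2_extension_block4 act_coord)
  have \<Psi>_in: "\<Psi> Q \<in> S" and \<Phi>\<Psi>: "\<Phi> (\<Psi> Q) = Q" if "Q \<in> carrier SO4" for Q
    using g2_extension[of Q] that act[of "g2_extension Q"] by (simp_all add: SO4 S \<Phi>_def \<Psi>_def)
  have cont\<Phi>: "continuous_on S \<Phi>"
  proof -
    have "continuous_on S (\<lambda>A. h (A (E j)) (E i))" for i j
    proof (rule continuous_on_compose2[OF h_cont[OF E_in]])
      show "continuous_on S (\<lambda>A. A (E j))"
        by (rule continuous_on_subset[OF continuous_on_product_coordinates]) simp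
      show "(\<lambda>A. A (E j)) ` S \<subseteq> V"
        using S' g2_groupD(1) E_in by (auto simp: preserving_def)
    qed
    then show ?thesis
      unfolding \<Phi>_def block4_def coord_def by (simp add: J_axis C_def continuous_on_vec_lambda)
  qed
  have cont\<Psi>: "continuous_on T \<Psi>" for T
  proof (rule continuous_on_coordinatewise_then_product)
    fix v
    have "continuous_on UNIV J" unfolding J_def by (rule comb_cont) (rule E_in)
    then have "continuous_on T (\<lambda>Q. J (g2_extension Q (C v)))"
      by (rule continuous_on_compose2) (auto intro: continuous_on_g2_extension)
    \<comment> \<open>For \<open>v\<close> outside \<open>V\<close> the extensional value is
      \<open>undefined\<close>, constant in \<open>Q\<close>.\<close>
    then show "continuous_on T (\<lambda>Q. \<Psi> Q v)"
      by (cases "v \<in> V") (simp_all add: \<Psi>_def act_def)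
  qed
  have "homeomorphic_maps (top_of_set S) (top_of_set (carrier SO4)) \<Phi> \<Psi>"
    using \<Phi>_in \<Psi>_in \<Phi>\<Psi> \<Psi>\<Phi> cont\<Phi> cont\<Psi> by (auto simp: homeomorphic_maps_def)
  then have hom: "homeomorphic_map (top_of_set S) (top_of_set (carrier SO4)) \<Phi>"
    by (rule homeomorphic_maps_map[THEN iffD1, THEN conjunct1])
  have "bij_betw \<Phi> S (carrier SO4)"
    using \<Phi>_in \<Psi>_in \<Phi>\<Psi> \<Psi>\<Phi> by (intro bij_betwI[of _ _ _ \<Psi>]) auto
  moreover have "\<Phi> (compose V A B) = \<Phi> A ** \<Phi> B" if "A \<in> S" "B \<in> S" for A B
  proof -
    have "preserving B" using S'[OF that(2)] g2_groupD(1) by blast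
    then have "coord (compose V A B) = coord A \<circ> coord B"
      by (auto simp: coord_def compose_def J_in J_C preserving_def)
    then show ?thesis
      using S'[OF that(1)] S'[OF that(2)] by (simp add: \<Phi>_def block4_compose g2_map_def)
  qed
  ultimately have "\<Phi> \<in> iso ((g2_group V h \<psi>)\<lparr>carrier := S\<rparr>) SO4"
    using \<Phi>_in by (auto simp: iso_def hom_def g2_group_def SO4_def)
  with hom show ?thesis by (auto simp: topological_group_iso_def)
qed

text \<open>Treats both degrees at once, with \<open>is\<close> the indices of the model plane. The
  hypotheses speak of all adapted frames \<open>F\<close>, so the stabilizer at every point of the
  orbit is obtained directly and no conjugation is required.\<close>

lemma homogeneous_orbit_contact_set:
  fixes V :: "'v::{real_vector,topological_space} set"
  assumes frame: "g2_frame V h \<psi> E"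
    and h_cont: "\<And>w. w \<in> V \<Longrightarrow> continuous_on V (\<lambda>v. h v w)"
    and comb_cont: "\<And>F::7 \<Rightarrow> 'v. (\<And>i. F i \<in> V) \<Longrightarrow>
      continuous_on UNIV (\<lambda>a::real^7. \<Sum>i\<in>UNIV. a$i *\<^sub>R F i)"
    and "is": "distinct is" "length is = m"
    and val: "\<And>F ws. g2_frame V h \<psi> F \<Longrightarrow> ws \<in> orthonormal_frames V h m \<Longrightarrow>
      set ws \<subseteq> span (F ` set is) \<Longrightarrow> \<phi> ws = frame_det h (map F is) ws"
    and contact: "\<And>vs. vs \<in> orthonormal_frames V h m \<Longrightarrow> \<phi> vs = 1 \<Longrightarrow>
      \<exists>F. g2_frame V h \<psi> F \<and> vs = map F is"
    and stab: "\<And>F A. g2_frame V h \<psi> F \<Longrightarrow> A \<in> carrier (g2_group V h \<psi>) \<Longrightarrow>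
      plane_action A (ip_space.plane V h m (map F is)) = ip_space.plane V h m (map F is) \<longleftrightarrow>
      preserves4 (g2_frame.coord h F A)"
  shows "homogeneous_orbit (g2_group V h \<psi>) (oriented_planes V h m) plane_action SO4 (contact_set V h m \<phi>)"
proof -
  interpret g2_frame V h \<psi> E by fact
  have fr: "map F is \<in> orthonormal_frames V h m" if "g2_frame V h \<psi> F" for F
    using g2_frame.frame_E[OF that "is"(1)] "is"(2) by simp
  have "plane m (map F is) \<in> contact_set V h m \<phi>" if F: "g2_frame V h \<psi> F" for F
  proof -
    \<comment> \<open>The representative picked by \<open>form_on_plane\<close> may differ from
      \<open>map F is\<close>, but \<open>\<phi>\<close> on it is a change of basis determinant,
      hence 1.\<close>
    define ws where "ws = (SOME ws. ws \<in> plane m (map F is))"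
    have op: "plane m (map F is) \<in> oriented_planes V h m" using fr[OF F] by (simp add: oriented_planes_eq)
    have "ws \<in> plane m (map F is)" unfolding ws_def by (rule oriented_plane_some(3)[OF op])
    then have ws: "ws \<in> orthonormal_frames V h m" "span (set (map F is)) = span (set ws)"
      "frame_det h (map F is) ws > 0" by (auto simp: in_plane)
    have sub: "set ws \<subseteq> span (set (map F is))" unfolding ws(2) by (rule span_superset)
    then have "\<phi> ws = 1" using val[OF F ws(1)] frame_det_eq_1[OF fr[OF F] ws(1) sub ws(3)] by simp
    with op show ?thesis by (simp add: contact_set_def form_on_plane_def ws_def)
  qed
  moreover have "\<exists>F. g2_frame V h \<psi> F \<and> \<xi> = plane m (map F is)" if "\<xi> \<in> contact_set V h m \<phi>" for \<xi>
  proof -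
    have op: "\<xi> \<in> oriented_planes V h m" and "\<phi> (SOME vs. vs \<in> \<xi>) = 1"
      using that by (auto simp: contact_set_def form_on_plane_def)
    then show ?thesis using contact[OF oriented_plane_some(1)[OF op]] oriented_plane_some(2)[OF op] by metis
  qed
  ultimately have cs: "contact_set V h m \<phi> = {plane m (map F is) | F. g2_frame V h \<psi> F}" by blast
  have act_plane: "plane_action A (plane m (map E is)) = plane m (map (\<lambda>i. A (E i)) is)"
    if "A \<in> carrier (g2_group V h \<psi>)" for A
    using plane_action_plane[OF preserving_isometry[OF g2_groupD(1)[OF that]] fr[OF frame]]
    by (simp add: comp_def)
  have "contact_set V h m \<phi> = orbit (g2_group V h \<psi>) plane_action (plane m (map E is))"
  proof
    show "contact_set V h m \<phi> \<subseteq> orbit (g2_group V h \<psi>) plane_action (plane m (map E is))"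
    proof
      fix \<xi> assume "\<xi> \<in> contact_set V h m \<phi>"
      then obtain F where F: "g2_frame V h \<psi> F" "\<xi> = plane m (map F is)" by (auto simp: cs)
      obtain A where A: "A \<in> carrier (g2_group V h \<psi>)" "\<And>i. A (E i) = F i"
        using transitive_on_frames[OF F(1)] by blast
      then have "\<xi> = plane_action A (plane m (map E is))" using act_plane[OF A(1)] F(2) by simp
      with A(1) show "\<xi> \<in> orbit (g2_group V h \<psi>) plane_action (plane m (map E is))"
        by (auto simp: orbit_def)
    qed
    show "orbit (g2_group V h \<psi>) plane_action (plane m (map E is)) \<subseteq> contact_set V h m \<phi>"
      using act_plane g2_frame_image by (fastforce simp: orbit_def cs)
  qed
  moreover have "plane m (map E is) \<in> oriented_planes V h m" using fr[OF frame] by (simp add: oriented_planes_eq)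
  ultimately have "contact_set V h m \<phi> \<in> orbits (g2_group V h \<psi>) (oriented_planes V h m) plane_action"
    by (auto simp: orbits_def)
  moreover have "topological_group_iso ((g2_group V h \<psi>)\<lparr>carrier := stabilizer (g2_group V h \<psi>) plane_action \<xi>\<rparr>) SO4"
    if "\<xi> \<in> contact_set V h m \<phi>" for \<xi>
  proof -
    obtain F where F: "g2_frame V h \<psi> F" "\<xi> = plane m (map F is)" using \<open>\<xi> \<in> _\<close> by (auto simp: cs)
    show ?thesis
      by (rule topological_group_iso_SO4[OF F(1) h_cont comb_cont]) (simp_all add: stabilizer_def F(2) stab[OF F(1)] cong: conj_cong)
  qed
  ultimately show ?thesis by (simp add: homogeneous_orbit_def)
qed

text \<open>The change of coordinates between two adapted frames is a \<open>g2_map\<close>.\<close>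

lemma (in g2_frame) star0_frame_independent:
  assumes "g2_frame V h \<psi> F" "w1 \<in> V" "w2 \<in> V" "w3 \<in> V" "w4 \<in> V"
  shows "star0 (g2_frame.C h F w1) (g2_frame.C h F w2) (g2_frame.C h F w3) (g2_frame.C h F w4) =
    star0 (C w1) (C w2) (C w3) (C w4)"
proof -
  interpret F: g2_frame V h \<psi> F by fact
  have "C (F.J (a + r *\<^sub>R b)) = C (F.J a) + r *\<^sub>R C (F.J b)" for a r b
    by (simp add: F.J_linear C_linear F.J_in)
  from this[of _ 1] this[of 0] have "linear (\<lambda>a. C (F.J a))"
    by (intro linearI) (simp_all add: F.J_def C_def h_zero E_in Finite_Cartesian_Product.vec_eq_iff)
  then have "g2_map (\<lambda>a. C (F.J a))"
    by (rule g2_mapI) (simp_all add: F.J_in F.h_J F.psi_J flip: h_C psi_C)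
  from g2_map_star0[OF this, of "F.C w1" "F.C w2" "F.C w3" "F.C w4"] show ?thesis
    using assms by (simp add: F.J_C)
qed

lemma g2_frame_contact_sets:
  fixes V :: "'v::{real_vector,topological_space} set"
  assumes frame: "g2_frame V h \<psi> E"
    and h_cont: "\<And>w. w \<in> V \<Longrightarrow> continuous_on V (\<lambda>v. h v w)"
    and comb_cont: "\<And>F::7 \<Rightarrow> 'v. (\<And>i. F i \<in> V) \<Longrightarrow>
      continuous_on UNIV (\<lambda>a::real^7. \<Sum>i\<in>UNIV. a$i *\<^sub>R F i)"
    and star: "\<And>w1 w2 w3 w4. w1 \<in> V \<Longrightarrow> w2 \<in> V \<Longrightarrow> w3 \<in> V \<Longrightarrow> w4 \<in> V \<Longrightarrow> \<sigma> [w1, w2, w3, w4] =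
      star0 (g2_frame.C h E w1) (g2_frame.C h E w2) (g2_frame.C h E w3) (g2_frame.C h E w4)"
  shows "\<xi> \<in> oriented_planes V h 3 \<Longrightarrow> form_on_plane \<psi> \<xi> \<le> 1"
    and "\<xi> \<in> oriented_planes V h 4 \<Longrightarrow> form_on_plane \<sigma> \<xi> \<le> 1"
    and "homogeneous_orbit (g2_group V h \<psi>) (oriented_planes V h 3) plane_action SO4 (contact_set V h 3 \<psi>)"
    and "homogeneous_orbit (g2_group V h \<psi>) (oriented_planes V h 4) plane_action SO4 (contact_set V h 4 \<sigma>)"
proof -
  interpret g2_frame V h \<psi> E by fact
  show "\<xi> \<in> oriented_planes V h 3 \<Longrightarrow> form_on_plane \<psi> \<xi> \<le> 1"
    unfolding form_on_plane_def by (intro psi_le_1 oriented_plane_some)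
  have list4: "\<exists>x y z w. vs = [x, y, z, w] \<and> x \<in> V \<and> y \<in> V \<and> z \<in> V \<and> w \<in> V"
    if "vs \<in> orthonormal_frames V h 4" for vs
    using framesD(1,2)[OF that] by (auto simp: eval_nat_numeral length_Suc_conv)
  have "\<sigma> vs \<le> 1" if vs: "vs \<in> orthonormal_frames V h 4" for vs
    using list4[OF vs] star_le_1(1) vs star by force
  then show "\<xi> \<in> oriented_planes V h 4 \<Longrightarrow> form_on_plane \<sigma> \<xi> \<le> 1"
    unfolding form_on_plane_def using oriented_plane_some(1) by blast
  show "homogeneous_orbit (g2_group V h \<psi>) (oriented_planes V h 3) plane_action SO4 (contact_set V h 3 \<psi>)"
    by (rule homogeneous_orbit_contact_set[OF frame h_cont comb_cont, of "[1, 2, 3]"])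
      (simp_all add: g2_frame.psi_on_plane psi_contact g2_frame.stabilizer_psi_plane del: list.map)
  show "homogeneous_orbit (g2_group V h \<psi>) (oriented_planes V h 4) plane_action SO4 (contact_set V h 4 \<sigma>)"
  proof (rule homogeneous_orbit_contact_set[OF frame h_cont comb_cont, of "[4, 5, 6, 7]"])
    fix F ws assume F: "g2_frame V h \<psi> F" and ws: "ws \<in> orthonormal_frames V h 4"
      "set ws \<subseteq> span (F ` set [4, 5, 6, 7])"
    obtain x y z w where l: "ws = [x, y, z, w]" "x \<in> V" "y \<in> V" "z \<in> V" "w \<in> V" using list4[OF ws(1)] by blast
    show "\<sigma> ws = frame_det h (map F [4, 5, 6, 7]) ws"
      using g2_frame.star_on_plane[OF F, of x y z w] star0_frame_independent[OF F l(2-)] star[OF l(2-)] ws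
      by (simp add: l)
  next
    fix vs assume vs: "vs \<in> orthonormal_frames V h 4" "\<sigma> vs = 1"
    obtain x y z w where l: "vs = [x, y, z, w]" "x \<in> V" "y \<in> V" "z \<in> V" "w \<in> V" using list4[OF vs(1)] by blast
    show "\<exists>F. g2_frame V h \<psi> F \<and> vs = map F [4, 5, 6, 7]"
      using star_le_1(2)[of x y z w] vs star[OF l(2-)] by (simp add: l)
  qed (simp_all add: g2_frame.stabilizer_star_plane del: list.map)
qed

section \<open>Coframes and the Hodge dual\<close>

lemma wedge_1_1: "wedge 1 1 \<alpha> \<beta> [x, y] = \<alpha> [x] * \<beta> [y] - \<alpha> [y] * \<beta> [x]"
proof -
  have f: "finite {1::nat}" "0 \<notin> {1::nat}" and U: "{..<1 + 1::nat} = {0, 1}" by auto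
  show ?thesis
    unfolding wedge_def U sum_over_permutations_insert[OF f] permutes_sing
    by (simp add: sign_swap_id sign_id Transposition.transpose_def)
qed

text \<open>The denominator is \<open>1! 2!\<close>; it cancels once \<open>\<gamma>\<close> is one
  of the antisymmetric 2-forms in \<open>g2_form\<close>.\<close>

lemma wedge_1_2: "wedge 1 2 \<alpha> \<gamma> [x, y, z] = (\<alpha> [x] * (\<gamma> [y, z] - \<gamma> [z, y]) -
    \<alpha> [y] * (\<gamma> [x, z] - \<gamma> [z, x]) + \<alpha> [z] * (\<gamma> [x, y] - \<gamma> [y, x])) / 2"
proof -
  have f: "finite {1::nat, 2}" "0 \<notin> {1::nat, 2}" and f': "finite {2::nat}" "1 \<notin> {2::nat}"
    and U: "{..<1 + 2::nat} = {0, 1, 2}" by auto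
  have l: "[0..<1] = [0::nat]" "[1..<1 + 2] = [1, 2::nat]" by (simp_all add: upt_rec)
  show ?thesis
    unfolding wedge_def U sum_over_permutations_insert[OF f] sum_over_permutations_insert[OF f'] permutes_sing l
    by (simp add: sign_swap_id sign_id permutation_swap_id permutation_compose sign_compose
        Transposition.transpose_def) (simp add: algebra_simps)
qed

lemma g2_form_length: "length vs \<noteq> 3 \<Longrightarrow> g2_form e vs = 0"
  by (simp add: g2_form_def wedge_def Let_def)

lemma g2_form_coordinates:
  assumes "\<And>i. i \<in> {1..7} \<Longrightarrow> e i [x] = a $ of_nat i" "\<And>i. i \<in> {1..7} \<Longrightarrow> e i [y] = b $ of_nat i"
    "\<And>i. i \<in> {1..7} \<Longrightarrow> e i [z] = c $ of_nat i"
  shows "g2_form e [x, y, z] = psi0 a b c"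
proof -
  have e: "e 1 [x] = a$1" "e 2 [x] = a$2" "e 3 [x] = a$3" "e 4 [x] = a$4" "e 5 [x] = a$5" "e 6 [x] = a$6" "e 7 [x] = a$7"
    "e 1 [y] = b$1" "e 2 [y] = b$2" "e 3 [y] = b$3" "e 4 [y] = b$4" "e 5 [y] = b$5" "e 6 [y] = b$6" "e 7 [y] = b$7"
    "e 1 [z] = c$1" "e 2 [z] = c$2" "e 3 [z] = c$3" "e 4 [z] = c$4" "e 5 [z] = c$5" "e 6 [z] = c$6" "e 7 [z] = c$7"
    using assms(1)[of 1] assms(1)[of 2] assms(1)[of 3] assms(1)[of 4] assms(1)[of 5] assms(1)[of 6] assms(1)[of 7]
      assms(2)[of 1] assms(2)[of 2] assms(2)[of 3] assms(2)[of 4] assms(2)[of 5] assms(2)[of 6] assms(2)[of 7]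
      assms(3)[of 1] assms(3)[of 2] assms(3)[of 3] assms(3)[of 4] assms(3)[of 5] assms(3)[of 6] assms(3)[of 7]
    by simp_all
  have *: "wedge 1 2 \<alpha> \<gamma> [x, y, z] = \<alpha> [x] * \<gamma> [y, z] - \<alpha> [y] * \<gamma> [x, z] + \<alpha> [z] * \<gamma> [x, y]"
    if "\<gamma> [z, y] = - \<gamma> [y, z]" "\<gamma> [z, x] = - \<gamma> [x, z]" "\<gamma> [y, x] = - \<gamma> [x, y]" for \<alpha> \<gamma> :: "'a list \<Rightarrow> real"
    unfolding wedge_1_2 that by simp
  show ?thesis
    unfolding g2_form_def Let_def plus_fun_apply
    by (simp only: wedge_1_1 plus_fun_apply minus_apply *)
      (simp add: * wedge_1_1 e psi0_def minor3_def algebra_simps del: One_nat_def)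
qed

lemma alternating_form_linear:
  assumes "\<epsilon> \<in> alternating_forms V 1" "x \<in> V" "y \<in> V"
  shows "\<epsilon> [x + a *\<^sub>R y] = \<epsilon> [x] + a * \<epsilon> [y]"
proof -
  have "\<epsilon> ([x][0 := x + a *\<^sub>R y]) = \<epsilon> ([x][0 := x]) + a * \<epsilon> ([x][0 := y])"
    using assms unfolding alternating_forms_def by (simp del: list_update_code list_update.simps)
  then show ?thesis by simp
qed

text \<open>The list position, counted from 0, of an index of type \<open>7\<close>; the default
  branch is the index 7, which equals 0 in this type.\<close>

definition pos7 :: "7 \<Rightarrow> nat" where
  "pos7 i = (if i = 1 then 0 else if i = 2 then 1 else if i = 3 then 2 else if i = 4 then 3
     else if i = 5 then 4 else if i = 6 then 5 else 6)"

lemma pos7_less: "pos7 i < 7"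
  by (simp add: pos7_def)

lemma pos7_of_nat: "i \<in> {1..7} \<Longrightarrow> pos7 (of_nat i) = i - 1"
proof -
  assume "i \<in> {1..7}"
  then have "i = 1 \<or> i = 2 \<or> i = 3 \<or> i = 4 \<or> i = 5 \<or> i = 6 \<or> i = 7" by (simp; linarith)
  then show ?thesis by (elim disjE; simp add: pos7_def)
qed

lemma pos7_eq_iff: "pos7 i = pos7 j \<longleftrightarrow> i = j"
  using exhaust_7[of i] exhaust_7[of j] by (elim disjE; simp add: pos7_def)

lemma of_nat_pos7: "of_nat (Suc (pos7 i)) = i"
  using exhaust_7[of i] by (elim disjE; simp add: pos7_def)

text \<open>By linearity the coframe is determined on \<open>V\<close> by its values on the dual
  basis \<open>D\<close>, hence is its metric dual. The frame \<open>E\<close> is \<open>D\<close>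
  reindexed by the type \<open>7\<close>.\<close>

lemma g2_coframe_frame:
  assumes ips: "ip_space V h" and len: "\<And>D. D \<in> orthonormal_bases V h \<Longrightarrow> length D = 7"
    and cof: "g2_coframe V h \<psi> e"
  obtains E where "g2_frame V h \<psi> E" "\<And>i. i \<in> {1..7} \<Longrightarrow> e i \<in> alternating_forms V 1"
    "\<And>i v. i \<in> {1..7} \<Longrightarrow> v \<in> V \<Longrightarrow> e i [v] = h v (E (of_nat i))"
proof -
  interpret ip_space V h by fact
  obtain D where D: "D \<in> orthonormal_bases V h"
    and alt: "\<And>i. i \<in> {1..length D} \<Longrightarrow> e i \<in> alternating_forms V 1"
    and dual: "\<And>i j. i \<in> {1..length D} \<Longrightarrow> j \<in> {1..length D} \<Longrightarrow> e i [D ! (j - 1)] = (if i = j then 1 else 0)"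
    using cof by (auto simp: g2_coframe_def orthonormal_coframe_def)
  note l = len[OF D]
  have fr: "D \<in> orthonormal_frames V h 7" and sp: "span (set D) = V"
    using D l by (auto simp: orthonormal_bases_def)
  note frD = framesD[OF fr]
  define E where "E i = D ! pos7 i" for i
  have E: "E i \<in> V" for i using frD(3) pos7_less by (simp add: E_def)
  have orth: "h (E i) (E j) = (if i = j then 1 else 0)" for i j
    using frD(4)[OF pos7_less pos7_less] by (simp add: E_def pos7_eq_iff)
  have eE: "e i [v] = h v (E (of_nat i))" if i: "i \<in> {1..7}" and v: "v \<in> V" for i v
  proof -
    have a: "e i \<in> alternating_forms V 1" using alt[of i] i l by simp
    have e0: "e i [0] = 0" using alternating_form_linear[OF a, of 0 0 1] by simp
    have lin: "e i [\<Sum>k\<in>K. c k *\<^sub>R f k] = (\<Sum>k\<in>K. c k * e i [f k])"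
      if "\<And>k. k \<in> K \<Longrightarrow> f k \<in> V" for K :: "nat set" and c f
      using that
    proof (induction K rule: infinite_finite_induct)
      case (insert k K)
      then have "e i [(\<Sum>k\<in>K. c k *\<^sub>R f k) + c k *\<^sub>R f k] = e i [\<Sum>k\<in>K. c k *\<^sub>R f k] + c k * e i [f k]"
        by (intro alternating_form_linear[OF a]) (auto intro: sum_in)
      then show ?case using insert by (simp add: add.commute)
    qed (simp_all add: e0)
    have "v = (\<Sum>k<7. h v (D ! k) *\<^sub>R D ! k)" using span_frame[OF fr] sp v by blast
    then have "e i [v] = e i [\<Sum>k<7. h v (D ! k) *\<^sub>R D ! k]" by simp
    also have "\<dots> = (\<Sum>k<7. h v (D ! k) * e i [D ! k])" using frD(3) by (intro lin) simp
    also have "\<dots> = (\<Sum>k<7. if k = i - 1 then h v (D ! k) else 0)"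
    proof (intro sum.cong refl)
      fix k :: nat assume "k \<in> {..<7}"
      then show "h v (D ! k) * e i [D ! k] = (if k = i - 1 then h v (D ! k) else 0)"
        using dual[of i "Suc k"] i l by auto
    qed
    also have "\<dots> = h v (D ! (i - 1))" using i by auto
    finally show ?thesis using i by (simp add: E_def pos7_of_nat)
  qed
  have "g2_frame V h \<psi> E"
  proof
    have "set D \<subseteq> range E"
    proof
      fix x assume "x \<in> set D"
      then obtain k where "k < 7" "x = D ! k" using frD(1) by (auto simp: in_set_conv_nth)
      then show "x \<in> range E" using pos7_of_nat[of "Suc k"] by (auto simp: E_def intro!: image_eqI[of _ _ "of_nat (Suc k)"])
    qed
    then show "V \<subseteq> span (range E)" using sp span_mono by blast
    fix vs assume vs: "set vs \<subseteq> V"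
    have \<psi>: "\<psi> = g2_form e" using cof by (simp add: g2_coframe_def)
    show "\<psi> vs = (if length vs = 3 then psi0 (\<chi> i. h (vs ! 0) (E i)) (\<chi> i. h (vs ! 1) (E i)) (\<chi> i. h (vs ! 2) (E i)) else 0)"
    proof (cases "length vs = 3")
      case True
      then obtain x y z where xyz: "vs = [x, y, z]" by (auto simp: eval_nat_numeral length_Suc_conv)
      with vs show ?thesis
        unfolding xyz \<psi> by (subst g2_form_coordinates) (auto simp: eE simp del: of_nat_Suc)
    qed (simp add: \<psi> g2_form_length)
  qed (use E orth in auto)
  then show thesis by (rule that) (use alt l eE in auto)
qed

lemma sum_lists_3:
  "(\<Sum>js | length js = 3 \<and> set js \<subseteq> {..<n::nat}. f js) = (\<Sum>i<n. \<Sum>j<n. \<Sum>k<n. f [i, j, k] :: real)"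
proof -
  have "(\<Sum>i<n. \<Sum>j<n. \<Sum>k<n. f [i, j, k]) = (\<Sum>(i, j, k)\<in>{..<n} \<times> {..<n} \<times> {..<n}. f [i, j, k])"
    by (simp add: sum.cartesian_product)
  also have "\<dots> = (\<Sum>js | length js = 3 \<and> set js \<subseteq> {..<n}. f js)"
    by (rule sum.reindex_bij_witness[of _ "\<lambda>js. (js ! 0, js ! 1, js ! 2)" "\<lambda>(i, j, k). [i, j, k]"])
      (auto simp: eval_nat_numeral length_Suc_conv)
  finally show ?thesis ..
qed

lemma star0_linear:
  "star0 (a + r *\<^sub>R a') b c d = star0 a b c d + r * star0 a' b c d"
  "star0 a (b + r *\<^sub>R b') c d = star0 a b c d + r * star0 a b' c d"
  "star0 a b (c + r *\<^sub>R c') d = star0 a b c d + r * star0 a b c' d"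
  "star0 a b c (d + r *\<^sub>R d') = star0 a b c d + r * star0 a b c d'"
  by (simp_all add: star0_eq_inner cross7_add inner_add inner_diff algebra_simps)

lemma star0_repeated:
  "star0 a a c d = 0" "star0 a b a d = 0" "star0 a b c a = 0" "star0 a b b d = 0" "star0 a b c b = 0" "star0 a b c c = 0"
  by (simp_all add: star0_def minor4_def minor3_def) (simp_all add: algebra_simps)

text \<open>Both choices disappear here: the basis \<open>D\<close> by Parseval, the coframe
  \<open>e0\<close> because its frame \<open>F\<close> and the given \<open>E\<close> yield the same
  values of \<open>star0\<close>. That formula also gives multilinearity and alternation; vanishing
  on improper arguments is read off the determinant.\<close>

lemma hodge_dual_g2:
  assumes ips: "ip_space V h" and len: "\<And>D. D \<in> orthonormal_bases V h \<Longrightarrow> length D = 7"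
    and frame: "g2_frame V h \<psi> E" and cof: "g2_coframe V h \<psi> e"
  defines "\<sigma> \<equiv> hodge_dual V h (g2_volume V h \<psi>) 3 \<psi>"
  shows "w1 \<in> V \<Longrightarrow> w2 \<in> V \<Longrightarrow> w3 \<in> V \<Longrightarrow> w4 \<in> V \<Longrightarrow> \<sigma> [w1, w2, w3, w4] =
      star0 (g2_frame.C h E w1) (g2_frame.C h E w2) (g2_frame.C h E w3) (g2_frame.C h E w4)"
    and "\<sigma> \<in> alternating_forms V 4"
proof -
  interpret E: g2_frame V h \<psi> E by fact
  define e0 where "e0 = (SOME e. g2_coframe V h \<psi> e)"
  have cof0: "g2_coframe V h \<psi> e0" unfolding e0_def by (rule someI[of "g2_coframe V h \<psi>", OF cof])
  obtain F where F: "g2_frame V h \<psi> F" and alt: "\<And>i. i \<in> {1..7} \<Longrightarrow> e0 i \<in> alternating_forms V 1"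
    and e0: "\<And>i v. i \<in> {1..7} \<Longrightarrow> v \<in> V \<Longrightarrow> e0 i [v] = h v (F (of_nat i))"
    using g2_coframe_frame[OF ips len cof0] by metis
  interpret F: g2_frame V h \<psi> F by fact
  define D where "D = (SOME D. D \<in> orthonormal_bases V h)"
  have D: "D \<in> orthonormal_bases V h" unfolding D_def using E.EL_basis by (rule someI)
  define vol where "vol = g2_volume V h \<psi>"
  have vol: "vol us = (if length us = 7 then Determinant.det (Matrix.mat 7 7 (\<lambda>(i, j). e0 (Suc i) [us ! j])) else 0)" for us
    by (simp add: vol_def g2_volume_def e0_def Let_def)
  have vol_frame: "vol us = frame_det h F.EL us" if "length us = 7" "set us \<subseteq> V" for us
  proof -
    have "Matrix.mat 7 7 (\<lambda>(i, j). e0 (Suc i) [us ! j]) = Matrix.mat 7 7 (\<lambda>(i, j). h (F.EL ! i) (us ! j))"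
      using that by (intro eq_matI) (auto simp: e0 F.EL_nth subset_iff E.h_sym[OF F.E_in] simp del: of_nat_Suc)
    then show ?thesis using that by (simp add: vol frame_det_def F.EL_length)
  qed
  have \<sigma>: "\<sigma> ws = (\<Sum>i<7. \<Sum>j<7. \<Sum>k<7. \<psi> [D!i, D!j, D!k] * vol ([D!i, D!j, D!k] @ ws)) / 6" for ws
    using len[OF D] by (simp add: \<sigma>_def hodge_dual_def D_def[symmetric] vol_def sum_lists_3 fact_numeral)
  note frD = E.framesD[OF E.basis_frame[OF D]]
  have val: "\<sigma> [w1, w2, w3, w4] = star0 (E.C w1) (E.C w2) (E.C w3) (E.C w4)"
    if w: "w1 \<in> V" "w2 \<in> V" "w3 \<in> V" "w4 \<in> V" for w1 w2 w3 w4
  proof -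
    have "vol ([D!i, D!j, D!k] @ [w1, w2, w3, w4]) = frame_det h F.EL [D!i, D!j, D!k, w1, w2, w3, w4]"
      if "i < 7" "j < 7" "k < 7" for i j k
      using vol_frame[of "[D!i, D!j, D!k, w1, w2, w3, w4]"] that w frD(3) by simp
    then have "\<sigma> [w1, w2, w3, w4] = star0 (F.C w1) (F.C w2) (F.C w3) (F.C w4)"
      using F.hodge_psi[OF D w] by (simp add: \<sigma>)
    then show ?thesis by (simp add: E.star0_frame_independent[OF F w])
  qed
  then show "w1 \<in> V \<Longrightarrow> w2 \<in> V \<Longrightarrow> w3 \<in> V \<Longrightarrow> w4 \<in> V \<Longrightarrow> \<sigma> [w1, w2, w3, w4] =
      star0 (g2_frame.C h E w1) (g2_frame.C h E w2) (g2_frame.C h E w3) (g2_frame.C h E w4)" .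
  have out: "\<sigma> ws = 0" if "\<not> (length ws = 4 \<and> set ws \<subseteq> V)" for ws
  proof -
    have "vol ([D!i, D!j, D!k] @ ws) = 0" if "i < 7" "j < 7" "k < 7" for i j k
    proof (cases "length ws = 4")
      case True
      then obtain v where "v \<in> set ws" "v \<notin> V"
        using \<open>\<not> (length ws = 4 \<and> set ws \<subseteq> V)\<close> by auto
      then obtain n where n: "n < 4" "ws ! n \<notin> V"
        using True by (auto simp: in_set_conv_nth)
      define M where "M = Matrix.mat 7 7 (\<lambda>(i', j'). e0 (Suc i') [([D!i, D!j, D!k] @ ws) ! j'])"
      \<comment> \<open>The 1-forms of the coframe vanish on an argument outside \<open>V\<close>,
        which makes a zero column; the shift by 3 accounts for the basis vectors in front.\<close>
      have "M $$ (r, n + 3) = 0" if "r < 7" for r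
        using alt[of "Suc r"] n that by (simp add: M_def nth_append eval_nat_numeral alternating_forms_def)
      then have "Determinant.det M = 0"
        using n by (subst laplace_expansion_column[of M 7 "n + 3"]) (auto simp: M_def)
      then show ?thesis by (simp add: vol M_def)
    qed (simp add: vol)
    then show ?thesis by (simp add: \<sigma>)
  qed
  show "\<sigma> \<in> alternating_forms V 4"
    unfolding alternating_forms_def
  proof (intro CollectI conjI allI impI)
    fix vs :: "'a list" assume "\<not> (length vs = 4 \<and> set vs \<subseteq> V)"
    then show "\<sigma> vs = 0" by (rule out)
  next
    fix vs i x y a assume vs: "length vs = 4" "set vs \<subseteq> V" and "i < (4::nat)" "x \<in> V" "y \<in> V"
    obtain w1 w2 w3 w4 where w: "vs = [w1, w2, w3, w4]" using vs by (auto simp: eval_nat_numeral length_Suc_conv)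
    have "i = 0 \<or> i = 1 \<or> i = 2 \<or> i = 3" using \<open>i < 4\<close> by linarith
    moreover have "x + a *\<^sub>R y \<in> V" using \<open>x \<in> V\<close> \<open>y \<in> V\<close> E.add_in E.scale_in by blast
    ultimately show "\<sigma> (vs[i := x + a *\<^sub>R y]) = \<sigma> (vs[i := x]) + a * \<sigma> (vs[i := y])"
      using vs \<open>x \<in> V\<close> \<open>y \<in> V\<close>
      by (elim disjE; simp add: w val E.C_linear star0_linear numeral_2_eq_2 numeral_3_eq_3)
  next
    fix vs i j assume vs: "length vs = 4" "set vs \<subseteq> V" and ij: "i < j" "j < (4::nat)" "vs ! i = (vs ! j :: 'a)"
    obtain w1 w2 w3 w4 where w: "vs = [w1, w2, w3, w4]" using vs by (auto simp: eval_nat_numeral length_Suc_conv)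
    have "(i = 0 \<and> j = 1) \<or> (i = 0 \<and> j = 2) \<or> (i = 0 \<and> j = 3) \<or> (i = 1 \<and> j = 2) \<or> (i = 1 \<and> j = 3) \<or> (i = 2 \<and> j = 3)"
      using ij by linarith
    then show "\<sigma> vs = 0"
      using vs ij(3) by (elim disjE conjE; simp add: w val star0_repeated numeral_2_eq_2 numeral_3_eq_3)
  qed
qed

section \<open>Smoothness and tangent spaces\<close>

lemma Ck_on_cong:
  assumes "open S" "\<And>x. x \<in> S \<Longrightarrow> f x = g x" "Ck_on k S f"
  shows "Ck_on k S g"
  using assms(2,3)
proof (induction k arbitrary: f g)
  case 0
  then show ?case using continuous_on_cong[of S S f g] by simp
next
  case (Suc k)
  have d: "(g has_derivative D) (at x)" if "(f has_derivative D) (at x)" "x \<in> S" for x D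
    using has_derivative_transform_within_open[OF that(1) assms(1) that(2)] Suc.prems(1) by blast
  have df: "(f has_derivative frechet_derivative f (at x)) (at x)" if "x \<in> S" for x
    using Suc.prems(2) that frechet_derivative_works by auto
  have "g differentiable (at x)" if "x \<in> S" for x
    using d[OF df[OF that] that] by (auto simp: differentiable_def)
  moreover have eq: "frechet_derivative f (at x) v = frechet_derivative g (at x) v" if "x \<in> S" for x v
    using frechet_derivative_at[OF d[OF df[OF that] that]] by simp
  moreover have "Ck_on k S (\<lambda>x. frechet_derivative g (at x) v)" for v
    using Suc.prems(2) by (intro Suc.IH[OF eq]) auto
  ultimately show ?case by simp
qed

lemma smooth_on_cong:
  assumes "open S" "\<And>x. x \<in> S \<Longrightarrow> f x = g x" "smooth_on S f"
  shows "smooth_on S g"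
  unfolding smooth_on_def
proof
  show "Ck_on k S g" for k
    by (rule Ck_on_cong[OF assms(1,2)]) (use assms(3) in \<open>simp_all add: smooth_on_def\<close>)
qed

text \<open>Adapted coframes are smooth only on neighbourhoods, so the smoothness of
  \<open>*\<psi>\<close> in a chart has to be assembled from open pieces.\<close>

lemma Ck_on_local:
  assumes "\<And>x. x \<in> S \<Longrightarrow> \<exists>T. open T \<and> x \<in> T \<and> Ck_on k T f"
  shows "Ck_on k S f"
  using assms
proof (induction k arbitrary: f)
  case 0
  then show ?case
    unfolding Ck_on.simps(1) by (intro continuous_at_imp_continuous_on ballI) (metis continuous_on_eq_continuous_at)
next
  case (Suc k)
  have "Ck_on k S (\<lambda>x. frechet_derivative f (at x) v)" for v
    using Suc.prems by (intro Suc.IH) (metis Ck_on.simps(2))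
  moreover have "f differentiable (at x)" if "x \<in> S" for x
    using Suc.prems[OF that] by auto
  ultimately show ?case by simp
qed

lemma Ck_on_Suc_imp: "Ck_on (Suc k) S f \<Longrightarrow> Ck_on k S f"
proof (induction k arbitrary: f)
  case 0
  then show ?case
    by (auto intro!: continuous_at_imp_continuous_on differentiable_imp_continuous_within)
qed auto

lemma Ck_on_add:
  assumes "open S" "Ck_on k S f" "Ck_on k S g"
  shows "Ck_on k S (\<lambda>x. f x + g x)"
  using assms(2,3)
proof (induction k arbitrary: f g)
  case (Suc k)
  have "Ck_on k S (\<lambda>x. frechet_derivative (\<lambda>x. f x + g x) (at x) v)" for v
  proof (rule Ck_on_cong[OF assms(1)])
    show "Ck_on k S (\<lambda>x. frechet_derivative f (at x) v + frechet_derivative g (at x) v)"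
      using Suc.prems by (intro Suc.IH) auto
    fix x assume "x \<in> S"
    then have "(f has_derivative frechet_derivative f (at x)) (at x)"
      "(g has_derivative frechet_derivative g (at x)) (at x)"
      using Suc.prems by (simp_all add: frechet_derivative_works)
    from frechet_derivative_at[OF has_derivative_add[OF this]]
    show "frechet_derivative f (at x) v + frechet_derivative g (at x) v =
        frechet_derivative (\<lambda>x. f x + g x) (at x) v"
      by (rule fun_cong)
  qed
  then show ?case using Suc.prems by simp
qed (simp add: continuous_on_add)

lemma Ck_on_diff:
  assumes "open S" "Ck_on k S f" "Ck_on k S g"
  shows "Ck_on k S (\<lambda>x. f x - g x)"
  using assms(2,3)
proof (induction k arbitrary: f g)
  case (Suc k)
  have "Ck_on k S (\<lambda>x. frechet_derivative (\<lambda>x. f x - g x) (at x) v)" for v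
  proof (rule Ck_on_cong[OF assms(1)])
    show "Ck_on k S (\<lambda>x. frechet_derivative f (at x) v - frechet_derivative g (at x) v)"
      using Suc.prems by (intro Suc.IH) auto
    fix x assume "x \<in> S"
    then have "(f has_derivative frechet_derivative f (at x)) (at x)"
      "(g has_derivative frechet_derivative g (at x)) (at x)"
      using Suc.prems by (simp_all add: frechet_derivative_works)
    from frechet_derivative_at[OF has_derivative_diff[OF this]]
    show "frechet_derivative f (at x) v - frechet_derivative g (at x) v =
        frechet_derivative (\<lambda>x. f x - g x) (at x) v"
      by (rule fun_cong)
  qed
  then show ?case using Suc.prems by simp
qed (simp add: continuous_on_diff)

text \<open>In the product rule each summand keeps one factor undifferentiated;
  \<open>Ck_on_Suc_imp\<close> lowers its order to fit the induction hypothesis.\<close>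

lemma Ck_on_mult:
  fixes f g :: "'e::real_normed_vector \<Rightarrow> real"
  assumes "open S" "Ck_on k S f" "Ck_on k S g"
  shows "Ck_on k S (\<lambda>x. f x * g x)"
  using assms(2,3)
proof (induction k arbitrary: f g)
  case (Suc k)
  have diff: "(f has_derivative frechet_derivative f (at x)) (at x)" "(g has_derivative frechet_derivative g (at x)) (at x)"
    if "x \<in> S" for x
    using Suc.prems that by (simp_all add: frechet_derivative_works)
  note prod = has_derivative_mult[OF diff]
  have "Ck_on k S (\<lambda>x. frechet_derivative (\<lambda>x. f x * g x) (at x) v)" for v
  proof (rule Ck_on_cong[OF assms(1)])
    show "Ck_on k S (\<lambda>x. f x * frechet_derivative g (at x) v + frechet_derivative f (at x) v * g x)"
      using Suc.prems Suc.prems[THEN Ck_on_Suc_imp] by (intro Suc.IH Ck_on_add[OF assms(1)]) auto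
    fix x assume "x \<in> S"
    from frechet_derivative_at[OF prod[OF this this]]
    show "f x * frechet_derivative g (at x) v + frechet_derivative f (at x) v * g x =
        frechet_derivative (\<lambda>x. f x * g x) (at x) v"
      by (rule fun_cong)
  qed
  moreover have "(\<lambda>x. f x * g x) differentiable (at x)" if "x \<in> S" for x
    using prod[OF that that] by (auto simp: differentiable_def)
  ultimately show ?case by simp
qed (simp add: continuous_on_mult)

lemma smooth_on_star0:
  assumes T: "open T"
    and f: "\<And>i. smooth_on T (a i)" "\<And>i. smooth_on T (b i)" "\<And>i. smooth_on T (c i)" "\<And>i. smooth_on T (d i)"
  shows "smooth_on T (\<lambda>x. star0 (\<chi> i. a i x) (\<chi> i. b i x) (\<chi> i. c i x) (\<chi> i. d i x))"
proof -
  have "Ck_on k T (a i)" "Ck_on k T (b i)" "Ck_on k T (c i)" "Ck_on k T (d i)" for k i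
    using f by (auto simp: smooth_on_def)
  then show ?thesis
    unfolding smooth_on_def star0_def minor4_def minor3_def vec_lambda_beta
    by (intro allI Ck_on_add[OF T] Ck_on_diff[OF T] Ck_on_mult[OF T])
qed

section \<open>Tangent spaces seen in a chart\<close>

locale smooth_mfd =
  fixes X :: "'a topology" and \<A> :: "('a, 'n::finite) chart set"
  assumes mfd: "smooth_manifold X \<A>"
begin

lemma chart: "c \<in> \<A> \<Longrightarrow> chart_on X c"
  using mfd by (simp add: smooth_manifold_def)

lemma chart_inj:
  assumes "c \<in> \<A>"
  shows "inj_on (snd c) (fst c)"
proof -
  have "homeomorphic_map (subtopology X (fst c)) (top_of_set (snd c ` fst c)) (snd c)" "openin X (fst c)"
    using chart[OF assms] by (auto simp: chart_on_def)
  then have "inj_on (snd c) (topspace (subtopology X (fst c)))" "fst c \<subseteq> topspace X"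
    by (auto simp: homeomorphic_eq_everything_map openin_subset)
  then show ?thesis by (simp add: Int_absorb1)
qed

lemma chart_inv: "c \<in> \<A> \<Longrightarrow> q \<in> fst c \<Longrightarrow> chart_inv c (snd c q) = q"
  by (simp add: chart_inv_def chart_inj)

lemma transition: "c \<in> \<A> \<Longrightarrow> q \<in> fst c \<Longrightarrow> transition c c' (snd c q) = snd c' q"
  by (simp add: transition_def chart_inv)

lemma chart_open:
  assumes "c \<in> \<A>" "openin X W"
  shows "open (snd c ` (fst c \<inter> W))"
proof -
  have hom: "homeomorphic_map (subtopology X (fst c)) (top_of_set (snd c ` fst c)) (snd c)"
    and op: "open (snd c ` fst c)" using chart[OF assms(1)] by (auto simp: chart_on_def)
  have "openin (subtopology X (fst c)) (fst c \<inter> W)"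
    using assms(2) by (auto simp: openin_subtopology Int_commute)
  then have "openin (top_of_set (snd c ` fst c)) (snd c ` (fst c \<inter> W))"
    using hom by (auto simp: homeomorphic_eq_everything_map open_map_def)
  then show ?thesis using op openin_open_trans by blast
qed

lemma transition_differentiable:
  assumes "c \<in> charts_at \<A> p" "c' \<in> charts_at \<A> p"
  shows "(transition c c' has_derivative frechet_derivative (transition c c') (at (snd c p))) (at (snd c p))"
proof -
  have "smooth_on (snd c ` (fst c \<inter> fst c')) (transition c c')"
    using mfd assms by (auto simp: smooth_manifold_def charts_at_def)
  then have "Ck_on (Suc 0) (snd c ` (fst c \<inter> fst c')) (transition c c')" by (simp only: smooth_on_def)
  then show ?thesis using assms by (auto simp: charts_at_def simp flip: frechet_derivative_works)
qed

text \<open>The chain rule, with the composite agreeing with the direct coordinate change near the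
  point. It is the compatibility that makes a coordinate vector a tangent vector.\<close>

lemma transition_chain:
  assumes c: "c \<in> charts_at \<A> p" "c' \<in> charts_at \<A> p" "c'' \<in> charts_at \<A> p"
  shows "frechet_derivative (transition c c'') (at (snd c p)) u =
    frechet_derivative (transition c' c'') (at (snd c' p)) (frechet_derivative (transition c c') (at (snd c p)) u)"
proof -
  have cA: "c \<in> \<A>" "c' \<in> \<A>" "p \<in> fst c" "p \<in> fst c'" using c by (auto simp: charts_at_def)
  have tp: "transition c c' (snd c p) = snd c' p" by (rule transition[OF cA(1,3)])
  have "(transition c' c'' has_derivative frechet_derivative (transition c' c'') (at (snd c' p)))
      (at (transition c c' (snd c p)))" unfolding tp by (rule transition_differentiable[OF c(2,3)])
  from diff_chain_at[OF transition_differentiable[OF c(1,2)] this]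
  have "(transition c c'' has_derivative (frechet_derivative (transition c' c'') (at (snd c' p)) \<circ>
      frechet_derivative (transition c c') (at (snd c p)))) (at (snd c p))"
  proof (rule has_derivative_transform_within_open)
    show "open (snd c ` (fst c \<inter> fst c'))"
      using chart_open[OF cA(1)] chart[OF cA(2)] by (auto simp: chart_on_def)
    show "snd c p \<in> snd c ` (fst c \<inter> fst c')" using cA by auto
    fix y assume "y \<in> snd c ` (fst c \<inter> fst c')"
    then show "(transition c' c'' \<circ> transition c c') y = transition c c'' y"
      using cA by (auto simp: transition)
  qed
  from fun_cong[OF frechet_derivative_at[OF this], of u] show ?thesis by simp
qed

lemma transition_self:
  assumes c: "c \<in> charts_at \<A> p"
  shows "frechet_derivative (transition c c) (at (snd c p)) u = u"
proof -
  have cA: "c \<in> \<A>" "p \<in> fst c" using c by (auto simp: charts_at_def)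
  have "(transition c c has_derivative (\<lambda>u. u)) (at (snd c p))"
  proof (rule has_derivative_transform_within_open[OF has_derivative_ident])
    show "open (snd c ` fst c)" using chart[OF cA(1)] by (simp add: chart_on_def)
    show "snd c p \<in> snd c ` fst c" using cA by simp
    show "y \<in> snd c ` fst c \<Longrightarrow> y = transition c c y" for y using cA by (auto simp: transition)
  qed
  from fun_cong[OF frechet_derivative_at[OF this], of u] show ?thesis by simp
qed

lemma transition_linear:
  assumes "c \<in> charts_at \<A> p" "c' \<in> charts_at \<A> p"
  shows "linear (frechet_derivative (transition c c') (at (snd c p)))"
  using transition_differentiable[OF assms] by (simp add: has_derivative_linear)

lemma tangentI:
  assumes "\<And>c. c \<notin> charts_at \<A> p \<Longrightarrow> v c = 0"
    and "\<And>c c'. c \<in> charts_at \<A> p \<Longrightarrow> c' \<in> charts_at \<A> p \<Longrightarrow>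
      v c' = frechet_derivative (transition c c') (at (snd c p)) (v c)"
  shows "v \<in> tangent_space \<A> p"
  using assms unfolding tangent_space_def by blast

lemma tangentD:
  assumes "v \<in> tangent_space \<A> p"
  shows "c \<notin> charts_at \<A> p \<Longrightarrow> v c = 0"
    and "c \<in> charts_at \<A> p \<Longrightarrow> c' \<in> charts_at \<A> p \<Longrightarrow>
      v c' = frechet_derivative (transition c c') (at (snd c p)) (v c)"
  using assms unfolding tangent_space_def by blast+

lemma subspace_tangent_space: "subspace (tangent_space \<A> p)"
proof (rule subspaceI)
  show "0 \<in> tangent_space \<A> p"
    by (rule tangentI) (simp_all add: linear_0[OF transition_linear])
next
  fix x y assume xy: "x \<in> tangent_space \<A> p" "y \<in> tangent_space \<A> p"
  show "x + y \<in> tangent_space \<A> p"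
  proof (rule tangentI)
    fix c c' assume c: "c \<in> charts_at \<A> p" "c' \<in> charts_at \<A> p"
    show "(x + y) c' = frechet_derivative (transition c c') (at (snd c p)) ((x + y) c)"
      using tangentD(2)[OF xy(1) c] tangentD(2)[OF xy(2) c] by (simp add: linear_add[OF transition_linear[OF c]])
  qed (simp add: xy[THEN tangentD(1)])
next
  fix r x assume x: "x \<in> tangent_space \<A> p"
  show "r *\<^sub>R x \<in> tangent_space \<A> p"
  proof (rule tangentI)
    fix c c' assume c: "c \<in> charts_at \<A> p" "c' \<in> charts_at \<A> p"
    show "(r *\<^sub>R x) c' = frechet_derivative (transition c c') (at (snd c p)) ((r *\<^sub>R x) c)"
      using tangentD(2)[OF x c] by (simp add: scaleR_fun_def linear_scale[OF transition_linear[OF c]])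
  qed (simp add: scaleR_fun_def x[THEN tangentD(1)])
qed

lemma coord_vector_in:
  assumes "c \<in> charts_at \<A> p"
  shows "coord_vector \<A> c u p \<in> tangent_space \<A> p"
  by (auto simp: tangent_space_def coord_vector_def intro: transition_chain[OF assms])

lemma coord_vector_same: "c \<in> charts_at \<A> p \<Longrightarrow> coord_vector \<A> c u p c = u"
  by (simp add: coord_vector_def transition_self)

lemma coord_vector_of_tangent:
  assumes "c \<in> charts_at \<A> p" "v \<in> tangent_space \<A> p"
  shows "coord_vector \<A> c (v c) p = v"
proof
  fix c'
  show "coord_vector \<A> c (v c) p c' = v c'"
    unfolding coord_vector_def using tangentD(1)[OF assms(2), of c'] tangentD(2)[OF assms(2,1), of c'] by metis
qed

lemma coord_vector_linear:
  assumes "c \<in> charts_at \<A> p"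
  shows "coord_vector \<A> c (u + r *\<^sub>R u') p = coord_vector \<A> c u p + r *\<^sub>R coord_vector \<A> c u' p"
  using assms
  by (auto simp: coord_vector_def scaleR_fun_def fun_eq_iff linear_add[OF transition_linear] linear_scale[OF transition_linear])

lemma linear_eval_chart: "linear (\<lambda>v::('a, 'n) tangent. v c)"
  by (rule linearI) (simp_all add: scaleR_fun_def)

text \<open>Evaluation in one chart is a linear isomorphism onto the coordinate space; this is where
  the dimension of the tangent space comes from.\<close>

lemma tangent_basis_card:
  assumes "c \<in> charts_at \<A> p" "independent B" "span B = tangent_space \<A> p"
  shows "card B = CARD('n)"
proof -
  let ?f = "\<lambda>v::('a, 'n) tangent. v c"
  have inj: "inj_on ?f (span B)"
    unfolding assms(3) using coord_vector_of_tangent[OF assms(1)] by (rule inj_on_inverseI)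
  have "u \<in> ?f ` tangent_space \<A> p" for u
    by (rule image_eqI[of _ _ "coord_vector \<A> c u p"])
      (simp_all add: coord_vector_same[OF assms(1)] coord_vector_in[OF assms(1)])
  then have "?f ` tangent_space \<A> p = UNIV" by blast
  then have "span (?f ` B) = UNIV"
    by (simp add: linear_span_image[OF linear_eval_chart] assms(3))
  moreover have "independent (?f ` B)"
    by (rule linear_independent_injective_image[OF linear_eval_chart assms(2) inj])
  ultimately have "card (?f ` B) = DIM(real^'n)" by (metis dim_UNIV dim_eq_card span_UNIV)
  moreover have "card (?f ` B) = card B" by (rule card_image) (rule inj_on_subset[OF inj span_superset])
  ultimately show ?thesis by simp
qed

lemma continuous_on_combination:
  fixes F :: "'i::finite \<Rightarrow> ('a, 'n) tangent"
  shows "continuous_on UNIV (\<lambda>a::real^'i. \<Sum>i\<in>UNIV. a$i *\<^sub>R F i)"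
proof (rule continuous_on_coordinatewise_then_product)
  fix c
  have "(\<Sum>i\<in>UNIV. a$i *\<^sub>R F i) c = (\<Sum>i\<in>UNIV. a$i *\<^sub>R F i c)" for a :: "real^'i"
    using linear_sum[OF linear_eval_chart[of c], of "\<lambda>i. a$i *\<^sub>R F i" UNIV] by (simp add: scaleR_fun_def)
  then show "continuous_on UNIV (\<lambda>a::real^'i. (\<Sum>i\<in>UNIV. a$i *\<^sub>R F i) c)"
    by (auto intro!: continuous_intros)
qed

text \<open>The component in one chart is continuous in the pointwise topology, and the metric is a
  linear function of that component on a finite-dimensional space.\<close>

lemma continuous_on_inner_product:
  assumes c: "c \<in> charts_at \<A> p" and ip: "inner_product_on (tangent_space \<A> p) h" and w: "w \<in> tangent_space \<A> p"
  shows "continuous_on (tangent_space \<A> p) (\<lambda>v. h v w)"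
proof -
  interpret ip_space "tangent_space \<A> p" h by (intro ip_space.intro subspace_tangent_space ip)
  define L where "L u = h (coord_vector \<A> c u p) w" for u
  have L: "L (u + r *\<^sub>R u') = L u + r * L u'" for u u' r
    unfolding L_def coord_vector_linear[OF c] by (intro h_linear coord_vector_in[OF c] w)
  have "L 0 = 0" using L[of 0 1 0] by simp
  then have "linear L" using L[of _ 1] L[of 0] by (intro linearI) auto
  then have "continuous_on UNIV L" by (simp add: linear_continuous_on linear_conv_bounded_linear)
  moreover have "continuous_on (tangent_space \<A> p) (\<lambda>v. v c)"
    by (rule continuous_on_subset[OF continuous_on_product_coordinates]) simp
  ultimately have "continuous_on (tangent_space \<A> p) (\<lambda>v. L (v c))"
    by (rule continuous_on_compose2) simp
  then show ?thesis
    by (rule continuous_on_eq) (simp add: L_def coord_vector_of_tangent[OF c])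
qed

lemma chart_at: "p \<in> topspace X \<Longrightarrow> \<exists>c. c \<in> charts_at \<A> p"
  using mfd unfolding smooth_manifold_def charts_at_def by blast

end

section \<open>The forms on a manifold with a \<open>G\<^sub>2\<close>-structure\<close>

locale g2_manifold = smooth_mfd X \<A> for X :: "'a topology" and \<A> :: "('a, 7) chart set" +
  fixes g :: "'a \<Rightarrow> ('a, 7) tangent \<Rightarrow> ('a, 7) tangent \<Rightarrow> real"
    and \<psi> :: "'a \<Rightarrow> ('a, 7) tangent list \<Rightarrow> real"
  assumes metric: "riemannian_metric X \<A> g" and g2: "g2_structure X \<A> g \<psi>"
begin

lemma ip_space_tangent: "p \<in> topspace X \<Longrightarrow> ip_space (tangent_space \<A> p) (g p)"
  using metric by (intro ip_space.intro subspace_tangent_space) (simp add: riemannian_metric_def)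

lemma orthonormal_basis_7:
  assumes "p \<in> topspace X" "D \<in> orthonormal_bases (tangent_space \<A> p) (g p)"
  shows "length D = 7"
proof -
  interpret ip_space "tangent_space \<A> p" "g p" by (rule ip_space_tangent[OF assms(1)])
  obtain c where c: "c \<in> charts_at \<A> p" using chart_at[OF assms(1)] by blast
  have D: "D \<in> orthonormal_frames (tangent_space \<A> p) (g p) (length D)" "span (set D) = tangent_space \<A> p"
    using assms(2) by (auto simp: orthonormal_bases_def)
  then show ?thesis
    using tangent_basis_card[OF c frame_independent(1)[OF D(1)] D(2)] frame_independent(2)[OF D(1)]
    by (simp add: distinct_card)
qed

lemma local_coframe:
  assumes "p \<in> topspace X"
  obtains W e where "openin X W" "p \<in> W" "\<And>i. i \<in> {1..7} \<Longrightarrow> smooth_form_on \<A> W 1 (e i)"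
    "\<And>q. q \<in> W \<Longrightarrow> g2_coframe (tangent_space \<A> q) (g q) (\<psi> q) (\<lambda>i. e i q)"
  using g2 assms unfolding g2_structure_def by blast

lemma coframe_frame:
  assumes "p \<in> topspace X" "g2_coframe (tangent_space \<A> p) (g p) (\<psi> p) e"
  obtains E where "g2_frame (tangent_space \<A> p) (g p) (\<psi> p) E"
    "\<And>w. w \<in> tangent_space \<A> p \<Longrightarrow> g2_frame.C (g p) E w = (\<chi> i. e (Suc (pos7 i)) [w])"
    "\<And>w1 w2 w3 w4. w1 \<in> tangent_space \<A> p \<Longrightarrow> w2 \<in> tangent_space \<A> p \<Longrightarrow> w3 \<in> tangent_space \<A> p \<Longrightarrow>
      w4 \<in> tangent_space \<A> p \<Longrightarrow> g2_dual \<A> g \<psi> p [w1, w2, w3, w4] =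
      star0 (g2_frame.C (g p) E w1) (g2_frame.C (g p) E w2) (g2_frame.C (g p) E w3) (g2_frame.C (g p) E w4)"
    "g2_dual \<A> g \<psi> p \<in> alternating_forms (tangent_space \<A> p) 4"
proof -
  note ips = ip_space_tangent[OF assms(1)]
  note len = orthonormal_basis_7[OF assms(1)]
  obtain E where E: "g2_frame (tangent_space \<A> p) (g p) (\<psi> p) E"
    and e: "\<And>i v. i \<in> {1..7} \<Longrightarrow> v \<in> tangent_space \<A> p \<Longrightarrow> e i [v] = g p v (E (of_nat i))"
    using g2_coframe_frame[OF ips len assms(2)] by metis
  have C: "g2_frame.C (g p) E w = (\<chi> i. e (Suc (pos7 i)) [w])" if "w \<in> tangent_space \<A> p" for w
  proof -
    have "e (Suc (pos7 i)) [w] = g p w (E i)" for i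
      using e[of "Suc (pos7 i)" w] that pos7_less[of i] of_nat_pos7[of i] by simp
    then show ?thesis by (simp add: g2_frame.C_def[OF E])
  qed
  show thesis
    by (rule that[OF E C]) (use hodge_dual_g2[OF ips len E assms(2)] in \<open>simp_all add: g2_dual_def\<close>)
qed

text \<open>Near each point the components of \<open>*\<psi>\<close> in a chart are
  \<open>star0\<close> applied to the components of a smooth adapted coframe, hence polynomials in
  smooth functions, although the coframe in the definition is chosen separately at each
  point.\<close>

lemma smooth_g2_dual: "smooth_form_on \<A> (topspace X) 4 (g2_dual \<A> g \<psi>)"
  unfolding smooth_form_on_def
proof (intro conjI ballI allI impI)
  fix q assume q: "q \<in> topspace X"
  then show "g2_dual \<A> g \<psi> q \<in> alternating_forms (tangent_space \<A> q) 4"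
    using local_coframe[OF q] coframe_frame[OF q] by metis
next
  fix c and us :: "(real^7) list" assume c: "c \<in> \<A>" and "length us = 4"
  then obtain u1 u2 u3 u4 where us: "us = [u1, u2, u3, u4]" by (auto simp: eval_nat_numeral length_Suc_conv)
  let ?v = "\<lambda>u x. coord_vector \<A> c u (chart_inv c x)"
  let ?F = "\<lambda>x. g2_dual \<A> g \<psi> (chart_inv c x) (map (\<lambda>u. ?v u x) us)"
  have "\<exists>T. open T \<and> x \<in> T \<and> smooth_on T ?F" if x: "x \<in> snd c ` (fst c \<inter> topspace X)" for x
  proof -
    obtain p where p: "p \<in> fst c" "p \<in> topspace X" "x = snd c p" using x by blast
    obtain W e where W: "openin X W" "p \<in> W" and sm: "\<And>i. i \<in> {1..7} \<Longrightarrow> smooth_form_on \<A> W 1 (e i)"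
      and cof: "\<And>q. q \<in> W \<Longrightarrow> g2_coframe (tangent_space \<A> q) (g q) (\<psi> q) (\<lambda>i. e i q)"
      using local_coframe[OF p(2)] by metis
    define T where "T = snd c ` (fst c \<inter> W)"
    have T: "open T" unfolding T_def by (rule chart_open[OF c W(1)])
    define f where "f u i x = e (Suc (pos7 i)) (chart_inv c x) [?v u x]" for u i x
    have "smooth_on T (f u i)" for u i
    proof -
      have "smooth_form_on \<A> W 1 (e (Suc (pos7 i)))" using pos7_less[of i] by (intro sm) simp
      from conjunct2[OF this[unfolded smooth_form_on_def], rule_format, OF c, of "[u]"]
      show ?thesis by (simp add: f_def[abs_def] T_def)
    qed
    then have sF: "smooth_on T (\<lambda>x. star0 (\<chi> i. f u1 i x) (\<chi> i. f u2 i x) (\<chi> i. f u3 i x) (\<chi> i. f u4 i x))"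
      by (intro smooth_on_star0 T)
    have "star0 (\<chi> i. f u1 i y) (\<chi> i. f u2 i y) (\<chi> i. f u3 i y) (\<chi> i. f u4 i y) = ?F y" if y: "y \<in> T" for y
    proof -
      obtain q where q: "q \<in> fst c" "q \<in> W" "y = snd c q" using y by (auto simp: T_def)
      have inv: "chart_inv c y = q" using c q by (simp add: chart_inv)
      have qX: "q \<in> topspace X" using W(1) q(2) openin_subset by blast
      have v: "?v u y \<in> tangent_space \<A> q" for u
        using coord_vector_in[of c q] c q(1) by (simp add: inv charts_at_def)
      show ?thesis
      proof (rule coframe_frame[OF qX cof[OF q(2)]])
        fix E assume C: "\<And>w. w \<in> tangent_space \<A> q \<Longrightarrow> g2_frame.C (g q) E w = (\<chi> i. e (Suc (pos7 i)) q [w])"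
          and dual: "\<And>w1 w2 w3 w4. w1 \<in> tangent_space \<A> q \<Longrightarrow> w2 \<in> tangent_space \<A> q \<Longrightarrow> w3 \<in> tangent_space \<A> q \<Longrightarrow>
            w4 \<in> tangent_space \<A> q \<Longrightarrow> g2_dual \<A> g \<psi> q [w1, w2, w3, w4] =
            star0 (g2_frame.C (g q) E w1) (g2_frame.C (g q) E w2) (g2_frame.C (g q) E w3) (g2_frame.C (g q) E w4)"
        show ?thesis using dual[OF v v v v] C[OF v] by (simp add: us f_def inv)
      qed
    qed
    from smooth_on_cong[OF T this sF] have "smooth_on T ?F" .
    moreover have "x \<in> T" using p W by (auto simp: T_def)
    ultimately show ?thesis using T by blast
  qed
  then show "smooth_on (snd c ` (fst c \<inter> topspace X)) ?F"
    unfolding smooth_on_def by (intro allI Ck_on_local) blast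
qed

theorem calibrations:
  assumes p: "p \<in> topspace X"
  defines "V \<equiv> tangent_space \<A> p"
  shows "\<xi> \<in> oriented_planes V (g p) 3 \<Longrightarrow> form_on_plane (\<psi> p) \<xi> \<le> 1"
    and "\<xi> \<in> oriented_planes V (g p) 4 \<Longrightarrow> form_on_plane (g2_dual \<A> g \<psi> p) \<xi> \<le> 1"
    and "homogeneous_orbit (g2_group V (g p) (\<psi> p)) (oriented_planes V (g p) 3) plane_action SO4
      (contact_set V (g p) 3 (\<psi> p))"
    and "homogeneous_orbit (g2_group V (g p) (\<psi> p)) (oriented_planes V (g p) 4) plane_action SO4
      (contact_set V (g p) 4 (g2_dual \<A> g \<psi> p))"
proof -
  obtain W e where "p \<in> W" and "\<And>q. q \<in> W \<Longrightarrow> g2_coframe (tangent_space \<A> q) (g q) (\<psi> q) (\<lambda>i. e i q)"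
    using local_coframe[OF p] by metis
  then have cof: "g2_coframe (tangent_space \<A> p) (g p) (\<psi> p) (\<lambda>i. e i p)" by blast
  obtain c where c: "c \<in> charts_at \<A> p" using chart_at[OF p] by blast
  have "inner_product_on (tangent_space \<A> p) (g p)" using metric p by (simp add: riemannian_metric_def)
  note h_cont = continuous_on_inner_product[OF c this]
  obtain E where E: "g2_frame (tangent_space \<A> p) (g p) (\<psi> p) E"
    and dual: "\<And>w1 w2 w3 w4. w1 \<in> tangent_space \<A> p \<Longrightarrow> w2 \<in> tangent_space \<A> p \<Longrightarrow> w3 \<in> tangent_space \<A> p \<Longrightarrow>
      w4 \<in> tangent_space \<A> p \<Longrightarrow> g2_dual \<A> g \<psi> p [w1, w2, w3, w4] =
      star0 (g2_frame.C (g p) E w1) (g2_frame.C (g p) E w2) (g2_frame.C (g p) E w3) (g2_frame.C (g p) E w4)"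
    using coframe_frame[OF p cof] by metis
  note * = g2_frame_contact_sets[OF E h_cont continuous_on_combination dual, folded V_def]
  show "\<xi> \<in> oriented_planes V (g p) 3 \<Longrightarrow> form_on_plane (\<psi> p) \<xi> \<le> 1"
    "\<xi> \<in> oriented_planes V (g p) 4 \<Longrightarrow> form_on_plane (g2_dual \<A> g \<psi> p) \<xi> \<le> 1"
    "homogeneous_orbit (g2_group V (g p) (\<psi> p)) (oriented_planes V (g p) 3) plane_action SO4
      (contact_set V (g p) 3 (\<psi> p))"
    "homogeneous_orbit (g2_group V (g p) (\<psi> p)) (oriented_planes V (g p) 4) plane_action SO4
      (contact_set V (g p) 4 (g2_dual \<A> g \<psi> p))"
    by (rule *; assumption)+
qed

end

theorem proposition3:
  fixes X :: "'a topology"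
    and \<A> :: "('a, 7) chart set"
    and g :: "'a \<Rightarrow> ('a, 7) tangent \<Rightarrow> ('a, 7) tangent \<Rightarrow> real"
    and \<psi> :: "'a \<Rightarrow> ('a, 7) tangent list \<Rightarrow> real"
  assumes "smooth_manifold X \<A>"
    and "riemannian_metric X \<A> g"
    and "g2_structure X \<A> g \<psi>"
  shows "generalized_calibration X \<A> g 3 \<psi> \<and>
    generalized_calibration X \<A> g 4 (g2_dual \<A> g \<psi>) \<and>
    (\<forall>p\<in>topspace X. \<forall>(m, \<phi>)\<in>{(3, \<psi> p), (4, g2_dual \<A> g \<psi> p)}.
       homogeneous_orbit (g2_group (tangent_space \<A> p) (g p) (\<psi> p))
         (oriented_planes (tangent_space \<A> p) (g p) m) plane_action SO4
         (contact_set (tangent_space \<A> p) (g p) m \<phi>))"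
proof -
  interpret g2_manifold X \<A> g \<psi>
    by (intro g2_manifold.intro smooth_mfd.intro g2_manifold_axioms.intro assms)
  have "smooth_form_on \<A> (topspace X) 3 \<psi>" using g2 by (simp add: g2_structure_def)
  then show ?thesis
    using smooth_g2_dual calibrations by (auto simp: generalized_calibration_def)
qed

end
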